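(* Fix $d\ge1$. Consider any observable LDS $$x_t=Ax_{t-1}+Bu_t,\qquad y_t=Cx_t,\qquad x_0=0,$$ with state dimension $d$ and instability complexity $k$. Let $(u_t)_{t\ge1}$ be any input sequence with $\|u_t\|_2\le K$ whose generated outputs $(y_t)_{t\ge1}$ are controlled: there is a constant $B_y<\infty$, independent of the horizon $T$, with $\max_{1\le t\le T}\|y_t\|_2\le B_y$ for every $T\ge1$. Choose the approximation level $$\varepsilon=\varepsilon_\star=\Theta(k+B_TA_T),\qquad A_T:=\log T+k\log(k+2),\quad B_T:=\log T+\log(k+2),$$ and set the filter count $h$ and the finite-memory length $L$ to the values given by the formulas in the context with $\varepsilon=\varepsilon_\star$. Treating the per-mode LDS parameters as constants, the filter count satisfies $$h=O\bigl(k\cdot\log T\cdot\log(\mathrm{poly}(T,k,1/\varepsilon))\bigr)=\widetilde O(k).$$ Because the autoregressive coefficients can be exponentially large ($\log L_{\mathrm{ustb}}=O(k\log k)$), the finite-memory length satisfies $$L=O\!\left(\log(k+2)\log\frac{\mathrm{poly}(T,k)\,L_{\mathrm{ustb}}^2}{\varepsilon}\right)=O\bigl(k\cdot\mathrm{polylog}(T,k,1/\varepsilon)\bigr)=\widetilde O(k).$$ Then the unified prediction algorithm (defined in the context) achieves $$\frac1T\sum_{t=1}^T\|\widehat y_t-y_t\|_2^2\le O\!\left(\frac{k^2\log^3k\,\log^3T}{T}\right)$$ using $O\bigl(p\,(k+m(L+k+1)+hm)\bigr)$ learnable parameters in total, which is $O\bigl(k\cdot\log T\cdot\mathrm{polylog}(T,k)\bigr)=\widetilde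 O(k)$ if the parameters of the LDS are treated as constants except $T,k$.
   Context: System: $A\in\mathbb R^{d\times d}$, $B\in\mathbb R^{d\times m}$, $C\in\mathbb R^{p\times d}$; observable means that $(A,C)$ is observable. Put $u_t:=0$, $y_t:=0$ for $t\le0$. "Treating the LDS parameters as constants" means that the $O$-constants may depend on the parameters of the system other than $T$ and $k$. $\widetilde O$ hides polylogarithmic factors. Instability complexity: the smallest integer $k\ge0$ such that at most $k$ eigenvalues of $A$ (over $\mathbb C$, counted with algebraic multiplicity) either lie outside the real interval $(-1,1)$ with $|\lambda_i|>1-1/\log(k+2)$, or are non-semisimple; it is set to $1$ when no eigenvalue satisfies these conditions. Spectral filters: for $\alpha\in(-1,1)$ let $\mu_\alpha=(1,\alpha,\dots,\alpha^{T-1})^\top$ and $Z=\int_{-1}^1\mu_\alpha\mu_\alpha^\top\,d\alpha\in\mathbb R^{T\times T}$; $\phi_1,\dots,\phi_T\in\mathbb R^T$ are the orthonormal eigenvectors of $Z$, with corresponding eigenvalues $\sigma_1,\dots,\sigma_T$ ordered so that $1>|\sigma_1|\ge\cdots\ge|\sigma_T|>0$ (the condition as the paper states it). Input history: $\tilde u_t:=(u_t,u_{t-1},\dots,u_1,0,\dots,0)\in\mathbb R^{m\times T}$. Unified prediction algorithm, with filter count $h$ and finite-memory length $L$: run one copy of the Vovk–Azoury–Warmuth (VAW) forecaster of feature dimension $d_{\mathrm{feat}}=k+m(L+k+1)+hm$ for each output coordinate $i\in\{1,\dots,p\}$. At time $t=1,\dots,T$, observe $u_t$ and form $a_{t,i}=[Y_{t,i}^\top\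 F_t^\top\ \tilde U_t^\top]^\top$, where $Y_{t,i}=((y_{t-1})_i,\dots,(y_{t-k})_i)^\top$, $F_t=(u_t^\top,\dots,u_{t-(L+k)}^\top)^\top$, $\tilde U_t=((\tilde u_t\phi_1)^\top,\dots,(\tilde u_t\phi_h)^\top)^\top$. The $i$-th coordinate of the prediction $\widehat y_t$ is the output of the $i$-th copy on $a_{t,i}$; then $y_t$ is observed and the $i$-th copy is updated with label $(y_t)_i$. VAW with regularization parameter $\lambda>0$: start with $G_0=\lambda I$, $v_0=0$; on feature $a_t$ set $G_t=G_{t-1}+a_ta_t^\top$ and predict $a_t^\top G_t^{-1}v_{t-1}$; on label $b_t$ set $v_t=v_{t-1}+b_ta_t$. Formulas for $h$ and $L$: let $\tau_k=\log(k+2)$. Let $\mu_1,\dots,\mu_q$ ($q\le k$) be the eigenvalues of $A$ that are non-semisimple, or semisimple and outside $(-1,1)$ with modulus $>1-1/\tau_k$; let $\lambda_1,\dots,\lambda_r$ be the real semisimple eigenvalues with $1-1/\tau_k<|\lambda_a|<1$ (all with algebraic multiplicity); the remaining eigenvalues are semisimple of modulus at most $1-1/\tau_k$. Take a real block diagonalization $A=P\operatorname{diag}(\Lambda,A_{\mathrm{ustb}},A_{\mathrm{fast}})P^{-1}$ with $P\in\mathrm{GL}_d(\mathbb R)$, $\Lambda=\operatorname{diag}(\lambda_1,\dots,\lambda_r)$, $A_{\mathrm{ustb}}\in\mathbb R^{q\times q}$ with eigenvalues $\mu_1,\dots,\mu_q$, and $A_{\mathrm{fast}}$ with the remaining eigenvalues.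 Let $B_{\mathrm{st}},B_{\mathrm{ustb}},B_{\mathrm{fast}}$ be the corresponding row blocks of $P^{-1}B$ and $C_{\mathrm{st}},C_{\mathrm{ustb}},C_{\mathrm{fast}}$ the corresponding column blocks of $CP$. Let $$L_{\mathrm{ustb}}=\Bigl(\prod_{j=1}^q(1+|\mu_j|)\Bigr)\Bigl(1+k\|C_{\mathrm{ustb}}\|_\infty\|B_{\mathrm{ustb}}\|_\infty\max\{1,\|A_{\mathrm{ustb}}\|_\infty\}^{\max\{q-1,0\}}\Bigr),\quad \widetilde L_{\mathrm{ustb}}=(1+kL_{\mathrm{ustb}})(1-1/\tau_k)^{-k},$$ and $C_{\mathrm{fast},0}=\|C_{\mathrm{fast}}V\|\,\|V^{-1}B_{\mathrm{fast}}\|$ for a diagonalization $A_{\mathrm{fast}}=VDV^{-1}$ over $\mathbb C$ ($C_{\mathrm{fast},0}=0$ if this block is empty). Then $$h=\Bigl\lceil2\log T\cdot\log\frac{4\pi K^2\widetilde L_{\mathrm{ustb}}^2\|C_{\mathrm{st}}\|_F^2\|B_{\mathrm{st}}\|_F^2T^6(1+kL_{\mathrm{ustb}})^2}{\varepsilon}\Bigr\rceil,\quad L=\Bigl\lceil\tau_k\log\frac{(1+C_{\mathrm{fast},0})K(1+\tau_k)T(1+kL_{\mathrm{ustb}})^2}{\varepsilon}\Bigr\rceil.$$ Here $\|\cdot\|_F$ is the Frobenius norm, $\|\cdot\|_\infty$ on matrices is the induced $\infty$-norm, and $\|\cdot\|$ is the spectral norm.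
   Formalization: log k in the error bound is read as log(k+2) and T≥2 is assumed (otherwise the bound is 0 at k=1 or T=1); the impossible condition 1>|σ_1| is dropped; λ is a suitable λ(T,k) for uniform constants, or any fixed λ with a constant depending on the system and λ. *)

theory Defs
  imports
    "HOL-Analysis.L2_Norm"
    "HOL-Analysis.Henstock_Kurzweil_Integration"
    "Jordan_Normal_Form.Matrix"
    "Jordan_Normal_Form.Matrix_Kernel"
    "Jordan_Normal_Form.Char_Poly"
    "Jordan_Normal_Form.Gauss_Jordan_Elimination"
    "Jordan_Normal_Form.DL_Rank"
begin

unbundle no vec_syntax
unbundle no inner_syntax

section \<open>Norms\<close>

definition l2norm :: "'a::real_normed_vector vec \<Rightarrow> real" where
  "l2norm v = L2_set (\<lambda>i. norm (v $ i)) {..<dim_vec v}"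

definition frob_norm :: "real mat \<Rightarrow> real" where
  "frob_norm M = L2_set (\<lambda>ij. M $$ ij) ({..<dim_row M} \<times> {..<dim_col M})"

text \<open>The 0 inserted below makes the norm of a matrix without rows equal to 0.\<close>

definition inf_norm :: "real mat \<Rightarrow> real" where
  "inf_norm M = Max (insert 0 ((\<lambda>i. \<Sum>j<dim_col M. \<bar>M $$ (i, j)\<bar>) ` {..<dim_row M}))"

definition spectral_norm :: "complex mat \<Rightarrow> real" where
  "spectral_norm M = Sup {l2norm (M *\<^sub>v x) | x. x \<in> carrier_vec (dim_col M) \<and> l2norm x \<le> 1}"

section \<open>Linear dynamical systems\<close>

primrec lds_state :: "nat \<Rightarrow> real mat \<Rightarrow> real mat \<Rightarrow> (nat \<Rightarrow> real vec) \<Rightarrow> nat \<Rightarrow> real vec" where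
  "lds_state d A B u 0 = 0\<^sub>v d"
| "lds_state d A B u (Suc t) = A *\<^sub>v lds_state d A B u t + B *\<^sub>v u (Suc t)"

definition lds_output ::
  "nat \<Rightarrow> real mat \<Rightarrow> real mat \<Rightarrow> real mat \<Rightarrow> (nat \<Rightarrow> real vec) \<Rightarrow> nat \<Rightarrow> real vec" where
  "lds_output d A B C u t = C *\<^sub>v lds_state d A B u t"

text \<open>The observability matrix stacks \<open>C, C A, \<dots>, C A^(d-1)\<close>.\<close>

definition observability_matrix :: "nat \<Rightarrow> nat \<Rightarrow> real mat \<Rightarrow> real mat \<Rightarrow> real mat" where
  "observability_matrix d p A C =
     mat (d * p) d (\<lambda>(i, j). (C * A ^\<^sub>m (i div p)) $$ (i mod p, j))"

definition observable :: "nat \<Rightarrow> nat \<Rightarrow> real mat \<Rightarrow> real mat \<Rightarrow> bool" where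
  "observable d p A C \<longleftrightarrow> vec_space.rank (d * p) (observability_matrix d p A C) = d"

definition controlled_run ::
  "nat \<Rightarrow> nat \<Rightarrow> real mat \<Rightarrow> real mat \<Rightarrow> real mat \<Rightarrow> real \<Rightarrow> real \<Rightarrow> (nat \<Rightarrow> real vec) \<Rightarrow> bool" where
  "controlled_run d m A B C K By u \<longleftrightarrow>
     (\<forall>t\<ge>1. u t \<in> carrier_vec m \<and> l2norm (u t) \<le> K) \<and>
     (\<forall>T\<ge>1. \<forall>t\<in>{1..T}. l2norm (lds_output d A B C u t) \<le> By)"

section \<open>Eigenvalue classes and instability complexity\<close>

abbreviation cmat :: "real mat \<Rightarrow> complex mat" where
  "cmat \<equiv> map_mat complex_of_real"

definition alg_mult :: "real mat \<Rightarrow> complex \<Rightarrow> nat" where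
  "alg_mult A z = order z (char_poly (cmat A))"

definition geo_mult :: "real mat \<Rightarrow> complex \<Rightarrow> nat" where
  "geo_mult A z = kernel_dim (char_matrix (cmat A) z)"

definition semisimple :: "real mat \<Rightarrow> complex \<Rightarrow> bool" where
  "semisimple A z \<longleftrightarrow> geo_mult A z = alg_mult A z"

definition tau :: "nat \<Rightarrow> real" where
  "tau k = ln (real k + 2)"

definition unstable_eigs :: "nat \<Rightarrow> real mat \<Rightarrow> complex set" where
  "unstable_eigs k A = {z. eigenvalue (cmat A) z \<and>
     ((z \<notin> complex_of_real ` {-1<..<1} \<and> cmod z > 1 - 1 / tau k) \<or> \<not> semisimple A z)}"

definition slow_eigs :: "nat \<Rightarrow> real mat \<Rightarrow> complex set" where
  "slow_eigs k A = {z. eigenvalue (cmat A) z \<and> semisimple A z \<and>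
     z \<in> complex_of_real ` {x. 1 - 1 / tau k < \<bar>x\<bar> \<and> \<bar>x\<bar> < 1}}"

definition fast_eigs :: "nat \<Rightarrow> real mat \<Rightarrow> complex set" where
  "fast_eigs k A = {z. eigenvalue (cmat A) z} - unstable_eigs k A - slow_eigs k A"

text \<open>
  The least \<open>k\<close> is 0 exactly when no eigenvalue satisfies the condition (at \<open>k = 0\<close>);
  the maximum then resets the value to 1.
\<close>

definition instability_complexity :: "real mat \<Rightarrow> nat" where
  "instability_complexity A = max 1 (LEAST k. (\<Sum>z\<in>unstable_eigs k A. alg_mult A z) \<le> k)"

definition lds_system ::
  "nat \<Rightarrow> nat \<Rightarrow> nat \<Rightarrow> real mat \<Rightarrow> real mat \<Rightarrow> real mat \<Rightarrow> nat \<Rightarrow> bool" where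
  "lds_system d m p A B C k \<longleftrightarrow>
     d \<ge> 1 \<and> A \<in> carrier_mat d d \<and> B \<in> carrier_mat d m \<and> C \<in> carrier_mat p d \<and>
     observable d p A C \<and> k = instability_complexity A"

section \<open>Block decomposition\<close>

definition row_block :: "nat \<Rightarrow> nat \<Rightarrow> 'a mat \<Rightarrow> 'a mat" where
  "row_block s n M = mat n (dim_col M) (\<lambda>(i, j). M $$ (s + i, j))"

definition col_block :: "nat \<Rightarrow> nat \<Rightarrow> 'a mat \<Rightarrow> 'a mat" where
  "col_block s n M = mat (dim_row M) n (\<lambda>(i, j). M $$ (i, s + j))"

definition block_diagonalization ::
  "nat \<Rightarrow> real mat \<Rightarrow> real mat \<Rightarrow> real mat \<Rightarrow> real mat \<Rightarrow> real mat \<Rightarrow> real mat \<Rightarrow> bool" where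
  "block_diagonalization k A \<Lambda> Au Af P Q \<longleftrightarrow>
     square_mat \<Lambda> \<and> square_mat Au \<and> square_mat Af \<and> diagonal_mat \<Lambda> \<and>
     similar_mat_wit A (diag_block_mat [\<Lambda>, Au, Af]) P Q \<and>
     (\<forall>z. alg_mult \<Lambda> z = (if z \<in> slow_eigs k A then alg_mult A z else 0)) \<and>
     (\<forall>z. alg_mult Au z = (if z \<in> unstable_eigs k A then alg_mult A z else 0)) \<and>
     (\<forall>z. alg_mult Af z = (if z \<in> fast_eigs k A then alg_mult A z else 0))"

text \<open>
  The real block diagonalization together with the corresponding row blocks of \<open>P\<^sup>-\<^sup>1 B\<close>,
  column blocks of \<open>C P\<close>, and a complex diagonalization \<open>V D V\<^sup>-\<^sup>1\<close> of the fast block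
  (\<open>Q\<close> and \<open>W\<close> are the inverses of \<open>P\<close> and \<open>V\<close>).
\<close>

definition lds_blocks ::
  "nat \<Rightarrow> real mat \<Rightarrow> real mat \<Rightarrow> real mat \<Rightarrow> real mat \<Rightarrow>
   real mat \<Rightarrow> real mat \<Rightarrow> real mat \<Rightarrow> real mat \<Rightarrow> real mat \<Rightarrow> real mat \<Rightarrow>
   complex mat \<Rightarrow> complex mat \<Rightarrow> bool" where
  "lds_blocks k A B C Au Bst Bu Bf Cst Cu Cf V W \<longleftrightarrow>
     (\<exists>\<Lambda> Af P Q D. block_diagonalization k A \<Lambda> Au Af P Q \<and>
        (let r = dim_row \<Lambda>; q = dim_row Au; s = dim_row Af in
          Bst = row_block 0 r (Q * B) \<and> Bu = row_block r q (Q * B) \<and> Bf = row_block (r + q) s (Q * B) \<and>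
          Cst = col_block 0 r (C * P) \<and> Cu = col_block r q (C * P) \<and> Cf = col_block (r + q) s (C * P)) \<and>
        similar_mat_wit (cmat Af) D V W \<and> diagonal_mat D)"

definition L_ustb :: "nat \<Rightarrow> real mat \<Rightarrow> real mat \<Rightarrow> real mat \<Rightarrow> real mat \<Rightarrow> real" where
  "L_ustb k A Au Bu Cu =
     (\<Prod>z\<in>unstable_eigs k A. (1 + cmod z) ^ alg_mult A z) *
     (1 + real k * inf_norm Cu * inf_norm Bu * max 1 (inf_norm Au) ^ (dim_row Au - 1))"

definition L_tilde :: "nat \<Rightarrow> real \<Rightarrow> real" where
  "L_tilde k Lu = (1 + real k * Lu) / (1 - 1 / tau k) ^ k"

definition fast_gain :: "real mat \<Rightarrow> real mat \<Rightarrow> complex mat \<Rightarrow> complex mat \<Rightarrow> real" where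
  "fast_gain Bf Cf V W = spectral_norm (cmat Cf * V) * spectral_norm (W * cmat Bf)"

text \<open>
  Entrywise bound on the unstable block; the induced norms inside \<^const>\<open>L_ustb\<close> may thus grow
  linearly with \<open>k\<close>, which is the regime in which \<open>ln L_ustb\<close> is of order \<open>k ln k\<close>.
\<close>

definition mode_bound ::
  "real \<Rightarrow> real mat \<Rightarrow> real mat \<Rightarrow> real mat \<Rightarrow> real mat \<Rightarrow> real mat \<Rightarrow> real mat \<Rightarrow> real mat \<Rightarrow>
   complex mat \<Rightarrow> complex mat \<Rightarrow> bool" where
  "mode_bound M Au Bst Bu Bf Cst Cu Cf V W \<longleftrightarrow>
     (\<forall>x \<in> elements_mat Au \<union> elements_mat Bu \<union> elements_mat Cu. \<bar>x\<bar> \<le> M) \<and>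
     frob_norm Bst \<le> M \<and> frob_norm Cst \<le> M \<and> fast_gain Bf Cf V W \<le> M"

section \<open>Tuning\<close>

text \<open>
  Both counts are naturals: a negative ceiling becomes 0. Since \<open>ln 0 = 0\<close>, they are also 0
  when the argument of the logarithm vanishes.
\<close>

definition filter_count :: "nat \<Rightarrow> nat \<Rightarrow> real \<Rightarrow> real \<Rightarrow> real mat \<Rightarrow> real mat \<Rightarrow> real \<Rightarrow> nat" where
  "filter_count T k K Lu Bst Cst \<epsilon> =
     nat \<lceil>2 * ln (real T) *
       ln (4 * pi * K\<^sup>2 * (L_tilde k Lu)\<^sup>2 * (frob_norm Cst)\<^sup>2 * (frob_norm Bst)\<^sup>2 *
           real T ^ 6 * (1 + real k * Lu)\<^sup>2 / \<epsilon>)\<rceil>"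

definition memory_length :: "nat \<Rightarrow> nat \<Rightarrow> real \<Rightarrow> real \<Rightarrow> real \<Rightarrow> real \<Rightarrow> nat" where
  "memory_length T k K Lu Cf0 \<epsilon> =
     nat \<lceil>tau k * ln ((1 + Cf0) * K * (1 + tau k) * real T * (1 + real k * Lu)\<^sup>2 / \<epsilon>)\<rceil>"

definition logA :: "nat \<Rightarrow> nat \<Rightarrow> real" where
  "logA T k = ln (real T) + real k * ln (real k + 2)"

definition logB :: "nat \<Rightarrow> nat \<Rightarrow> real" where
  "logB T k = ln (real T) + ln (real k + 2)"

definition approx_levels :: "real \<Rightarrow> real \<Rightarrow> nat \<Rightarrow> nat \<Rightarrow> real set" where
  "approx_levels c\<^sub>1 c\<^sub>2 T k =
     {c\<^sub>1 * (real k + logB T k * logA T k) .. c\<^sub>2 * (real k + logB T k * logA T k)}"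

section \<open>Spectral filters\<close>

definition filter_matrix :: "nat \<Rightarrow> real mat" where
  "filter_matrix T = mat T T (\<lambda>(i, j). integral {-1..1} (\<lambda>\<alpha>. \<alpha> ^ i * \<alpha> ^ j))"

text \<open>
  Filters are indexed from 0. No upper bound on \<open>\<bar>\<sigma> 0\<bar>\<close> is imposed: the top left entry of
  the matrix is 2, so its largest eigenvalue is at least 2.
\<close>

definition spectral_filters :: "nat \<Rightarrow> (nat \<Rightarrow> real vec) \<Rightarrow> (nat \<Rightarrow> real) \<Rightarrow> bool" where
  "spectral_filters T \<phi> \<sigma> \<longleftrightarrow>
     (\<forall>j<T. \<phi> j \<in> carrier_vec T \<and> filter_matrix T *\<^sub>v \<phi> j = \<sigma> j \<cdot>\<^sub>v \<phi> j) \<and>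
     (\<forall>i<T. \<forall>j<T. \<phi> i \<bullet> \<phi> j = (if i = j then 1 else 0)) \<and>
     (\<forall>i j. i \<le> j \<and> j < T \<longrightarrow> \<bar>\<sigma> i\<bar> \<ge> \<bar>\<sigma> j\<bar>) \<and>
     (\<forall>j<T. \<bar>\<sigma> j\<bar> > 0)"

section \<open>The Vovk--Azoury--Warmuth forecaster\<close>

text \<open>Features \<open>a t\<close> and labels \<open>b t\<close> are used for \<open>t \<ge> 1\<close>; \<open>n\<close> is the feature dimension.\<close>

primrec vaw_G :: "real \<Rightarrow> nat \<Rightarrow> (nat \<Rightarrow> real vec) \<Rightarrow> nat \<Rightarrow> real mat" where
  "vaw_G lam n a 0 = lam \<cdot>\<^sub>m 1\<^sub>m n"
| "vaw_G lam n a (Suc t) = vaw_G lam n a t + mat n n (\<lambda>(i, j). a (Suc t) $ i * a (Suc t) $ j)"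

primrec vaw_v :: "nat \<Rightarrow> (nat \<Rightarrow> real vec) \<Rightarrow> (nat \<Rightarrow> real) \<Rightarrow> nat \<Rightarrow> real vec" where
  "vaw_v n a b 0 = 0\<^sub>v n"
| "vaw_v n a b (Suc t) = vaw_v n a b t + b (Suc t) \<cdot>\<^sub>v a (Suc t)"

definition vaw_weights ::
  "real \<Rightarrow> nat \<Rightarrow> (nat \<Rightarrow> real vec) \<Rightarrow> (nat \<Rightarrow> real) \<Rightarrow> nat \<Rightarrow> real vec" where
  "vaw_weights lam n a b t = the (mat_inverse (vaw_G lam n a t)) *\<^sub>v vaw_v n a b (t - 1)"

definition vaw_predict ::
  "real \<Rightarrow> nat \<Rightarrow> (nat \<Rightarrow> real vec) \<Rightarrow> (nat \<Rightarrow> real) \<Rightarrow> nat \<Rightarrow> real" where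
  "vaw_predict lam n a b t = a t \<bullet> vaw_weights lam n a b t"

section \<open>The unified prediction algorithm\<close>

text \<open>The value at time \<open>t - j\<close> of a sequence that starts at time 1 and is 0 before.\<close>

definition lagged :: "(nat \<Rightarrow> real vec) \<Rightarrow> nat \<Rightarrow> nat \<Rightarrow> nat \<Rightarrow> real vec" where
  "lagged f n t j = (if j < t then f (t - j) else 0\<^sub>v n)"

definition input_history :: "nat \<Rightarrow> nat \<Rightarrow> (nat \<Rightarrow> real vec) \<Rightarrow> nat \<Rightarrow> real mat" where
  "input_history m T u t = mat m T (\<lambda>(i, j). lagged u m t j $ i)"

definition output_feature :: "nat \<Rightarrow> nat \<Rightarrow> (nat \<Rightarrow> real vec) \<Rightarrow> nat \<Rightarrow> nat \<Rightarrow> real vec" where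
  "output_feature p k y t i = vec k (\<lambda>j. lagged y p t (Suc j) $ i)"

definition input_feature :: "nat \<Rightarrow> nat \<Rightarrow> nat \<Rightarrow> (nat \<Rightarrow> real vec) \<Rightarrow> nat \<Rightarrow> real vec" where
  "input_feature m k L u t = vec (m * (L + k + 1)) (\<lambda>j. lagged u m t (j div m) $ (j mod m))"

text \<open>There are only \<open>T\<close> filters; components for filter indices from \<open>T\<close> on are set to 0.\<close>

definition filter_feature ::
  "nat \<Rightarrow> nat \<Rightarrow> nat \<Rightarrow> (nat \<Rightarrow> real vec) \<Rightarrow> (nat \<Rightarrow> real vec) \<Rightarrow> nat \<Rightarrow> real vec" where
  "filter_feature m h T \<phi> u t =
     vec (h * m) (\<lambda>j. if j div m < T then (input_history m T u t *\<^sub>v \<phi> (j div m)) $ (j mod m) else 0)"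

definition feat_dim :: "nat \<Rightarrow> nat \<Rightarrow> nat \<Rightarrow> nat \<Rightarrow> nat" where
  "feat_dim m k L h = k + m * (L + k + 1) + h * m"

definition unified_feature ::
  "nat \<Rightarrow> nat \<Rightarrow> nat \<Rightarrow> nat \<Rightarrow> nat \<Rightarrow> nat \<Rightarrow> (nat \<Rightarrow> real vec) \<Rightarrow>
   (nat \<Rightarrow> real vec) \<Rightarrow> (nat \<Rightarrow> real vec) \<Rightarrow> nat \<Rightarrow> nat \<Rightarrow> real vec" where
  "unified_feature m p k L h T \<phi> u y i t =
     output_feature p k y t i @\<^sub>v input_feature m k L u t @\<^sub>v filter_feature m h T \<phi> u t"

lemma dim_unified_feature [simp]:
  "dim_vec (unified_feature m p k L h T \<phi> u y i t) = feat_dim m k L h"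
  by (simp add: unified_feature_def output_feature_def input_feature_def filter_feature_def
      feat_dim_def)

definition unified_weights ::
  "nat \<Rightarrow> nat \<Rightarrow> nat \<Rightarrow> nat \<Rightarrow> nat \<Rightarrow> nat \<Rightarrow> (nat \<Rightarrow> real vec) \<Rightarrow> real \<Rightarrow>
   (nat \<Rightarrow> real vec) \<Rightarrow> (nat \<Rightarrow> real vec) \<Rightarrow> nat \<Rightarrow> nat \<Rightarrow> real vec" where
  "unified_weights m p k L h T \<phi> lam u y i t =
     vaw_weights lam (feat_dim m k L h) (unified_feature m p k L h T \<phi> u y i) (\<lambda>s. y s $ i) t"

definition unified_predict ::
  "nat \<Rightarrow> nat \<Rightarrow> nat \<Rightarrow> nat \<Rightarrow> nat \<Rightarrow> nat \<Rightarrow> (nat \<Rightarrow> real vec) \<Rightarrow> real \<Rightarrow>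
   (nat \<Rightarrow> real vec) \<Rightarrow> (nat \<Rightarrow> real vec) \<Rightarrow> nat \<Rightarrow> real vec" where
  "unified_predict m p k L h T \<phi> lam u y t = vec p (\<lambda>i.
     vaw_predict lam (feat_dim m k L h) (unified_feature m p k L h T \<phi> u y i) (\<lambda>s. y s $ i) t)"

definition avg_error ::
  "nat \<Rightarrow> nat \<Rightarrow> nat \<Rightarrow> nat \<Rightarrow> nat \<Rightarrow> nat \<Rightarrow> (nat \<Rightarrow> real vec) \<Rightarrow> real \<Rightarrow>
   (nat \<Rightarrow> real vec) \<Rightarrow> (nat \<Rightarrow> real vec) \<Rightarrow> real" where
  "avg_error m p k L h T \<phi> lam u y =
     1 / real T * (\<Sum>t = 1..T. (l2norm (unified_predict m p k L h T \<phi> lam u y t - y t))\<^sup>2)"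

definition learnable_params ::
  "nat \<Rightarrow> nat \<Rightarrow> nat \<Rightarrow> nat \<Rightarrow> nat \<Rightarrow> nat \<Rightarrow> (nat \<Rightarrow> real vec) \<Rightarrow> real \<Rightarrow>
   (nat \<Rightarrow> real vec) \<Rightarrow> (nat \<Rightarrow> real vec) \<Rightarrow> nat" where
  "learnable_params m p k L h T \<phi> lam u y =
     (\<Sum>i<p. dim_vec (unified_weights m p k L h T \<phi> lam u y i T))"

end

theory Submission
  imports
    Defs
    "Jordan_Normal_Form.Determinant"
    "HOL-Analysis.Harmonic_Numbers"
    "HOL-Analysis.Complex_Transcendental"
    "HOL-Computational_Algebra.Fundamental_Theorem_Algebra"
begin

unbundle no vec_syntax
unbundle no inner_syntax

text \<open>
  Write \<open>A = log T + k log (k + 2)\<close> and \<open>B = log T + log (k + 2)\<close>. Some fixed weight vector of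
  the algorithm predicts well: the autoregressive part uses the characteristic polynomial of the
  unstable block, which by Cayley--Hamilton reduces the unstable modes to finitely many inputs; the
  fast modes are geometrically small beyond the finite memory; the slow modes contribute moment
  vectors \<open>(1, \<alpha>, \<alpha>\<^sup>2, \<dots>)\<close>, which the leading filters capture. For the latter, Taylor expansions
  on a dyadic cover of \<open>[-1, 1]\<close> approximate the moment curve by few vectors, so that the
  eigenvalues of the filter matrix decay geometrically in \<open>h / log T\<close>. The cumulative squared error
  of this vector is \<open>O(A\<^sup>2)\<close> as soon as \<open>T \<ge> B\<^sup>2\<close>; for smaller \<open>T\<close> the zero vector is good enough,
  because the outputs are bounded.

  The regret of the forecaster against that vector is governed by a log determinant and is at most
  the feature dimension, which is \<open>O(B A)\<close>, times \<open>A + log (1 / \<lambda>)\<close>. The squared norm of the vector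
  is \<open>exp (O(A))\<close>, so \<open>\<lambda> = exp (- c A)\<close> gives \<open>O(B A\<^sup>2)\<close> in total.
\<close>

section \<open>Regret of the Vovk--Azoury--Warmuth forecaster\<close>

text \<open>The tight point is the factor 2 log T in h. Let X be the squared norm of the projection
  of a moment vector onto the filters from h on. A mean square bound gives only X^3 = O(T^3
  \<sigma>^2) at a single point, so two thirds of the exponent of \<sigma>^2 per power of \<sigma>
  survive. With about log_2 T cells on either side of 0 and Taylor remainders of size 3^-N, where N
  is about h / (2 log_2 T), the exponent becomes 4/3 ln 2 ln 3 times h / (2 log T). The formula for
  h asks for h / (2 log T), and 4/3 ln 2 ln 3 is about 1.015. Rounding fits into this margin only
  from some threshold on T; below it the zero vector serves again.

  Dividing by \<open>lam a ^ q\<close> and the autoregressive coefficients make the weights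
  exponentially large, and slow eigenvalues may lie arbitrarily close to 1. A constant valid for all
  systems therefore goes with an exponentially small regularization, while for one system the
  coordinates of the comparator stay bounded in T and every fixed regularization works. Both cases
  come from one estimate that leaves the regularization and the norm of the slow moment vectors
  open.\<close>

lemma arg_cong4: "a = a' \<Longrightarrow> b = b' \<Longrightarrow> c = c' \<Longrightarrow> d = d' \<Longrightarrow> f a b c d = f a' b' c' d'"
  by simp

section \<open>Determinants: rank-one perturbations and a crude bound\<close>

lemma outer_mult_vec:
  fixes u v z :: "real vec"
  assumes "u \<in> carrier_vec n" "v \<in> carrier_vec n" "z \<in> carrier_vec n"
  shows "mat n n (\<lambda>(i, j). u $ i * v $ j) *\<^sub>v z = (v \<bullet> z) \<cdot>\<^sub>v u"
  using assms by (intro eq_vecI)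
    (auto simp: scalar_prod_def sum_distrib_left sum_distrib_right algebra_simps)

text \<open>Sylvester's determinant identity for one column. The products \<open>M * E\<close> and
  \<open>E * M\<close> have the same determinant, and both are block triangular: one has the
  diagonal blocks \<open>R\<close> and 1, the other has 1 and the scalar \<open>S\<close>.\<close>

lemma det_one_minus_outer:
  fixes u v :: "real vec"
  assumes u: "u \<in> carrier_vec n" and v: "v \<in> carrier_vec n"
  shows "det (1\<^sub>m n - mat n n (\<lambda>(i, j). u $ i * v $ j)) = 1 - v \<bullet> u"
proof -
  define U where "U = mat n 1 (\<lambda>(i, j). u $ i)"
  define V where "V = mat 1 n (\<lambda>(i, j). v $ j)"
  define S where "S = mat 1 1 (\<lambda>_. 1 - v \<bullet> u)"
  define R where "R = 1\<^sub>m n - mat n n (\<lambda>(i, j). u $ i * v $ j)"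
  have c: "U \<in> carrier_mat n 1" "V \<in> carrier_mat 1 n" "S \<in> carrier_mat 1 1" "R \<in> carrier_mat n n"
    by (simp_all add: U_def V_def S_def R_def minus_carrier_mat)
  define M where "M = four_block_mat (1\<^sub>m n) U V (1\<^sub>m 1)"
  define E where "E = four_block_mat (1\<^sub>m n) (0\<^sub>m n 1) (- V) (1\<^sub>m 1)"
  have UV: "1\<^sub>m n + U * - V = R"
    by (rule eq_matI) (auto simp: U_def V_def R_def scalar_prod_def)
  have VU: "- V * U + 1\<^sub>m 1 = S"
    by (rule eq_matI) (use u v in \<open>auto simp: U_def V_def S_def scalar_prod_def sum_negf\<close>)
  have cM: "M \<in> carrier_mat (n + 1) (n + 1)" and cE: "E \<in> carrier_mat (n + 1) (n + 1)"
    unfolding M_def E_def by (rule four_block_carrier_mat; simp add: c)+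
  have "det E = 1"
    unfolding E_def using c(2) by (subst det_four_block_mat_upper_right_zero[of _ n _ 1]) auto
  have mV: "- V \<in> carrier_mat 1 n" using c(2) by simp
  note one = one_carrier_mat[of n] one_carrier_mat[of 1]
  have "M * E = four_block_mat (1\<^sub>m n * 1\<^sub>m n + U * - V) (1\<^sub>m n * 0\<^sub>m n 1 + U * 1\<^sub>m 1)
    (V * 1\<^sub>m n + 1\<^sub>m 1 * - V) (V * 0\<^sub>m n 1 + 1\<^sub>m 1 * 1\<^sub>m 1)"
    unfolding M_def E_def
    by (rule mult_four_block_mat[OF one(1) c(1,2) one(2) one(1) zero_carrier_mat mV one(2)])
  also have "\<dots> = four_block_mat R U (0\<^sub>m 1 n) (1\<^sub>m 1)"
    by (rule arg_cong4[where f = four_block_mat])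
      (use c UV in \<open>auto simp del: One_nat_def simp: right_mult_one_mat[OF c(1)] left_mult_one_mat[OF mV]
        right_mult_one_mat[OF c(2)] right_mult_zero_mat[OF c(2)]\<close>)
  finally have 1: "det M * det E = det R"
    using det_mult[OF cM cE] det_four_block_mat_lower_left_zero[OF c(4) c(1) refl one(2)]
    by simp
  have "E * M = four_block_mat (1\<^sub>m n * 1\<^sub>m n + 0\<^sub>m n 1 * V) (1\<^sub>m n * U + 0\<^sub>m n 1 * 1\<^sub>m 1)
    (- V * 1\<^sub>m n + 1\<^sub>m 1 * V) (- V * U + 1\<^sub>m 1 * 1\<^sub>m 1)"
    unfolding M_def E_def
    by (rule mult_four_block_mat[OF one(1) zero_carrier_mat mV one(2) one(1) c(1,2) one(2)])
  also have "\<dots> = four_block_mat (1\<^sub>m n) U (0\<^sub>m 1 n) S"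
    by (rule arg_cong4[where f = four_block_mat])
      (use c VU in \<open>auto simp del: One_nat_def simp: left_mult_one_mat[OF c(1)] left_mult_one_mat[OF c(2)]
        right_mult_one_mat[OF mV] left_mult_zero_mat[OF c(2)]\<close>)
  finally have 2: "det E * det M = det S"
    using det_mult[OF cE cM] det_four_block_mat_lower_left_zero[OF one(1) c(1) refl c(3)]
    by simp
  have "det S = 1 - v \<bullet> u"
    by (subst det_single) (auto simp: S_def)
  then show ?thesis using 1 2 by (simp add: R_def mult.commute)
qed

text \<open>Leibniz formula with n! \<le> n^n terms. The bound is used under a logarithm, where the
  factor n^n costs only n ln n.\<close>

lemma abs_det_le:
  fixes G :: "real mat"
  assumes G: "G \<in> carrier_mat n n" and b: "\<And>i j. i < n \<Longrightarrow> j < n \<Longrightarrow> \<bar>G $$ (i, j)\<bar> \<le> b"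
  shows "\<bar>det G\<bar> \<le> (real n * b) ^ n"
proof (cases "n = 0")
  case False
  then have b0: "0 \<le> b" using b[of 0 0] by simp
  have "\<bar>det G\<bar> \<le> (\<Sum>p | p permutes {0..<n}. \<bar>signof p * (\<Prod>i = 0..<n. G $$ (i, p i))\<bar>)"
    unfolding det_def'[OF G] by (rule sum_abs)
  also have "\<dots> \<le> (\<Sum>p | p permutes {0..<n}. b ^ n)"
  proof (rule sum_mono)
    fix p assume "p \<in> {p. p permutes {0..<n}}"
    then have p: "p permutes {0..<n}" by simp
    have "(\<Prod>i = 0..<n. \<bar>G $$ (i, p i)\<bar>) \<le> (\<Prod>i = 0..<n. b)"
      using permutes_in_image[OF p] by (intro prod_mono) (auto intro!: b)
    then show "\<bar>signof p * (\<Prod>i = 0..<n. G $$ (i, p i))\<bar> \<le> b ^ n"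
      by (simp add: abs_mult abs_prod sign_def)
  qed
  also have "\<dots> = fact n * b ^ n"
    by (simp add: card_permutations)
  also have "\<dots> \<le> real n ^ n * b ^ n"
    using fact_le_power[of n, where 'a = real] b0 by (intro mult_right_mono) auto
  finally show ?thesis by (simp add: power_mult_distrib)
qed (use G in simp)

lemma scalar_prod_self_pos:
  fixes x :: "real vec"
  assumes "x \<in> carrier_vec n" "x \<noteq> 0\<^sub>v n"
  shows "0 < x \<bullet> x"
  using assms conjugate_square_greater_0_vec[of x n] by simp

lemma scalar_prod_self_nonneg:
  fixes x :: "real vec"
  shows "0 \<le> x \<bullet> x"
  by (simp add: scalar_prod_def sum_nonneg)

section \<open>The log-determinant potential and the regret bound\<close>

locale vaw_data =
  fixes lam :: real and n :: nat and a :: "nat \<Rightarrow> real vec" and b :: "nat \<Rightarrow> real"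
  assumes lam: "0 < lam" and a [simp]: "a t \<in> carrier_vec n"
begin

abbreviation "G \<equiv> vaw_G lam n a"
abbreviation "v \<equiv> vaw_v n a b"

lemma G_carrier [simp]: "G t \<in> carrier_mat n n"
  by (induction t) auto

lemma v_carrier [simp]: "v t \<in> carrier_vec n"
  by (induction t) auto

lemma G_index:
  assumes "i < n" "j < n"
  shows "G t $$ (i, j) = (if i = j then lam else 0) + (\<Sum>s = 1..t. a s $ i * a s $ j)"
  using assms by (induction t) (auto simp: carrier_matD[OF G_carrier])

lemma G_mult_Suc:
  assumes "x \<in> carrier_vec n"
  shows "G (Suc t) *\<^sub>v x = G t *\<^sub>v x + (a (Suc t) \<bullet> x) \<cdot>\<^sub>v a (Suc t)"
  using assms by (simp add: add_mult_distrib_mat_vec[of _ n n] outer_mult_vec)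

text \<open>Symmetry and positive definiteness of \<open>G t\<close> are read off from this formula:
  the right-hand side is symmetric in \<open>x\<close> and \<open>z\<close>, and positive when they
  are equal and nonzero.\<close>

lemma quad_G:
  assumes x: "x \<in> carrier_vec n" and z: "z \<in> carrier_vec n"
  shows "z \<bullet> (G t *\<^sub>v x) = lam * (z \<bullet> x) + (\<Sum>s = 1..t. (a s \<bullet> z) * (a s \<bullet> x))"
proof (induction t)
  case 0
  have "G 0 *\<^sub>v x = lam \<cdot>\<^sub>v x" using x by (intro eq_vecI) (auto simp: scalar_prod_def if_distrib[of "\<lambda>c. c * _"] if_distrib[of "\<lambda>c. _ * c"] sum.delta cong: if_cong)
  then show ?case using x z by simp
next
  case (Suc t)
  have "z \<bullet> (G (Suc t) *\<^sub>v x) = z \<bullet> (G t *\<^sub>v x) + (a (Suc t) \<bullet> x) * (z \<bullet> a (Suc t))"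
    unfolding G_mult_Suc[OF x] using x z
    by (subst scalar_prod_add_distrib[of _ n]) (auto intro: mult_mat_vec_carrier[OF G_carrier])
  then show ?case using Suc comm_scalar_prod[OF z a] by simp
qed

lemma scalar_prod_v:
  assumes x: "x \<in> carrier_vec n"
  shows "x \<bullet> v t = (\<Sum>s = 1..t. b s * (a s \<bullet> x))"
proof (induction t)
  case (Suc t)
  have "x \<bullet> v (Suc t) = x \<bullet> v t + b (Suc t) * (x \<bullet> a (Suc t))"
    using x by (simp add: scalar_prod_add_distrib[of _ n])
  then show ?case using Suc comm_scalar_prod[OF x a] by simp
qed (use x in simp)

lemma det_G_nonzero: "det (G t) \<noteq> 0"
proof
  assume "det (G t) = 0"
  then obtain x where x: "x \<in> carrier_vec n" "x \<noteq> 0\<^sub>v n" "G t *\<^sub>v x = 0\<^sub>v n"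
    using det_0_iff_vec_prod_zero[OF G_carrier] by blast
  then have "0 = lam * (x \<bullet> x) + (\<Sum>s = 1..t. (a s \<bullet> x) * (a s \<bullet> x))"
    using quad_G[OF x(1) x(1), of t] by simp
  moreover have "0 < lam * (x \<bullet> x)" using scalar_prod_self_pos[OF x(1,2)] lam by simp
  moreover have "0 \<le> (\<Sum>s = 1..t. (a s \<bullet> x) * (a s \<bullet> x))" by (intro sum_nonneg) simp
  ultimately show False by linarith
qed

definition Ginv :: "nat \<Rightarrow> real mat" where "Ginv t = the (mat_inverse (G t))"

lemma Ginv: "Ginv t \<in> carrier_mat n n" "G t * Ginv t = 1\<^sub>m n"
proof -
  obtain B where B: "mat_inverse (G t) = Some B"
  proof (cases "mat_inverse (G t)")
    case None
    then have "G t \<notin> Units (ring_mat TYPE(real) n ())" by (rule mat_inverse(1)[OF G_carrier])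
    moreover have "G t \<in> Units (ring_mat TYPE(real) n ())"
      by (rule det_non_zero_imp_unit[OF G_carrier det_G_nonzero])
    ultimately show ?thesis by blast
  qed auto
  from mat_inverse(2)[OF G_carrier B]
  show "Ginv t \<in> carrier_mat n n" "G t * Ginv t = 1\<^sub>m n" by (auto simp: Ginv_def B)
qed

lemma G_Ginv_vec [simp]: "z \<in> carrier_vec n \<Longrightarrow> G t *\<^sub>v (Ginv t *\<^sub>v z) = z"
  using Ginv[of t] by (subst assoc_mult_mat_vec[symmetric, of _ n n _ n]) auto

lemma Ginv_vec_carrier [simp]: "z \<in> carrier_vec n \<Longrightarrow> Ginv t *\<^sub>v z \<in> carrier_vec n"
  using Ginv(1) mult_mat_vec_carrier by blast

text \<open>The leverage of the current feature; it telescopes through the determinants of \<open>G\<close>.\<close>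

definition lev :: "nat \<Rightarrow> real" where "lev t = a t \<bullet> (Ginv t *\<^sub>v a t)"

text \<open>The rank-one update is undone by a factor on the right: if \<open>z\<close> solves
  \<open>G (Suc t) *\<^sub>v z = a (Suc t)\<close>, then \<open>G t\<close> is
  \<open>G (Suc t)\<close> times the identity minus the outer product of \<open>z\<close> and
  \<open>a (Suc t)\<close>. That factor has determinant 1 minus the leverage.\<close>

lemma det_G_Suc: "det (G t) = det (G (Suc t)) * (1 - lev (Suc t))"
proof -
  define z where "z = Ginv (Suc t) *\<^sub>v a (Suc t)"
  let ?R = "mat n n (\<lambda>(i, j). z $ i * a (Suc t) $ j)"
  have z: "z \<in> carrier_vec n" and Gz: "G (Suc t) *\<^sub>v z = a (Suc t)"
    unfolding z_def by (simp_all del: vaw_G.simps)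
  have "G (Suc t) * ?R = mat n n (\<lambda>(i, j). a (Suc t) $ i * a (Suc t) $ j)"
  proof (rule eq_matI)
    fix i j assume ij: "i < dim_row (mat n n (\<lambda>(i, j). a (Suc t) $ i * a (Suc t) $ j))"
      "j < dim_col (mat n n (\<lambda>(i, j). a (Suc t) $ i * a (Suc t) $ j))"
    then have "(G (Suc t) * ?R) $$ (i, j) = (G (Suc t) *\<^sub>v z) $ i * a (Suc t) $ j"
      using carrier_matD[OF G_carrier[of "Suc t"]] carrier_vecD[OF z]
      by (simp add: scalar_prod_def sum_distrib_right mult.assoc del: vaw_G.simps)
    then have "(G (Suc t) * ?R) $$ (i, j) = a (Suc t) $ i * a (Suc t) $ j" unfolding Gz .
    then show "(G (Suc t) * ?R) $$ (i, j) = mat n n (\<lambda>(i, j). a (Suc t) $ i * a (Suc t) $ j) $$ (i, j)"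
      using ij by (simp del: vaw_G.simps)
  qed (simp_all add: carrier_matD[OF G_carrier] del: vaw_G.simps)
  then have "G (Suc t) * (1\<^sub>m n - ?R) = G (Suc t) - mat n n (\<lambda>(i, j). a (Suc t) $ i * a (Suc t) $ j)"
    by (subst mult_minus_distrib_mat[of _ n n _ n]) (auto simp: right_mult_one_mat[OF G_carrier] simp del: vaw_G.simps)
  also have "\<dots> = G t"
    by (rule eq_matI) (auto simp: carrier_matD[OF G_carrier])
  finally have "det (G t) = det (G (Suc t) * (1\<^sub>m n - ?R))" by simp
  also have "\<dots> = det (G (Suc t)) * det (1\<^sub>m n - ?R)"
    by (rule det_mult[OF G_carrier]) auto
  also have "det (1\<^sub>m n - ?R) = 1 - lev (Suc t)"
    using det_one_minus_outer[OF z a, of "Suc t"] by (simp add: lev_def z_def)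
  finally show ?thesis .
qed

text \<open>If \<open>z\<close> solves \<open>G t *\<^sub>v z = a t\<close>, the leverage is the
  quadratic form of \<open>G t\<close> at \<open>z\<close>. For t \<ge> 1 one summand of that form
  is the square of \<open>a t \<bullet> z\<close>, which is the square of the leverage, so the
  leverage dominates its own square.\<close>

lemma lev_nonneg: "0 \<le> lev t"
  and lev_le_1: "1 \<le> t \<Longrightarrow> lev t \<le> 1"
proof -
  let ?z = "Ginv t *\<^sub>v a t"
  have z: "?z \<in> carrier_vec n" by simp
  have "lev t = ?z \<bullet> (G t *\<^sub>v ?z)" using comm_scalar_prod[OF a z, of t] by (simp add: lev_def)
  also have "\<dots> = lam * (?z \<bullet> ?z) + (\<Sum>s = 1..t. (a s \<bullet> ?z) * (a s \<bullet> ?z))"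
    by (rule quad_G[OF z z])
  finally have eq: "lev t = lam * (?z \<bullet> ?z) + (\<Sum>s = 1..t. (a s \<bullet> ?z) * (a s \<bullet> ?z))" .
  have l: "0 \<le> lam * (?z \<bullet> ?z)" using lam scalar_prod_self_nonneg by simp
  show "0 \<le> lev t" using l unfolding eq by (intro add_nonneg_nonneg sum_nonneg) auto
  show "lev t \<le> 1" if "1 \<le> t"
  proof -
    have "(a t \<bullet> ?z) * (a t \<bullet> ?z) \<le> (\<Sum>s = 1..t. (a s \<bullet> ?z) * (a s \<bullet> ?z))"
      using that by (intro member_le_sum) auto
    then have le: "lev t * lev t \<le> lev t" using l eq unfolding lev_def by linarith
    show ?thesis
    proof (rule ccontr)
      assume "\<not> lev t \<le> 1"
      then have "lev t * 1 < lev t * lev t" by (intro mult_strict_left_mono) auto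
      then show False using le by simp
    qed
  qed
qed

lemma det_G_pos: "0 < det (G t)"
proof (induction t)
  case 0
  show ?case using lam by (simp add: det_smult)
next
  case (Suc t)
  have "0 < det (G (Suc t)) * (1 - lev (Suc t))" using Suc det_G_Suc by metis
  then show ?case using lev_le_1[of "Suc t"] by (simp add: zero_less_mult_iff)
qed

text \<open>The inequality ln x \<le> x - 1 at the ratio of successive determinants, which is 1
  minus the leverage, bounds each leverage by a difference of log determinants.\<close>

lemma sum_lev_le: "(\<Sum>t = 1..T. lev t) \<le> ln (det (G T)) - ln (det (G 0))"
proof (induction T)
  case (Suc T)
  have "1 - lev (Suc T) = det (G T) / det (G (Suc T))"
    using det_G_Suc[of T] det_G_pos[of "Suc T"] by (simp add: field_simps del: vaw_G.simps)
  then have "ln (det (G T)) - ln (det (G (Suc T))) \<le> - lev (Suc T)"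
    using ln_le_minus_one[of "det (G T) / det (G (Suc T))"] det_G_pos[of T] det_G_pos[of "Suc T"]
    by (simp add: ln_div del: vaw_G.simps)
  then show ?case using Suc by (simp del: vaw_G.simps)
qed simp

definition loss :: "nat \<Rightarrow> real vec \<Rightarrow> real" where
  "loss t w = lam * (w \<bullet> w) + (\<Sum>s = 1..t. (a s \<bullet> w - b s)\<^sup>2)"

lemma loss_eq:
  assumes w: "w \<in> carrier_vec n"
  shows "loss t w = w \<bullet> (G t *\<^sub>v w) - 2 * (w \<bullet> v t) + (\<Sum>s = 1..t. (b s)\<^sup>2)"
  unfolding loss_def quad_G[OF w w] scalar_prod_v[OF w]
  by (simp add: power2_diff sum.distrib sum_subtractf power2_eq_square sum_distrib_left algebra_simps)

text \<open>
  The minimum of the regularized loss at time \<open>Suc t\<close> is compared with the loss at time \<open>t\<close> of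
  the weight vector that is used for the prediction, not with the minimum at time \<open>t\<close>.
\<close>

lemma loss_Suc_ge:
  fixes t :: nat
  assumes w: "w \<in> carrier_vec n"
  defines "x \<equiv> vaw_weights lam n a b (Suc t)"
  shows "loss t x + (a (Suc t) \<bullet> x - b (Suc t))\<^sup>2 - (b (Suc t))\<^sup>2 * lev (Suc t) \<le> loss (Suc t) w"
proof -
  let ?G = "G (Suc t)" and ?a = "a (Suc t)" and ?b = "b (Suc t)"
  define z where "z = Ginv (Suc t) *\<^sub>v ?a"
  have x: "x \<in> carrier_vec n" and Gx: "?G *\<^sub>v x = v t"
    unfolding x_def vaw_weights_def Ginv_def[symmetric] by (simp_all del: vaw_G.simps)
  have z: "z \<in> carrier_vec n" and Gz: "?G *\<^sub>v z = ?a"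
    unfolding z_def by (simp_all del: vaw_G.simps)
  have lz: "lev (Suc t) = ?a \<bullet> z" by (simp add: lev_def z_def)
  \<comment> \<open>\<open>x + ?b \<cdot>\<^sub>v z\<close> is the minimizer of the loss at time
    \<open>Suc t\<close>, since \<open>G (Suc t)\<close> maps it to \<open>v (Suc t)\<close>;
    \<open>q\<close> is the deviation of \<open>w\<close> from it. The loss at \<open>w\<close>
    exceeds the minimum by the quadratic form of \<open>q\<close>, and the claim is an equality for
    \<open>q\<close> = 0. The facts below are the scalar identities from which linear arithmetic
    derives this.\<close>
  define q where "q = w - (x + ?b \<cdot>\<^sub>v z)"
  have q: "q \<in> carrier_vec n" using w x z by (simp add: q_def)
  have dec: "w = q + x + ?b \<cdot>\<^sub>v z"
    using w x z by (intro eq_vecI) (auto simp: q_def)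
  have lin: "s \<bullet> w = s \<bullet> q + s \<bullet> x + ?b * (s \<bullet> z)" if "s \<in> carrier_vec n" for s
    unfolding dec using q x z that by (simp add: scalar_prod_add_distrib[of _ n])
  have Gw: "?G *\<^sub>v w = ?G *\<^sub>v q + v t + ?b \<cdot>\<^sub>v ?a"
    unfolding dec using q x z Gx Gz
    by (simp add: mult_add_distrib_mat_vec[of _ n n] mult_mat_vec[of _ n n] assoc_add_vec[of _ n]
        mult_mat_vec_carrier[OF G_carrier] del: vaw_G.simps)
  have vS: "v (Suc t) = v t + ?b \<cdot>\<^sub>v ?a" by simp
  have "w \<bullet> (?G *\<^sub>v w) = w \<bullet> (?G *\<^sub>v q) + w \<bullet> v t + ?b * (w \<bullet> ?a)"
    unfolding Gw using w q
    by (subst scalar_prod_add_distrib[of _ n]) (auto simp: scalar_prod_add_distrib[of _ n] mult_mat_vec_carrier[OF G_carrier] simp del: vaw_G.simps)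
  moreover have "w \<bullet> v (Suc t) = w \<bullet> v t + ?b * (w \<bullet> ?a)"
    unfolding vS using w by (simp add: scalar_prod_add_distrib[of _ n])
  moreover have "w \<bullet> (?G *\<^sub>v q) = q \<bullet> (?G *\<^sub>v w)"
    unfolding quad_G[OF q w] quad_G[OF w q] using comm_scalar_prod[OF q w] by (simp add: mult.commute)
  moreover have "q \<bullet> (?G *\<^sub>v w) = q \<bullet> (?G *\<^sub>v q) + q \<bullet> v t + ?b * (q \<bullet> ?a)"
    unfolding Gw using w q
    by (subst scalar_prod_add_distrib[of _ n]) (auto simp: scalar_prod_add_distrib[of _ n] mult_mat_vec_carrier[OF G_carrier] simp del: vaw_G.simps)
  moreover have "w \<bullet> v t = q \<bullet> v t + x \<bullet> v t + ?b * (z \<bullet> v t)"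
    using lin[of "v t"] comm_scalar_prod[OF w v_carrier] comm_scalar_prod[OF q v_carrier]
      comm_scalar_prod[OF x v_carrier] comm_scalar_prod[OF z v_carrier] by simp
  moreover have "w \<bullet> ?a = q \<bullet> ?a + x \<bullet> ?a + ?b * (z \<bullet> ?a)"
    using lin[of ?a] comm_scalar_prod[OF w a] comm_scalar_prod[OF q a]
      comm_scalar_prod[OF x a] comm_scalar_prod[OF z a] by simp
  moreover have "z \<bullet> v t = ?a \<bullet> x"
  proof -
    have "z \<bullet> (?G *\<^sub>v x) = x \<bullet> (?G *\<^sub>v z)"
      unfolding quad_G[OF x z] quad_G[OF z x] using comm_scalar_prod[OF z x] by (simp add: mult.commute)
    then show ?thesis unfolding Gx Gz using comm_scalar_prod[OF x a] by simp
  qed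
  moreover have "0 \<le> q \<bullet> (?G *\<^sub>v q)"
    unfolding quad_G[OF q q] using lam
    by (intro add_nonneg_nonneg mult_nonneg_nonneg[OF less_imp_le] sum_nonneg zero_le_square)
      (auto simp: scalar_prod_self_nonneg)
  moreover have "x \<bullet> (G t *\<^sub>v x) = x \<bullet> v t - (?a \<bullet> x)\<^sup>2"
    using quad_G[OF x x, of t] quad_G[OF x x, of "Suc t"] Gx
    by (simp add: power2_eq_square del: vaw_G.simps)
  moreover have "?b * (w \<bullet> ?a) = ?b * (q \<bullet> ?a) + ?b * (x \<bullet> ?a) + ?b * (?b * (z \<bullet> ?a))"
    unfolding \<open>w \<bullet> ?a = _\<close> by (simp only: distrib_left)
  moreover have "(?a \<bullet> x - ?b)\<^sup>2 = (?a \<bullet> x)\<^sup>2 - 2 * (?b * (?a \<bullet> x)) + ?b\<^sup>2"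
    by (simp only: power2_diff) simp
  moreover have "?b\<^sup>2 * (?a \<bullet> z) = ?b * (?b * (z \<bullet> ?a))"
    unfolding comm_scalar_prod[OF a z] by (simp only: power2_eq_square mult.assoc)
  moreover have "?b * (z \<bullet> v t) = ?b * (x \<bullet> ?a)" "?b * (?a \<bullet> x) = ?b * (x \<bullet> ?a)"
    unfolding \<open>z \<bullet> v t = _\<close> comm_scalar_prod[OF a x] by simp_all
  moreover have "(\<Sum>s = 1..Suc t. (b s)\<^sup>2) = (\<Sum>s = 1..t. (b s)\<^sup>2) + ?b\<^sup>2" by simp
  ultimately show ?thesis
    unfolding loss_eq[OF w] loss_eq[OF x] lz by linarith
qed

text \<open>The induction hypothesis is applied to the weights used for the prediction and not to
  \<open>w\<close>, hence the arbitrary \<open>w\<close>.\<close>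

lemma sum_pred_error_le_loss:
  "w \<in> carrier_vec n \<Longrightarrow>
    (\<Sum>t = 1..T. (vaw_predict lam n a b t - b t)\<^sup>2 - (b t)\<^sup>2 * lev t) \<le> loss T w"
proof (induction T arbitrary: w)
  case 0
  then show ?case using lam scalar_prod_self_nonneg by (simp add: loss_def)
next
  case (Suc T)
  have "vaw_weights lam n a b (Suc T) \<in> carrier_vec n"
    unfolding vaw_weights_def Ginv_def[symmetric] by (simp del: vaw_G.simps)
  from Suc.IH[OF this] loss_Suc_ge[OF Suc.prems, of T] show ?case
    by (simp add: vaw_predict_def)
qed

text \<open>The final determinant is bounded through the entries of \<open>G T\<close>, and the
  initial one is a power of \<open>lam\<close>. The regularization stays visible under the logarithm
  because one of the two later choices of it is exponentially small.\<close>

lemma vaw_regret: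
  assumes w: "w \<in> carrier_vec n" and n: "0 < n"
    and Y: "\<And>t. t \<in> {1..T} \<Longrightarrow> \<bar>b t\<bar> \<le> Y"
    and E: "\<And>t j. t \<in> {1..T} \<Longrightarrow> j < n \<Longrightarrow> \<bar>a t $ j\<bar> \<le> E"
  shows "(\<Sum>t = 1..T. (vaw_predict lam n a b t - b t)\<^sup>2)
    \<le> lam * (w \<bullet> w) + (\<Sum>t = 1..T. (a t \<bullet> w - b t)\<^sup>2)
       + Y\<^sup>2 * (real n * ln (real n * (1 + real T * E\<^sup>2 / lam)))"
proof -
  let ?X = "lam + real T * E\<^sup>2"
  have G: "\<bar>G T $$ (i, j)\<bar> \<le> ?X" if "i < n" "j < n" for i j
  proof -
    have "\<bar>\<Sum>s = 1..T. a s $ i * a s $ j\<bar> \<le> (\<Sum>s = 1..T. E\<^sup>2)"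
    proof (rule order_trans[OF sum_abs sum_mono])
      fix s assume s: "s \<in> {1..T}"
      have "\<bar>a s $ i\<bar> * \<bar>a s $ j\<bar> \<le> E * E"
        using E[OF s that(1)] E[OF s that(2)] by (intro mult_mono) auto
      then show "\<bar>a s $ i * a s $ j\<bar> \<le> E\<^sup>2" by (simp add: abs_mult power2_eq_square)
    qed
    then show ?thesis unfolding G_index[OF that] using lam by (auto simp: abs_le_iff)
  qed
  have X: "0 < ?X" using lam by (simp add: add_pos_nonneg)
  have "ln (det (G T)) \<le> ln ((real n * ?X) ^ n)"
    using abs_det_le[OF G_carrier G] det_G_pos[of T] by (subst ln_le_cancel_iff) (use n X in auto)
  also have "\<dots> = real n * (ln (real n) + ln ?X)"
    using n X by (simp add: ln_realpow ln_mult)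
  finally have 1: "ln (det (G T)) \<le> real n * (ln (real n) + ln ?X)" .
  have 2: "ln (det (G 0)) = real n * ln lam" using lam by (simp add: det_smult ln_realpow)
  have 3: "ln (real n * (1 + real T * E\<^sup>2 / lam)) = ln (real n) + (ln ?X - ln lam)"
  proof -
    have "1 + real T * E\<^sup>2 / lam = ?X / lam" using lam by (simp add: field_simps)
    then show ?thesis using n X lam by (simp add: ln_mult ln_div)
  qed
  have "(\<Sum>t = 1..T. lev t) \<le> real n * ln (real n * (1 + real T * E\<^sup>2 / lam))"
    using sum_lev_le[of T] 1 unfolding 2 3 by (simp add: algebra_simps)
  then have "Y\<^sup>2 * (\<Sum>t = 1..T. lev t) \<le> Y\<^sup>2 * (real n * ln (real n * (1 + real T * E\<^sup>2 / lam)))"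
    by (intro mult_left_mono) auto
  moreover have "(\<Sum>t = 1..T. (b t)\<^sup>2 * lev t) \<le> (\<Sum>t = 1..T. Y\<^sup>2 * lev t)"
  proof (intro sum_mono mult_right_mono lev_nonneg)
    fix t assume "t \<in> {1..T}"
    from Y[OF this] show "(b t)\<^sup>2 \<le> Y\<^sup>2" by (metis abs_ge_zero power2_abs power_mono)
  qed
  ultimately show ?thesis using sum_pred_error_le_loss[OF w, of T]
    by (simp add: sum_subtractf loss_def sum_distrib_left[symmetric])
qed

end

section \<open>Decay of the spectral filters\<close>

lemma underdetermined_nontrivial_solution:
  fixes L :: "'i \<Rightarrow> nat \<Rightarrow> real"
  assumes "finite I" and card: "card I < m"
  obtains x where "\<exists>j<m. x j \<noteq> 0" and "\<And>t. t \<in> I \<Longrightarrow> (\<Sum>j<m. x j * L t j) = 0"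
proof -
  obtain f where f: "bij_betw f {0..<card I} I"
    using ex_bij_betw_nat_finite[OF assms(1)] by blast
  \<comment> \<open>Zero rows make the system square. Row \<open>card I\<close> is one of them, so
    every term of the Leibniz formula vanishes.\<close>
  define M where "M = mat m m (\<lambda>(i, j). if i < card I then L (f i) j else 0)"
  have M: "M \<in> carrier_mat m m" by (simp add: M_def)
  have "det M = 0"
    unfolding det_def'[OF M]
  proof (rule sum.neutral, rule ballI)
    fix p assume "p \<in> {p. p permutes {0..<m}}"
    then have "p (card I) < m" using card permutes_in_image[of p "{0..<m}" "card I"] by auto
    then have "M $$ (card I, p (card I)) = 0" using card by (simp add: M_def)
    then show "signof p * (\<Prod>i = 0..<m. M $$ (i, p i)) = 0"
      using card by (metis atLeastLessThan_iff finite_atLeastLessThan mult_zero_right prod_zero_iff zero_le)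
  qed
  then obtain v where v: "v \<in> carrier_vec m" "v \<noteq> 0\<^sub>v m" "M *\<^sub>v v = 0\<^sub>v m"
    using det_0_iff_vec_prod_zero[OF M] by blast
  show thesis
  proof (rule that)
    show "\<exists>j<m. v $ j \<noteq> 0" using v(1,2) by (metis carrier_vecD eq_vecI index_zero_vec)
    fix t assume "t \<in> I"
    then obtain i where i: "i < card I" "f i = t"
      using f by (metis atLeastLessThan_iff bij_betw_iff_bijections)
    have "(M *\<^sub>v v) $ i = 0" using v(3) i card by simp
    then show "(\<Sum>j<m. v $ j * L t j) = 0"
      using i card v(1) by (simp add: M_def scalar_prod_def atLeast0LessThan mult.commute)
  qed
qed

text \<open>Replacing \<open>x\<close> by \<open>r\<close>, which is at least three times as large
  in modulus, gains a factor 3^-i in the term of order i, hence at least 3^-N in each omitted term.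
  The enlarged terms sum up to at most \<open>(c + r) ^ j\<close>.\<close>

lemma binomial_remainder_bound:
  fixes c x r R :: real
  assumes "0 \<le> c" and x: "3 * \<bar>x\<bar> \<le> r" and R: "c + r \<le> R"
  shows "\<bar>(c + x) ^ j - (\<Sum>i<N. real (j choose i) * c ^ (j - i) * x ^ i)\<bar> \<le> R ^ j / 3 ^ N"
proof -
  define b where "b i = real (j choose i) * c ^ (j - i) * x ^ i" for i
  have r: "0 \<le> r" using x by linarith
  have "(c + x) ^ j = (\<Sum>i\<le>j. b i)"
    by (simp add: b_def binomial_ring[of x c] add.commute[of c] mult.assoc mult.left_commute mult.commute)
  also have "\<dots> = (\<Sum>i\<in>{..j} \<inter> {..<N}. b i) + (\<Sum>i\<in>{..j} - {..<N}. b i)"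
    by (rule sum.Int_Diff) simp
  also have "(\<Sum>i\<in>{..j} \<inter> {..<N}. b i) = (\<Sum>i<N. b i)"
    by (rule sum.mono_neutral_left) (auto simp: b_def binomial_eq_0)
  finally have "\<bar>(c + x) ^ j - (\<Sum>i<N. b i)\<bar> = \<bar>\<Sum>i\<in>{..j} - {..<N}. b i\<bar>" by simp
  also have "\<dots> \<le> (\<Sum>i\<in>{..j} - {..<N}. real (j choose i) * c ^ (j - i) * r ^ i / 3 ^ N)"
  proof (rule order_trans[OF sum_abs sum_mono])
    fix i assume "i \<in> {..j} - {..<N}"
    then have i: "N \<le> i" by simp
    have "\<bar>x\<bar> ^ i \<le> (r / 3) ^ i" using x by (intro power_mono) auto
    also have "\<dots> = r ^ i / 3 ^ i" by (simp add: power_divide)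
    also have "\<dots> \<le> r ^ i / 3 ^ N"
      using i r by (intro divide_left_mono power_increasing) auto
    finally have "real (j choose i) * c ^ (j - i) * \<bar>x\<bar> ^ i \<le> real (j choose i) * c ^ (j - i) * (r ^ i / 3 ^ N)"
      using assms(1) by (intro mult_left_mono) auto
    then show "\<bar>b i\<bar> \<le> real (j choose i) * c ^ (j - i) * r ^ i / 3 ^ N"
      using assms(1) by (simp add: b_def abs_mult power_abs)
  qed
  also have "\<dots> \<le> (\<Sum>i\<le>j. real (j choose i) * c ^ (j - i) * r ^ i / 3 ^ N)"
    using assms(1) r by (intro sum_mono2) auto
  also have "\<dots> = (c + r) ^ j / 3 ^ N"
    by (simp add: sum_divide_distrib[symmetric] binomial_ring[of r c] add.commute[of c] mult.assoc
        mult.left_commute mult.commute)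
  also have "\<dots> \<le> R ^ j / 3 ^ N"
    using assms(1) r R by (intro divide_right_mono power_mono) auto
  finally show ?thesis by (simp add: b_def)
qed

text \<open>
  Dyadic cover of the unit interval refined towards 1. Each cell keeps twice its radius away
  from the point where the powers start to grow, so expansions converge like \<open>3 ^ -N\<close>.
\<close>

definition cell_center :: "nat \<Rightarrow> nat \<Rightarrow> real" where
  "cell_center J s = (if s < J then 1 - 3 / 2 * (1 / 2) ^ Suc s else 1 - (1 / 2) ^ J / 2)"

definition cell_radius :: "nat \<Rightarrow> nat \<Rightarrow> real" where
  "cell_radius J s = (if s < J then (1 / 2) ^ Suc s / 2 else (1 / 2) ^ J / 2)"

text \<open>For s < J the cell is the closed interval from 1 - 2^-s to 1 - 2^-(s+1); cell J is the
  rest, from 1 - 2^-J to 1.\<close>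

lemma cells_cover:
  assumes "0 \<le> x" "x \<le> 1"
  shows "\<exists>s\<le>J. \<bar>x - cell_center J s\<bar> \<le> cell_radius J s"
proof (cases "x < 1 - (1 / 2) ^ J")
  case True
  have "\<exists>s<J. 1 - (1 / 2) ^ s \<le> x \<and> x \<le> 1 - (1 / 2) ^ Suc s"
    using True
  proof (induction J)
    case 0
    then show ?case using assms by simp
  next
    case (Suc J)
    show ?case
    proof (cases "x < 1 - (1 / 2) ^ J")
      case True
      then show ?thesis using Suc.IH less_Suc_eq by blast
    next
      case False
      then show ?thesis using Suc.prems by (intro exI[of _ J]) simp
    qed
  qed
  then obtain s where "s < J" "1 - (1 / 2) ^ s \<le> x" "x \<le> 1 - (1 / 2) ^ Suc s" by blast
  then show ?thesis
    by (intro exI[of _ s]) (simp add: cell_center_def cell_radius_def abs_le_iff field_simps)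
next
  case False
  then show ?thesis using assms
    by (intro exI[of _ J]) (simp add: cell_center_def cell_radius_def abs_le_iff field_simps)
qed

lemma cell_center_nonneg: "0 \<le> cell_center J s"
proof -
  have "(1 / 2 :: real) ^ n \<le> 1" for n by (simp add: power_le_one)
  from this[of s] this[of J] show ?thesis by (simp add: cell_center_def)
qed

text \<open>Cells below J reach exactly 1 at three radii, the last one 1 + 2^-J. With T \<le> 2^J
  the powers of exponent below T therefore stay below (1 + 1/T)^T \<le> 3.\<close>

lemma cell_reach: "cell_center J s + 3 * cell_radius J s \<le> 1 + (1 / 2) ^ J"
  by (simp add: cell_center_def cell_radius_def)

text \<open>A vector orthogonal to the Taylor coefficient vectors of all cells sees only the
  remainder of the moment curve, which is at most 3 / 3^N in each of the T coordinates;
  Cauchy--Schwarz does the rest. The sign \<beta> reflects [-1, 0] onto the half that is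
  covered.\<close>

lemma moment_pairing_le:
  fixes v :: "nat \<Rightarrow> real"
  assumes T: "0 < T" and J: "real T \<le> 2 ^ J"
    and ann: "\<And>\<beta> s i. \<beta> \<in> {- 1, 1} \<Longrightarrow> s \<le> J \<Longrightarrow> i < N \<Longrightarrow>
      (\<Sum>j<T. v j * (\<beta> ^ j * (real (j choose i) * cell_center J s ^ (j - i)))) = 0"
    and \<alpha>: "\<alpha> \<in> {- 1..1}"
  shows "(\<Sum>j<T. v j * \<alpha> ^ j)\<^sup>2 \<le> 9 * real T * (\<Sum>j<T. (v j)\<^sup>2) / 9 ^ N"
proof -
  define \<beta> :: real where "\<beta> = (if 0 \<le> \<alpha> then 1 else - 1)"
  have \<beta>: "\<beta> \<in> {- 1, 1}" "\<alpha> = \<beta> * \<bar>\<alpha>\<bar>" "\<bar>\<beta>\<bar> = 1" by (auto simp: \<beta>_def)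
  obtain s where s: "s \<le> J" "\<bar>\<bar>\<alpha>\<bar> - cell_center J s\<bar> \<le> cell_radius J s"
    using cells_cover[of "\<bar>\<alpha>\<bar>" J] \<alpha> by (auto simp: abs_le_iff)
  define c x where "c = cell_center J s" and "x = \<bar>\<alpha>\<bar> - cell_center J s"
  define p where "p j = (\<Sum>i<N. real (j choose i) * c ^ (j - i) * x ^ i)" for j
  have rem: "\<bar>\<bar>\<alpha>\<bar> ^ j - p j\<bar> \<le> 3 / 3 ^ N" if "j < T" for j
  proof -
    have "\<bar>(c + x) ^ j - p j\<bar> \<le> (1 + (1 / 2) ^ J) ^ j / 3 ^ N"
      unfolding p_def using s cell_reach[of J s] cell_center_nonneg[of J s]
      by (intro binomial_remainder_bound[where r = "3 * cell_radius J s"]) (auto simp: c_def x_def)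
    also have "(1 + (1 / 2 :: real) ^ J) ^ j \<le> (1 + 1 / real T) ^ j"
      using J T by (intro power_mono) (auto simp: field_simps power_divide)
    also have "\<dots> \<le> (1 + 1 / real T) ^ T"
      using that by (intro power_increasing) auto
    also have "\<dots> \<le> exp (1 / real T) ^ T" by (intro power_mono exp_ge_add_one_self) auto
    also have "\<dots> = exp 1" using T by (simp add: exp_of_nat_mult[symmetric])
    also have "\<dots> \<le> 3" by (rule exp_le)
    finally show ?thesis by (simp add: c_def x_def divide_right_mono)
  qed
  have "(\<Sum>j<T. v j * (\<beta> ^ j * p j))
      = (\<Sum>i<N. x ^ i * (\<Sum>j<T. v j * (\<beta> ^ j * (real (j choose i) * c ^ (j - i)))))"
    unfolding p_def sum_distrib_left by (subst sum.swap) (simp add: mult_ac)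
  also have "\<dots> = 0" using ann[OF \<beta>(1) s(1)] by (simp add: c_def)
  finally have 0: "(\<Sum>j<T. v j * (\<beta> ^ j * p j)) = 0" .
  have "(\<Sum>j<T. v j * \<alpha> ^ j) = (\<Sum>j<T. v j * (\<beta> ^ j * (\<bar>\<alpha>\<bar> ^ j - p j)))"
    using 0 by (subst \<beta>(2)) (simp add: power_mult_distrib right_diff_distrib sum_subtractf)
  then have "(\<Sum>j<T. v j * \<alpha> ^ j)\<^sup>2 \<le> (\<Sum>j<T. (v j)\<^sup>2) * (\<Sum>j<T. (\<beta> ^ j * (\<bar>\<alpha>\<bar> ^ j - p j))\<^sup>2)"
    by (simp add: Cauchy_Schwarz_ineq_sum)
  also have "(\<Sum>j<T. (\<beta> ^ j * (\<bar>\<alpha>\<bar> ^ j - p j))\<^sup>2) \<le> (\<Sum>j<T. 9 / 9 ^ N)"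
  proof (rule sum_mono)
    fix j assume "j \<in> {..<T}"
    then have "\<bar>\<beta> ^ j * (\<bar>\<alpha>\<bar> ^ j - p j)\<bar> \<le> 3 / 3 ^ N"
      using rem[of j] \<beta>(3) by (simp add: abs_mult power_abs)
    then have "\<bar>\<beta> ^ j * (\<bar>\<alpha>\<bar> ^ j - p j)\<bar>\<^sup>2 \<le> (3 / 3 ^ N)\<^sup>2" by (intro power_mono) auto
    also have "\<dots> = 9 / 9 ^ N"
      by (simp add: power_divide power_mult[symmetric] mult.commute[of N] power_mult[of 3 2])
    finally show "(\<beta> ^ j * (\<bar>\<alpha>\<bar> ^ j - p j))\<^sup>2 \<le> 9 / 9 ^ N" by simp
  qed
  also have "(\<Sum>j<T. (v j)\<^sup>2) * (\<Sum>j<T. 9 / 9 ^ N) = 9 * real T * (\<Sum>j<T. (v j)\<^sup>2) / 9 ^ N" by simp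
  finally show ?thesis by (simp add: mult_left_mono sum_nonneg)
qed

lemma abs_power_diff_le:
  fixes a b :: real
  assumes "\<bar>a\<bar> \<le> 1" "\<bar>b\<bar> \<le> 1"
  shows "\<bar>a ^ i - b ^ i\<bar> \<le> real i * \<bar>a - b\<bar>"
  using norm_power_diff[of a b i] assms by simp

section \<open>The filter matrix as a Gram matrix, and the decay of its eigenvalues\<close>

locale filters =
  fixes T :: nat and \<phi> :: "nat \<Rightarrow> real vec" and \<sigma> :: "nat \<Rightarrow> real"
  assumes spectral: "spectral_filters T \<phi> \<sigma>"
begin

lemma phi_carrier: "j < T \<Longrightarrow> \<phi> j \<in> carrier_vec T"
  and phi_eigen: "j < T \<Longrightarrow> filter_matrix T *\<^sub>v \<phi> j = \<sigma> j \<cdot>\<^sub>v \<phi> j"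
  and sigma_antimono_abs: "i \<le> j \<Longrightarrow> j < T \<Longrightarrow> \<bar>\<sigma> j\<bar> \<le> \<bar>\<sigma> i\<bar>"
  using spectral by (auto simp: spectral_filters_def)

lemma phi_orthonormal:
  assumes "j < T" "l < T"
  shows "(\<Sum>i<T. \<phi> j $ i * \<phi> l $ i) = (if j = l then 1 else 0)"
proof -
  have "\<phi> j \<bullet> \<phi> l = (if j = l then 1 else 0)"
    using spectral assms by (auto simp: spectral_filters_def)
  then show ?thesis using carrier_vecD[OF phi_carrier[OF assms(2)]]
    by (simp only: scalar_prod_def atLeast0LessThan)
qed

text \<open>The matrix of filters is square, so orthonormal rows force orthonormal columns.\<close>

lemma phi_complete:
  assumes "i < T" "i' < T"
  shows "(\<Sum>j<T. \<phi> j $ i * \<phi> j $ i') = (if i = i' then 1 else 0)"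
proof -
  define F where "F = mat T T (\<lambda>(j, i). \<phi> j $ i)"
  have F: "F \<in> carrier_mat T T" "F\<^sup>T \<in> carrier_mat T T" by (auto simp: F_def)
  have "F * F\<^sup>T = 1\<^sub>m T"
    by (rule eq_matI) (auto simp: F_def scalar_prod_def atLeast0LessThan phi_orthonormal)
  then have "F\<^sup>T * F = 1\<^sub>m T" using mat_mult_left_right_inverse[OF F] by blast
  then have "(F\<^sup>T * F) $$ (i, i') = 1\<^sub>m T $$ (i, i')" by simp
  then show ?thesis using assms by (simp add: F_def scalar_prod_def atLeast0LessThan)
qed

lemma parseval:
  "(\<Sum>j<T. (\<Sum>i<T. \<phi> j $ i * f i) * (\<Sum>i<T. \<phi> j $ i * g i)) = (\<Sum>i<T. f i * g i)"
proof -
  have "(\<Sum>j<T. (\<Sum>i<T. \<phi> j $ i * f i) * (\<Sum>i<T. \<phi> j $ i * g i))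
      = (\<Sum>j<T. \<Sum>i<T. \<Sum>i'<T. f i * g i' * (\<phi> j $ i * \<phi> j $ i'))"
    by (simp add: sum_product mult_ac)
  also have "\<dots> = (\<Sum>i<T. \<Sum>i'<T. \<Sum>j<T. f i * g i' * (\<phi> j $ i * \<phi> j $ i'))"
    by (subst sum.swap, intro sum.cong refl sum.swap)
  also have "\<dots> = (\<Sum>i<T. \<Sum>i'<T. f i * g i' * (if i = i' then 1 else 0))"
    unfolding sum_distrib_left[symmetric] by (intro sum.cong refl) (simp add: phi_complete)
  finally show ?thesis by (simp add: if_distrib[of "\<lambda>x. _ * x"] cong: if_cong)
qed

lemma parseval_sq: "(\<Sum>j<T. (\<Sum>i<T. \<phi> j $ i * f i)\<^sup>2) = (\<Sum>i<T. (f i)\<^sup>2)"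
  using parseval[of f f] by (simp add: power2_eq_square)

definition comb :: "nat set \<Rightarrow> (nat \<Rightarrow> real) \<Rightarrow> nat \<Rightarrow> real" where
  "comb S x i = (\<Sum>j\<in>S. x j * \<phi> j $ i)"

lemma sum_comb_mult: "(\<Sum>i<T. comb S x i * f i) = (\<Sum>j\<in>S. x j * (\<Sum>i<T. \<phi> j $ i * f i))"
  unfolding comb_def sum_distrib_right sum_distrib_left by (subst sum.swap) (simp add: mult_ac)

lemma sum_comb_comb:
  assumes "S \<subseteq> {..<T}"
  shows "(\<Sum>i<T. comb S x i * comb S z i) = (\<Sum>j\<in>S. x j * z j)"
proof -
  have fin: "finite S" using assms finite_subset by blast
  have "(\<Sum>i<T. \<phi> j $ i * comb S z i) = z j" if "j \<in> S" for j
  proof -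
    have "(\<Sum>i<T. \<phi> j $ i * comb S z i) = (\<Sum>l\<in>S. z l * (\<Sum>i<T. \<phi> l $ i * \<phi> j $ i))"
      using sum_comb_mult[of S z "\<lambda>i. \<phi> j $ i"] by (simp add: mult.commute)
    also have "\<dots> = (\<Sum>l\<in>S. z l * (if l = j then 1 else 0))"
      using that assms by (intro sum.cong refl arg_cong2[where f = "(*)"] phi_orthonormal) auto
    finally show ?thesis using that fin by (simp add: if_distrib[of "\<lambda>x. _ * x"] cong: if_cong)
  qed
  then show ?thesis unfolding sum_comb_mult by simp
qed

lemma sum_comb_sq: "S \<subseteq> {..<T} \<Longrightarrow> (\<Sum>i<T. (comb S x i)\<^sup>2) = (\<Sum>j\<in>S. (x j)\<^sup>2)"
  using sum_comb_comb[of S x x] by (simp add: power2_eq_square)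

text \<open>The filter matrix is the Gram matrix of the monomials on [-1, 1]. This translates
  eigenvalues into integrals of squared polynomials. In particular the eigenvalues are nonnegative,
  and their order by absolute value is an order by value.\<close>

lemma has_integral_moment_sq:
  "((\<lambda>\<alpha>. (\<Sum>i<T. v i * \<alpha> ^ i)\<^sup>2) has_integral
     (\<Sum>i<T. v i * (\<Sum>j<T. filter_matrix T $$ (i, j) * v j))) {- 1..1}"
proof -
  have Z: "((\<lambda>\<alpha>. \<alpha> ^ i * \<alpha> ^ j) has_integral filter_matrix T $$ (i, j)) {- 1..1}"
    if "i < T" "j < T" for i j
    unfolding filter_matrix_def using that
    by (auto intro!: integrable_integral integrable_continuous_interval continuous_intros)
  have "((\<lambda>\<alpha>. \<Sum>i<T. v i * (\<Sum>j<T. (\<alpha> ^ i * \<alpha> ^ j) * v j)) has_integral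
     (\<Sum>i<T. v i * (\<Sum>j<T. filter_matrix T $$ (i, j) * v j))) {- 1..1}"
    by (intro has_integral_sum has_integral_mult_right has_integral_mult_left Z) auto
  moreover have "(\<Sum>i<T. v i * (\<Sum>j<T. (\<alpha> ^ i * \<alpha> ^ j) * v j)) = (\<Sum>i<T. v i * \<alpha> ^ i)\<^sup>2" for \<alpha> :: real
    by (simp add: power2_eq_square sum_product sum_distrib_left mult_ac)
  ultimately show ?thesis by simp
qed

lemma has_integral_comb_sq:
  assumes S: "S \<subseteq> {..<T}"
  shows "((\<lambda>\<alpha>. (\<Sum>i<T. comb S x i * \<alpha> ^ i)\<^sup>2) has_integral (\<Sum>j\<in>S. \<sigma> j * (x j)\<^sup>2)) {- 1..1}"
proof -
  have phi: "(\<Sum>l<T. filter_matrix T $$ (i, l) * \<phi> j $ l) = \<sigma> j * \<phi> j $ i" if "i < T" "j < T" for i j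
  proof -
    have "(filter_matrix T *\<^sub>v \<phi> j) $ i = (\<sigma> j \<cdot>\<^sub>v \<phi> j) $ i" using phi_eigen[OF that(2)] by simp
    then show ?thesis using that phi_carrier[OF that(2)]
      by (simp add: scalar_prod_def filter_matrix_def atLeast0LessThan)
  qed
  have "(\<Sum>l<T. filter_matrix T $$ (i, l) * comb S x l) = comb S (\<lambda>j. \<sigma> j * x j) i" if "i < T" for i
  proof -
    have "(\<Sum>l<T. filter_matrix T $$ (i, l) * comb S x l)
        = (\<Sum>j\<in>S. x j * (\<Sum>l<T. filter_matrix T $$ (i, l) * \<phi> j $ l))"
      using sum_comb_mult[of S x "\<lambda>l. filter_matrix T $$ (i, l)"] by (simp add: mult.commute)
    also have "\<dots> = (\<Sum>j\<in>S. x j * (\<sigma> j * \<phi> j $ i))"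
      using S that by (intro sum.cong refl) (auto simp: phi)
    finally show ?thesis by (simp add: comb_def mult_ac)
  qed
  then have "(\<Sum>i<T. comb S x i * (\<Sum>l<T. filter_matrix T $$ (i, l) * comb S x l))
      = (\<Sum>i<T. comb S x i * comb S (\<lambda>j. \<sigma> j * x j) i)" by simp
  also have "\<dots> = (\<Sum>j\<in>S. \<sigma> j * (x j)\<^sup>2)"
    unfolding sum_comb_comb[OF S] by (simp add: power2_eq_square mult_ac)
  finally show ?thesis using has_integral_moment_sq[of "comb S x"] by simp
qed

lemma sigma_nonneg: "j < T \<Longrightarrow> 0 \<le> \<sigma> j"
  using has_integral_nonneg[OF has_integral_comb_sq[of "{j}" "\<lambda>_. 1"]] by simp

lemma sigma_antimono: "i \<le> j \<Longrightarrow> j < T \<Longrightarrow> \<sigma> j \<le> \<sigma> i"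
  using sigma_antimono_abs[of i j] sigma_nonneg[of j] sigma_nonneg[of i] by simp

text \<open>Courant--Fischer: some combination of the first \<open>h + 1\<close> filters is orthogonal to all
  Taylor coefficient vectors.\<close>

lemma sigma_le:
  assumes h: "h < T" and J: "real T \<le> 2 ^ J" and N: "2 * (J + 1) * N \<le> h"
  shows "\<sigma> h \<le> 18 * real T / 9 ^ N"
proof -
  define I where "I = {- 1, 1 :: real} \<times> {..J} \<times> {..<N}"
  define b where "b = (\<lambda>(\<beta> :: real, s, i) j. \<beta> ^ j * (real (j choose i) * cell_center J s ^ (j - i)))"
  \<comment> \<open>Two signs, J + 1 cells and N Taylor coefficients each: these are the conditions
    that the h + 1 free coefficients have to outnumber.\<close>
  have "card I = 2 * (J + 1) * N" by (simp add: I_def card_cartesian_product)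
  then have "card I < Suc h" using N by simp
  moreover have "finite I" by (simp add: I_def)
  ultimately obtain x where x: "\<exists>j<Suc h. x j \<noteq> 0"
    "\<And>t. t \<in> I \<Longrightarrow> (\<Sum>j<Suc h. x j * (\<Sum>i<T. \<phi> j $ i * b t i)) = 0"
    using underdetermined_nontrivial_solution[of I "Suc h" "\<lambda>t j. \<Sum>i<T. \<phi> j $ i * b t i"] by blast
  let ?S = "{..<Suc h}" and ?X = "\<Sum>j<Suc h. (x j)\<^sup>2"
  have S: "?S \<subseteq> {..<T}" using h by auto
  have X: "0 < ?X" proof -
    obtain j where "j < Suc h" "x j \<noteq> 0" using x(1) by blast
    then show ?thesis by (intro sum_pos2[of _ j]) (auto simp del: sum.lessThan_Suc)
  qed
  have bnd: "(\<Sum>i<T. comb ?S x i * \<alpha> ^ i)\<^sup>2 \<le> 9 * real T * ?X / 9 ^ N" if "\<alpha> \<in> {- 1..1}" for \<alpha>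
    unfolding sum_comb_sq[OF S, symmetric]
  proof (rule moment_pairing_le[OF _ J _ that])
    fix \<beta> :: real and s i assume "\<beta> \<in> {- 1, 1}" "s \<le> J" "i < N"
    then show "(\<Sum>j<T. comb ?S x j * (\<beta> ^ j * (real (j choose i) * cell_center J s ^ (j - i)))) = 0"
      using x(2)[of "(\<beta>, s, i)"] unfolding sum_comb_mult by (simp add: I_def b_def)
  qed (use h in simp)
  \<comment> \<open>The quadratic form of the filter matrix on the span of the first h + 1 filters
    is at least \<open>\<sigma> h\<close> times the squared norm. Integrating the pointwise bound
    over an interval of length 2 turns 9 into 18.\<close>
  have "\<sigma> h * ?X \<le> (\<Sum>j<Suc h. \<sigma> j * (x j)\<^sup>2)"
    unfolding sum_distrib_left using h by (intro sum_mono mult_right_mono sigma_antimono) auto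
  also have "\<dots> \<le> 9 * real T * ?X / 9 ^ N * (1 - (- 1))"
    using has_integral_le[OF has_integral_comb_sq[OF S] has_integral_const_real bnd]
    by (simp add: mult.commute)
  finally have "\<sigma> h * ?X \<le> (18 * real T / 9 ^ N) * ?X" by (simp add: field_simps)
  then show ?thesis using X mult_right_le_imp_le by blast
qed

text \<open>
  The mean square bound by \<open>\<sigma> h\<close> becomes a bound at the single point \<open>\<alpha>\<close> because a polynomial
  with a unit coefficient vector is Lipschitz with constant \<open>T powr 1.5\<close> on the unit interval.
\<close>

lemma tail_cube_le:
  assumes h: "h < T" and \<alpha>: "\<bar>\<alpha>\<bar> \<le> 1"
  shows "(\<Sum>j\<in>{h..<T}. (\<Sum>i<T. \<phi> j $ i * \<alpha> ^ i)\<^sup>2) ^ 3 \<le> 64 * real T ^ 3 * (\<sigma> h)\<^sup>2"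
proof -
  define x where "x j = (\<Sum>i<T. \<phi> j $ i * \<alpha> ^ i)" for j
  define X where "X = (\<Sum>j\<in>{h..<T}. (x j)\<^sup>2)"
  let ?S = "{h..<T}"
  \<comment> \<open>The projection of the moment vector of \<alpha> onto the tail filters. Its
    pairing with that moment vector is its own squared norm, so
    \<open>g \<alpha> = X\<close>.\<close>
  define v where "v = comb ?S x"
  define g where "g \<gamma> = (\<Sum>i<T. v i * \<gamma> ^ i)" for \<gamma> :: real
  have S: "?S \<subseteq> {..<T}" by auto
  have vX: "(\<Sum>i<T. (v i)\<^sup>2) = X" unfolding v_def X_def by (rule sum_comb_sq[OF S])
  have g\<alpha>: "g \<alpha> = X"
    unfolding g_def v_def sum_comb_mult X_def x_def[symmetric] by (simp only: power2_eq_square)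
  have X0: "0 \<le> X" by (simp add: X_def sum_nonneg)
  have "X \<le> (\<Sum>j<T. (x j)\<^sup>2)" unfolding X_def by (intro sum_mono2) auto
  also have "\<dots> = (\<Sum>i<T. (\<alpha> ^ i)\<^sup>2)" unfolding x_def by (rule parseval_sq)
  also have "\<dots> \<le> (\<Sum>i<T. 1)"
  proof (rule sum_mono)
    fix i
    have "\<bar>\<alpha> ^ i\<bar> \<le> 1" using \<alpha> by (simp add: power_abs power_le_one)
    then show "(\<alpha> ^ i)\<^sup>2 \<le> 1" by (simp only: abs_square_le_1)
  qed
  finally have XT: "X \<le> real T" by simp
  have T: "1 \<le> real T" using h by simp
  define s where "s = sqrt X"
  have s: "0 \<le> s" "s\<^sup>2 = X" using X0 by (auto simp: s_def)
  define t where "t = sqrt (real T)"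
  have t: "1 \<le> t" "t\<^sup>2 = real T" using T by (auto simp: t_def)
  have st: "s \<le> t" using XT by (simp add: s_def t_def)
  have "(\<Sum>i<T. \<bar>v i\<bar> * 1)\<^sup>2 \<le> (\<Sum>i<T. \<bar>v i\<bar>\<^sup>2) * (\<Sum>i<T. 1\<^sup>2)"
    by (rule Cauchy_Schwarz_ineq_sum)
  then have "(\<Sum>i<T. \<bar>v i\<bar>)\<^sup>2 \<le> (s * t)\<^sup>2" using vX s(2) t(2) by (simp only: power_mult_distrib power2_abs mult_1_right) simp
  moreover have "0 \<le> s * t" using s(1) t(1) by simp
  ultimately have l1: "(\<Sum>i<T. \<bar>v i\<bar>) \<le> s * t" by (rule power2_le_imp_le)
  have lip: "\<bar>g \<gamma> - X\<bar> \<le> s * t ^ 3 * \<bar>\<gamma> - \<alpha>\<bar>" if "\<bar>\<gamma>\<bar> \<le> 1" for \<gamma>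
  proof -
    have "\<bar>g \<gamma> - X\<bar> = \<bar>\<Sum>i<T. v i * (\<gamma> ^ i - \<alpha> ^ i)\<bar>"
      unfolding g\<alpha>[symmetric] g_def by (simp add: sum_subtractf right_diff_distrib)
    also have "\<dots> \<le> (\<Sum>i<T. \<bar>v i\<bar> * (t\<^sup>2 * \<bar>\<gamma> - \<alpha>\<bar>))"
    proof (rule order_trans[OF sum_abs sum_mono])
      fix i assume "i \<in> {..<T}"
      have "\<bar>\<gamma> ^ i - \<alpha> ^ i\<bar> \<le> real i * \<bar>\<gamma> - \<alpha>\<bar>" by (rule abs_power_diff_le[OF that \<alpha>])
      also have "\<dots> \<le> t\<^sup>2 * \<bar>\<gamma> - \<alpha>\<bar>"
        unfolding t(2) using \<open>i \<in> {..<T}\<close> by (intro mult_right_mono) auto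
      finally show "\<bar>v i * (\<gamma> ^ i - \<alpha> ^ i)\<bar> \<le> \<bar>v i\<bar> * (t\<^sup>2 * \<bar>\<gamma> - \<alpha>\<bar>)"
        unfolding abs_mult by (rule mult_left_mono) simp
    qed
    also have "\<dots> = (\<Sum>i<T. \<bar>v i\<bar>) * (t\<^sup>2 * \<bar>\<gamma> - \<alpha>\<bar>)" by (simp add: sum_distrib_right)
    also have "\<dots> \<le> s * t * (t\<^sup>2 * \<bar>\<gamma> - \<alpha>\<bar>)" by (intro mult_right_mono l1) auto
    finally show ?thesis by (simp add: power3_eq_cube power2_eq_square mult_ac)
  qed
  show ?thesis
  proof (cases "s = 0")
    case True
    then show ?thesis using s by (simp add: X_def[unfolded x_def, symmetric])
  next
    case False
    then have s0: "0 < s" using s by simp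
    \<comment> \<open>Within distance \<open>w\<close> of \<alpha> the Lipschitz constant
      \<open>s * t ^ 3\<close> allows a drop of at most X / 2, so the squared polynomial stays above
      X^2 / 4. Comparison with the integral over [-1, 1] then gives
      \<open>s ^ 3 \<le> 8 * t ^ 3 * \<sigma> h\<close>.\<close>
    define w where "w = s / (2 * t ^ 3)"
    have t3: "1 \<le> t ^ 3" "t \<le> t ^ 3" using t(1) power_increasing[of 1 3 t] by simp_all
    have w: "0 < w" "w \<le> 1" using s0 st t3 by (auto simp: w_def field_simps)
    \<comment> \<open>The interval extends to one side of \<alpha>, towards and possibly across 0;
      as \<open>w \<le> 1\<close> it stays inside [-1, 1].\<close>
    define a where "a = (if \<alpha> \<le> 0 then \<alpha> else \<alpha> - w)"
    have a: "- 1 \<le> a" "a + w \<le> 1" "\<And>\<gamma>. \<gamma> \<in> {a..a + w} \<Longrightarrow> \<bar>\<gamma> - \<alpha>\<bar> \<le> w"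
      using w \<alpha> by (auto simp: a_def split: if_splits)
    have low: "X\<^sup>2 / 4 \<le> (g \<gamma>)\<^sup>2" if "\<gamma> \<in> {a..a + w}" for \<gamma>
    proof -
      have "\<bar>g \<gamma> - X\<bar> \<le> s * t ^ 3 * \<bar>\<gamma> - \<alpha>\<bar>" using that a by (intro lip) auto
      also have "\<dots> \<le> s * t ^ 3 * w" using s(1) t(1) a(3)[OF that] by (intro mult_left_mono mult_nonneg_nonneg zero_le_power) auto
      also have "\<dots> = X / 2" using t(1) by (simp add: w_def power2_eq_square flip: s(2))
      finally have "X / 2 \<le> g \<gamma>" by linarith
      then have "(X / 2)\<^sup>2 \<le> (g \<gamma>)\<^sup>2" using X0 by (intro power_mono) auto
      then show ?thesis by (simp add: power_divide)
    qed
    have cont: "continuous_on A (\<lambda>\<gamma>. (g \<gamma>)\<^sup>2)" for A unfolding g_def by (intro continuous_intros)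
    have int: "((\<lambda>\<gamma>. (g \<gamma>)\<^sup>2) has_integral (\<Sum>j\<in>?S. \<sigma> j * (x j)\<^sup>2)) {- 1..1}"
      unfolding g_def v_def by (rule has_integral_comb_sq[OF S])
    have "w * (X\<^sup>2 / 4) = integral {a..a + w} (\<lambda>_. X\<^sup>2 / 4)" using w by simp
    also have "\<dots> \<le> integral {a..a + w} (\<lambda>\<gamma>. (g \<gamma>)\<^sup>2)"
      by (intro integral_le integrable_continuous_interval cont continuous_intros low)
    also have "\<dots> \<le> integral {- 1..1} (\<lambda>\<gamma>. (g \<gamma>)\<^sup>2)"
      using a by (intro integral_subset_le integrable_continuous_interval cont) auto
    also have "\<dots> = (\<Sum>j\<in>?S. \<sigma> j * (x j)\<^sup>2)" using int by (rule integral_unique)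
    also have "\<dots> \<le> (\<Sum>j\<in>?S. \<sigma> h * (x j)\<^sup>2)" by (intro sum_mono mult_right_mono sigma_antimono) auto
    also have "\<dots> = \<sigma> h * X" by (simp add: X_def sum_distrib_left)
    finally have "w * (X\<^sup>2 / 4) \<le> \<sigma> h * X" .
    moreover have "w * (X\<^sup>2 / 4) = (s * X / (8 * t ^ 3)) * X" by (simp add: w_def power2_eq_square)
    ultimately have "(s * X / (8 * t ^ 3)) * X \<le> \<sigma> h * X" by (simp only:)
    then have "s * X / (8 * t ^ 3) \<le> \<sigma> h" proof (rule mult_right_le_imp_le)
      show "0 < X" using s0 unfolding s(2)[symmetric] by simp
    qed
    then have "s ^ 3 \<le> 8 * t ^ 3 * \<sigma> h"
    proof -
      assume "s * X / (8 * t ^ 3) \<le> \<sigma> h"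
      moreover have "s * X = s ^ 3" unfolding s(2)[symmetric] by (simp add: power3_eq_cube power2_eq_square)
      moreover have "0 < 8 * t ^ 3" using t3 by linarith
      ultimately show ?thesis by (simp add: pos_divide_le_eq mult.commute)
    qed
    then have "(s ^ 3)\<^sup>2 \<le> (8 * t ^ 3 * \<sigma> h)\<^sup>2" using s(1) by (intro power_mono) auto
    moreover have "(s ^ 3)\<^sup>2 = X ^ 3" unfolding s(2)[symmetric] by simp
    moreover have "(8 * t ^ 3 * \<sigma> h)\<^sup>2 = 64 * real T ^ 3 * (\<sigma> h)\<^sup>2"
      unfolding t(2)[symmetric] by (simp add: power_mult_distrib)
    ultimately show ?thesis by (simp add: X_def x_def)
  qed
qed

end

text \<open>The margin on which the tuning of h rests. To leading order X^3 decays like 81^-N with N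
  = h ln 2 / (2 ln T), that is, like exp (- 2 ln 2 ln 3 h / ln T), and it has to beat exp (- 3 h /
  (2 ln T)). The left-hand product is only about 3.046, so the estimates of both logarithms must be
  fairly sharp.\<close>

lemma ln2_ln3: "3 < 4 * (ln 2 * ln (3 :: real))"
proof -
  have l2: "69 / 100 \<le> ln (2 :: real)"
    using ln_approx_bounds[of 2 2, simplified, simplified eval_nat_numeral, simplified] by simp
  have "19 * ln (2 :: real) = ln (2 ^ 19)" by (subst ln_realpow) simp_all
  also have "\<dots> \<le> ln (3 ^ 12)" by (subst ln_le_cancel_iff) auto
  also have "\<dots> = 12 * ln 3" by (subst ln_realpow) simp_all
  finally have l3: "19 / 12 * ln 2 \<le> ln (3 :: real)" by simp
  have "3 < 4 * (69 / 100 * (19 / 12 * (69 / 100 :: real)))" by simp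
  also have "\<dots> \<le> 4 * (ln 2 * ln 3)" using l2 l3 by (intro mult_left_mono mult_mono) auto
  finally show ?thesis .
qed

text \<open>The rate 1 / (2 ln T) is the one that the formula for h is made for: if h is at least 2
  ln T ln X, the exponential is at most 1 / X. The threshold is where the margin of
  \<open>ln2_ln3\<close> starts to outweigh the rounding in the number of cells.\<close>

lemma filter_tail_le:
  obtains T\<^sub>0 :: nat where "\<And>T \<phi> \<sigma> h \<alpha>. T\<^sub>0 \<le> T \<Longrightarrow> spectral_filters T \<phi> \<sigma> \<Longrightarrow> \<bar>\<alpha>\<bar> \<le> 1 \<Longrightarrow>
    (\<Sum>j\<in>{h..<T}. (\<Sum>i<T. \<phi> j $ i * \<alpha> ^ i)\<^sup>2) \<le> 120 * real T ^ 2 * exp (- real h / (2 * ln (real T)))"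
proof -
  have "0 < 4 * ln 3 - 3 / ln (2 :: real)" using ln2_ln3 by (simp add: field_simps)
  then have z: "6 \<le> (4 * ln 3 - 3 / ln 2) * x" if "6 / (4 * ln 3 - 3 / ln 2) \<le> x" for x :: real
    using that by (simp only: pos_divide_le_eq mult.commute)
  \<comment> \<open>The 6 is 3 times 2: \<open>J + 1\<close> exceeds the binary logarithm of T by at
    most 2.\<close>
  define z :: real where "z = 6 / (4 * ln 3 - 3 / ln 2)"
  obtain T\<^sub>0 :: nat where T0: "exp z \<le> real T\<^sub>0" using real_arch_simple by blast
  show thesis
  proof (rule that[of "max 2 T\<^sub>0"])
    fix T \<phi> \<sigma> h and \<alpha> :: real
    assume T: "max 2 T\<^sub>0 \<le> T" and sf: "spectral_filters T \<phi> \<sigma>" and \<alpha>: "\<bar>\<alpha>\<bar> \<le> 1"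
    interpret filters T \<phi> \<sigma> by unfold_locales (rule sf)
    let ?X = "\<Sum>j\<in>{h..<T}. (\<Sum>i<T. \<phi> j $ i * \<alpha> ^ i)\<^sup>2"
    show "?X \<le> 120 * real T ^ 2 * exp (- real h / (2 * ln (real T)))"
    proof (cases "h < T")
      case True
      have lnT: "0 < ln (real T)" using T by simp
      have "exp z \<le> real T" using T T0 by simp
      then have "z \<le> ln (real T)" using T by (subst ln_ge_iff) auto
      then have big: "6 \<le> (4 * ln 3 - 3 / ln 2) * ln (real T)" unfolding z_def by (rule z)
      define J where "J = nat \<lceil>log 2 (real T)\<rceil>"
      have log0: "0 \<le> log 2 (real T)" using T by simp
      have J1: "log 2 (real T) \<le> real J" and J2: "real J \<le> log 2 (real T) + 1"
        using log0 by (auto simp: J_def)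
      have "real T = 2 powr log 2 (real T)" using T by simp
      also have "\<dots> \<le> 2 powr real J" using J1 by simp
      also have "\<dots> = 2 ^ J" by (simp add: powr_realpow)
      finally have J: "real T \<le> 2 ^ J" .
      define N where "N = h div (2 * (J + 1))"
      have N: "2 * (J + 1) * N \<le> h" unfolding N_def by (rule times_div_less_eq_dividend)
      have "h \<le> 2 * (J + 1) * (N + 1)"
        using dividend_less_times_div[of "2 * (J + 1)" h] unfolding N_def[symmetric] by simp
      then have "real h \<le> real (2 * (J + 1) * (N + 1))" by (rule of_nat_mono)
      then have "real h \<le> 2 * (real J + 1) * (real N + 1)" by (simp add: algebra_simps)
      then have "real h / (real J + 1) * ln 9 \<le> (2 * (real N + 1)) * ln 9"
        by (intro mult_right_mono) (auto simp: pos_divide_le_eq algebra_simps)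
      moreover have "3 * real h / (2 * ln (real T)) \<le> real h / (real J + 1) * ln 9"
      proof -
        have "ln (9 :: real) = 2 * ln 3" using ln_realpow[of 3 2] by simp
        moreover have "3 * (real J + 1) \<le> 4 * ln 3 * ln (real T)"
          using J2 big unfolding log_def left_diff_distrib by simp
        ultimately have "3 * (real J + 1) \<le> 2 * ln (real T) * ln 9" by (simp only: mult_ac)
        then have "3 / (2 * ln (real T)) \<le> ln 9 / (real J + 1)" using lnT by (simp add: field_simps)
        from mult_left_mono[OF this, of "real h"] show ?thesis by (simp add: mult_ac)
      qed
      ultimately have "3 * real h / (2 * ln (real T)) \<le> 2 * (real N + 1) * ln 9" by linarith
      then have e: "3 * real h / (2 * ln (real T)) \<le> real (2 * (N + 1)) * ln 9" by (simp add: add.commute)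
      have "exp (3 * real h / (2 * ln (real T))) \<le> exp (real (2 * (N + 1)) * ln 9)" using e by simp
      also have "\<dots> = 81 * (9 ^ N)\<^sup>2"
        by (subst exp_of_nat_mult) (simp add: power_add power_even_eq)
      finally have "1 / (9 ^ N)\<^sup>2 \<le> 81 * exp (- (3 * real h / (2 * ln (real T))))"
        by (simp add: exp_minus field_simps)
      moreover have "?X ^ 3 \<le> 64 * real T ^ 3 * (18 * real T / 9 ^ N)\<^sup>2"
        using sigma_le[OF True J N] sigma_nonneg[OF True]
        by (intro order_trans[OF tail_cube_le[OF True \<alpha>]] mult_left_mono power_mono) auto
      ultimately have "?X ^ 3 \<le> 20736 * real T ^ 5 * (81 * exp (- (3 * real h / (2 * ln (real T)))))"
      proof -
        assume 1: "1 / (9 ^ N)\<^sup>2 \<le> 81 * exp (- (3 * real h / (2 * ln (real T))))"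
          and 2: "?X ^ 3 \<le> 64 * real T ^ 3 * (18 * real T / 9 ^ N)\<^sup>2"
        have "64 * real T ^ 3 * (18 * real T / 9 ^ N)\<^sup>2 = 20736 * real T ^ 5 * (1 / (9 ^ N)\<^sup>2)"
          by (simp add: power_divide power_mult_distrib)
        also have "\<dots> \<le> 20736 * real T ^ 5 * (81 * exp (- (3 * real h / (2 * ln (real T)))))"
          by (intro mult_left_mono 1) auto
        finally show ?thesis using 2 by linarith
      qed
      \<comment> \<open>Rounding N down has cost the factor 81. The product 20736 * 81 = 1679616 is
        just below 120^3 = 1728000, and one more factor T makes the power of T a cube.\<close>
      also have "\<dots> \<le> (120 ^ 3) * real T ^ 6 * exp (- (3 * real h / (2 * ln (real T))))"
      proof -
        have "real T ^ 5 \<le> real T ^ 6" using T by (intro power_increasing) auto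
        then have "20736 * real T ^ 5 * 81 \<le> 1728000 * real T ^ 6" using zero_le_power[of "real T" 6] by linarith
        then have "20736 * real T ^ 5 * 81 \<le> (120 ^ 3) * real T ^ 6" by simp
        from mult_right_mono[OF this, of "exp (- (3 * real h / (2 * ln (real T))))"] show ?thesis
          by (simp add: mult_ac)
      qed
      also have "\<dots> = (120 * real T ^ 2 * exp (- real h / (2 * ln (real T)))) ^ 3"
      proof -
        have "exp (- (3 * real h / (2 * ln (real T)))) = exp (- real h / (2 * ln (real T))) ^ 3"
          by (subst exp_of_nat_mult[symmetric]) simp
        then show ?thesis by (simp only: power_mult_distrib power_mult[symmetric]) simp
      qed
      finally have "?X ^ Suc 2 \<le> (120 * real T ^ 2 * exp (- real h / (2 * ln (real T)))) ^ Suc 2"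
        by (simp only: eval_nat_numeral)
      then show ?thesis by (rule power_le_imp_le_base) simp
    qed simp
  qed
qed

section \<open>Characteristic polynomials and norms\<close>

text \<open>Let X be the adjugate of the characteristic matrix and \<open>Y i\<close> the matrix of
  its i-th coefficients. Comparing coefficients in the adjugate identity gives
  \<open>A * Y i\<close> = \<open>Y (i - 1)\<close> minus the i-th coefficient times the identity,
  so the sum telescopes to minus \<open>A ^\<^sub>m Suc N * Y N\<close>, which is 0 for large
  N.\<close>

lemma cayley_hamilton_entry:
  fixes A :: "real mat"
  assumes A: "A \<in> carrier_mat n n" and ab: "a < n" "b < n"
  shows "(\<Sum>i\<le>n. coeff (char_poly A) i * (A ^\<^sub>m i) $$ (a, b)) = 0"
proof -
  define X where "X = adj_mat (char_poly_matrix A)"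
  have cA: "char_poly_matrix A \<in> carrier_mat n n" using A by simp
  have X: "X \<in> carrier_mat n n" and CX: "char_poly_matrix A * X = char_poly A \<cdot>\<^sub>m 1\<^sub>m n"
    using adj_mat[OF cA] by (auto simp: X_def char_poly_def)
  define Y where "Y i = mat n n (\<lambda>(l, b). coeff (X $$ (l, b)) i)" for i
  have Y: "Y i \<in> carrier_mat n n" for i by (simp add: Y_def)
  have rec: "(A * Y i) $$ (l, b) = (if i = 0 then 0 else Y (i - 1) $$ (l, b))
      - (if l = b then coeff (char_poly A) i else 0)" if l: "l < n" "b < n" for i l b
  proof -
    have "(\<Sum>e = 0..<n. char_poly_matrix A $$ (l, e) * X $$ (e, b)) = (if l = b then char_poly A else 0)"
      using arg_cong[OF CX, of "\<lambda>M. M $$ (l, b)"] that cA X by (auto simp: scalar_prod_def)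
    moreover have "char_poly_matrix A $$ (l, e) * X $$ (e, b)
        = (if e = l then pCons 0 (X $$ (e, b)) else 0) - smult (A $$ (l, e)) (X $$ (e, b))" if "e < n" for e
      using that l A by (auto simp: char_poly_matrix_def)
    ultimately have "(\<Sum>e = 0..<n. (if e = l then pCons 0 (X $$ (e, b)) else 0))
        - (\<Sum>e = 0..<n. smult (A $$ (l, e)) (X $$ (e, b))) = (if l = b then char_poly A else 0)"
      by (simp add: sum_subtractf)
    then have "pCons 0 (X $$ (l, b)) - (\<Sum>e = 0..<n. smult (A $$ (l, e)) (X $$ (e, b)))
        = (if l = b then char_poly A else 0)" using l by simp
    from arg_cong[OF this, of "\<lambda>p. coeff p i"]
    have "(case i of 0 \<Rightarrow> 0 | Suc i \<Rightarrow> coeff (X $$ (l, b)) i) - (\<Sum>e = 0..<n. A $$ (l, e) * coeff (X $$ (e, b)) i)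
        = (if l = b then coeff (char_poly A) i else 0)"
      by (simp add: coeff_sum coeff_pCons split: if_splits nat.splits)
    then show ?thesis using l A by (cases i) (auto simp: Y_def scalar_prod_def)
  qed
  have tel: "(\<Sum>i\<le>N. coeff (char_poly A) i * (A ^\<^sub>m i) $$ (a, b)) = - (A ^\<^sub>m Suc N * Y N) $$ (a, b)" for N
  proof (induction N)
    case 0
    have "(A * Y 0) $$ (a, b) = - (if a = b then coeff (char_poly A) 0 else 0)"
      using rec[OF ab, of 0] by simp
    then show ?case using A ab by (simp add: left_mult_one_mat[OF A])
  next
    case (Suc N)
    define P where "P = A ^\<^sub>m Suc N"
    have P: "P \<in> carrier_mat n n" unfolding P_def by (rule pow_carrier_mat[OF A])
    have AY: "A * Y (Suc N) \<in> carrier_mat n n" using A Y by (rule mult_carrier_mat)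
    have ix: "(P * M) $$ (a, b) = (\<Sum>e = 0..<n. P $$ (a, e) * M $$ (e, b))" if "M \<in> carrier_mat n n" for M
      using P that ab by (auto simp: scalar_prod_def)
    have "(P * A * Y (Suc N)) $$ (a, b) = (P * (A * Y (Suc N))) $$ (a, b)"
      using assoc_mult_mat[OF P A Y] by simp
    also have "\<dots> = (\<Sum>e = 0..<n. P $$ (a, e) * (A * Y (Suc N)) $$ (e, b))"
      by (rule ix[OF AY])
    also have "\<dots> = (\<Sum>e = 0..<n. P $$ (a, e) * Y N $$ (e, b))
        - (\<Sum>e = 0..<n. if e = b then P $$ (a, e) * coeff (char_poly A) (Suc N) else 0)"
      unfolding sum_subtractf[symmetric]
      by (intro sum.cong refl) (use ab in \<open>simp add: rec right_diff_distrib\<close>)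
    also have "(\<Sum>e = 0..<n. P $$ (a, e) * Y N $$ (e, b)) = (P * Y N) $$ (a, b)"
      by (rule ix[OF Y, symmetric])
    finally have "(A ^\<^sub>m Suc (Suc N) * Y (Suc N)) $$ (a, b)
        = (P * Y N) $$ (a, b) - P $$ (a, b) * coeff (char_poly A) (Suc N)"
      using ab by (simp add: P_def)
    moreover have "(P * Y N) $$ (a, b) = - (\<Sum>i\<le>N. coeff (char_poly A) i * (A ^\<^sub>m i) $$ (a, b))"
      using Suc by (simp only: P_def)
    ultimately show ?case by (simp add: P_def mult.commute del: pow_mat.simps)
  qed
  \<comment> \<open>Beyond the degree of every entry of the adjugate the matrix \<open>Y N\<close>
    vanishes; the summand \<open>n\<close> also covers the degree of the characteristic
    polynomial.\<close>
  define N where "N = n + Max (insert 0 ((\<lambda>(l, b). Suc (degree (X $$ (l, b)))) ` ({..<n} \<times> {..<n})))"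
  have "Y N = 0\<^sub>m n n"
  proof (rule eq_matI)
    fix l b assume lb: "l < dim_row (0\<^sub>m n n :: real mat)" "b < dim_col (0\<^sub>m n n :: real mat)"
    then have "Suc (degree (X $$ (l, b))) \<le> N"
      unfolding N_def by (intro trans_le_add2 Max_ge) (auto intro!: image_eqI[of _ _ "(l, b)"])
    then show "Y N $$ (l, b) = 0\<^sub>m n n $$ (l, b)" using lb by (simp add: Y_def coeff_eq_0)
  qed (simp_all add: Y_def)
  then have "(A ^\<^sub>m Suc N * Y N) $$ (a, b) = 0" using ab pow_carrier_mat[OF A, of "Suc N"]
    by (metis index_zero_mat(1) right_mult_zero_mat)
  then have "(\<Sum>i\<le>N. coeff (char_poly A) i * (A ^\<^sub>m i) $$ (a, b)) = 0" using tel[of N] by simp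
  moreover have "(\<Sum>i\<le>n. coeff (char_poly A) i * (A ^\<^sub>m i) $$ (a, b))
      = (\<Sum>i\<le>N. coeff (char_poly A) i * (A ^\<^sub>m i) $$ (a, b))"
    using degree_monic_char_poly[OF A]
    by (intro sum.mono_neutral_left) (auto simp: N_def coeff_eq_0)
  ultimately show ?thesis by simp
qed

definition coeff_l1 :: "'a::real_normed_field poly \<Rightarrow> real" where
  "coeff_l1 p = (\<Sum>i\<le>degree p. norm (coeff p i))"

lemma coeff_l1_eq: "degree p \<le> N \<Longrightarrow> coeff_l1 p = (\<Sum>i\<le>N. norm (coeff p i))"
  unfolding coeff_l1_def by (intro sum.mono_neutral_left) (auto simp: coeff_eq_0)

text \<open>A linear factor adds a shifted copy of the coefficients to a multiple of them. Iterated
  over all roots this yields the product of the \<open>1 + cmod z\<close> that occurs in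
  \<open>L_ustb\<close>.\<close>

lemma coeff_l1_linear_mult: "coeff_l1 ([:- z, 1:] * p) \<le> (1 + norm z) * coeff_l1 p"
proof -
  let ?N = "Suc (degree p)"
  have "degree ([:- z, 1:] * p) \<le> ?N"
    using degree_mult_le[of "[:- z, 1:]" p] by (simp del: mult_pCons_left)
  then have "coeff_l1 ([:- z, 1:] * p) = (\<Sum>i\<le>?N. norm (coeff ([:- z, 1:] * p) i))"
    by (rule coeff_l1_eq)
  also have "\<dots> \<le> (\<Sum>i\<le>?N. norm z * norm (coeff p i) + norm (coeff (pCons 0 p) i))"
  proof (rule sum_mono)
    fix i
    have "coeff ([:- z, 1:] * p) i = - (z * coeff p i) + coeff (pCons 0 p) i" by simp
    then show "norm (coeff ([:- z, 1:] * p) i) \<le> norm z * norm (coeff p i) + norm (coeff (pCons 0 p) i)"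
      using norm_triangle_ineq[of "- (z * coeff p i)" "coeff (pCons 0 p) i"] by (simp add: norm_mult)
  qed
  also have "\<dots> = norm z * coeff_l1 p + (\<Sum>i\<le>?N. norm (coeff (pCons 0 p) i))"
    by (subst coeff_l1_eq[of p ?N]) (simp_all only: sum.distrib sum_distrib_left le_SucI order_refl)
  also have "(\<Sum>i\<le>?N. norm (coeff (pCons 0 p) i)) = coeff_l1 p"
    by (subst sum.atMost_Suc_shift) (simp add: coeff_l1_def)
  finally show ?thesis by (simp add: algebra_simps)
qed

lemma coeff_l1_prod:
  "finite S \<Longrightarrow> coeff_l1 (\<Prod>z\<in>S. [:- z, 1:] ^ e z) \<le> (\<Prod>z\<in>S. (1 + norm z) ^ e z)"
proof (induction S rule: finite_induct)
  case (insert z S)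
  have "coeff_l1 ([:- z, 1:] ^ m * p) \<le> (1 + norm z) ^ m * coeff_l1 p" for m p
  proof (induction m)
    case (Suc m)
    have "coeff_l1 ([:- z, 1:] * ([:- z, 1:] ^ m * p)) \<le> (1 + norm z) * ((1 + norm z) ^ m * coeff_l1 p)"
      by (rule order_trans[OF coeff_l1_linear_mult mult_left_mono[OF Suc]]) simp
    then show ?case by (simp only: power_Suc mult.assoc)
  qed simp
  from this[of "e z" "\<Prod>z\<in>S. [:- z, 1:] ^ e z"] mult_left_mono[OF insert.IH, of "(1 + norm z) ^ e z"]
  show ?case unfolding prod.insert[OF insert.hyps] by (meson order_trans zero_le_power add_nonneg_nonneg norm_ge_zero zero_le_one)
qed (simp add: coeff_l1_def)

lemma char_poly_cmat: "A \<in> carrier_mat n n \<Longrightarrow> char_poly (cmat A) = map_poly complex_of_real (char_poly A)"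
  by (rule of_real_hom.char_poly_hom)

lemma char_poly_cmat_monic:
  assumes "A \<in> carrier_mat n n"
  shows "degree (char_poly (cmat A)) = n" "lead_coeff (char_poly (cmat A)) = 1" "char_poly (cmat A) \<noteq> 0"
  using degree_monic_char_poly[of "cmat A" n] assms by auto

lemma alg_mult_eq_0_iff:
  assumes "A \<in> carrier_mat n n"
  shows "alg_mult A z = 0 \<longleftrightarrow> \<not> eigenvalue (cmat A) z"
  using char_poly_cmat_monic[OF assms] assms
  by (simp add: alg_mult_def order_root eigenvalue_root_char_poly[of _ n])

lemma finite_eigenvalues:
  assumes "A \<in> carrier_mat n n"
  shows "finite {z. eigenvalue (cmat A) z}"
proof -
  have "{z. eigenvalue (cmat A) z} = {z. poly (char_poly (cmat A)) z = 0}"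
    using assms by (simp add: eigenvalue_root_char_poly[of _ n])
  then show ?thesis using char_poly_cmat_monic(3)[OF assms] poly_roots_finite by metis
qed

lemma char_poly_decompose:
  assumes A: "A \<in> carrier_mat n n"
  shows "char_poly (cmat A) = (\<Prod>z | eigenvalue (cmat A) z. [:- z, 1:] ^ alg_mult A z)"
  using complex_poly_decompose[of "char_poly (cmat A)"] char_poly_cmat_monic[OF A] A
  by (simp add: alg_mult_def eigenvalue_root_char_poly[of _ n])

lemma sum_alg_mult:
  assumes A: "A \<in> carrier_mat n n"
  shows "(\<Sum>z | eigenvalue (cmat A) z. alg_mult A z) = n"
proof -
  have "n = degree (\<Prod>z | eigenvalue (cmat A) z. [:- z, 1:] ^ alg_mult A z)"
    using char_poly_cmat_monic(1)[OF A] char_poly_decompose[OF A] by simp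
  also have "\<dots> = (\<Sum>z | eigenvalue (cmat A) z. degree ([:- z, 1:] ^ alg_mult A z))"
    by (rule degree_prod_eq_sum_degree) simp
  finally show ?thesis by (simp add: degree_linear_power)
qed

lemma coeff_char_poly_l1:
  assumes A: "A \<in> carrier_mat n n"
  shows "(\<Sum>i\<le>n. \<bar>coeff (char_poly A) i\<bar>) \<le> (\<Prod>z | eigenvalue (cmat A) z. (1 + cmod z) ^ alg_mult A z)"
proof -
  have "(\<Sum>i\<le>n. \<bar>coeff (char_poly A) i\<bar>) = coeff_l1 (char_poly (cmat A))"
    unfolding coeff_l1_def char_poly_cmat[OF A]
    using degree_monic_char_poly[OF A] by simp
  then show ?thesis
    using coeff_l1_prod[OF finite_eigenvalues[OF A], of "alg_mult A"] char_poly_decompose[OF A] by simp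
qed

section \<open>Diagonal and block diagonal matrices\<close>

lemma diagonal_eigenvalue:
  fixes D :: "'a::field mat"
  assumes D: "D \<in> carrier_mat n n" and diag: "diagonal_mat D" and a: "a < n"
  shows "eigenvalue D (D $$ (a, a))"
proof -
  have "D *\<^sub>v unit_vec n a = D $$ (a, a) \<cdot>\<^sub>v unit_vec n a"
    using D diag a by (intro eq_vecI) (auto simp: diagonal_mat_def)
  moreover have "unit_vec n a \<noteq> (0\<^sub>v n :: 'a vec)" using a
    by (metis index_unit_vec(2) index_zero_vec(1) zero_neq_one)
  ultimately show ?thesis using D unfolding eigenvalue_def eigenvector_def
    by (intro exI[of _ "unit_vec n a"]) auto
qed

lemma diagonal_pow:
  fixes D :: "'a::field mat"
  assumes D: "D \<in> carrier_mat n n" and diag: "diagonal_mat D" and ab: "a < n" "b < n"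
  shows "(D ^\<^sub>m j) $$ (a, b) = (if a = b then D $$ (a, a) ^ j else 0)"
  using ab
proof (induction j arbitrary: a b)
  case 0
  then show ?case using D by simp
next
  case (Suc j)
  have "(D ^\<^sub>m j * D) $$ (a, b) = (\<Sum>e = 0..<n. (D ^\<^sub>m j) $$ (a, e) * D $$ (e, b))"
    using D Suc.prems by (auto simp: scalar_prod_def)
  also have "\<dots> = (\<Sum>e = 0..<n. if e = b then (if a = b then D $$ (a, a) ^ j * D $$ (b, b) else 0) else 0)"
    using Suc D diag by (intro sum.cong refl) (auto simp: diagonal_mat_def)
  finally show ?case using Suc.prems by simp
qed

lemma index_mult3:
  fixes X :: "'a::comm_semiring_0 mat"
  assumes "X \<in> carrier_mat p n" "M \<in> carrier_mat n n'" "Y \<in> carrier_mat n' m" "i < p" "l < m"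
  shows "(X * M * Y) $$ (i, l) = (\<Sum>a<n. \<Sum>b<n'. X $$ (i, a) * M $$ (a, b) * Y $$ (b, l))"
proof -
  have "(X * M * Y) $$ (i, l) = (\<Sum>b<n'. (\<Sum>a<n. X $$ (i, a) * M $$ (a, b)) * Y $$ (b, l))"
  proof -
    define N where "N = X * M"
    have N: "N \<in> carrier_mat p n'" unfolding N_def using assms by simp
    have "(N * Y) $$ (i, l) = (\<Sum>b<n'. N $$ (i, b) * Y $$ (b, l))"
      using N assms by (auto simp: scalar_prod_def atLeast0LessThan)
    moreover have "N $$ (i, b) = (\<Sum>a<n. X $$ (i, a) * M $$ (a, b))" if "b < n'" for b
      using assms that by (auto simp: N_def scalar_prod_def atLeast0LessThan)
    ultimately show ?thesis by (simp add: N_def)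
  qed
  then show ?thesis unfolding sum_distrib_right by (subst sum.swap) simp
qed

lemma index_mult_diagonal:
  fixes X :: "'a::field mat"
  assumes X: "X \<in> carrier_mat p n" and D: "D \<in> carrier_mat n n" "diagonal_mat D"
    and Y: "Y \<in> carrier_mat n m" and il: "i < p" "l < m"
  shows "(X * D ^\<^sub>m j * Y) $$ (i, l) = (\<Sum>a<n. X $$ (i, a) * Y $$ (a, l) * D $$ (a, a) ^ j)"
  unfolding index_mult3[OF X pow_carrier_mat[OF D(1)] Y il]
  by (intro sum.cong refl) (simp add: diagonal_pow[OF D] if_distrib[of "\<lambda>x. _ * x"]
      if_distrib[of "\<lambda>x. x * _"] mult_ac cong: if_cong)

lemma sum_lessThan_add: "sum f {..<r + s :: nat} = sum f {..<r} + (\<Sum>i<s. f (r + i))"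
  by (induction s) (simp_all add: add.assoc)

lemma index_mult_four_block:
  fixes X :: "'a::comm_semiring_0 mat"
  assumes X: "X \<in> carrier_mat p (r + s)" and M: "M \<in> carrier_mat r r" and N: "N \<in> carrier_mat s s"
    and Y: "Y \<in> carrier_mat (r + s) m" and il: "i < p" "l < m"
  shows "(X * four_block_mat M (0\<^sub>m r s) (0\<^sub>m s r) N * Y) $$ (i, l)
    = (col_block 0 r X * M * row_block 0 r Y) $$ (i, l) + (col_block r s X * N * row_block r s Y) $$ (i, l)"
proof -
  have F: "four_block_mat M (0\<^sub>m r s) (0\<^sub>m s r) N \<in> carrier_mat (r + s) (r + s)"
    using M N by (rule four_block_carrier_mat)
  have c: "col_block 0 r X \<in> carrier_mat p r" "row_block 0 r Y \<in> carrier_mat r m"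
    "col_block r s X \<in> carrier_mat p s" "row_block r s Y \<in> carrier_mat s m"
    using X Y by (auto simp: col_block_def row_block_def)
  show ?thesis
    unfolding index_mult3[OF X F Y il] index_mult3[OF c(1) M c(2) il] index_mult3[OF c(3) N c(4) il]
    using M N X Y il by (simp add: sum_lessThan_add row_block_def col_block_def sum.distrib)
qed

section \<open>Entries, rows and columns against the matrix norms\<close>

lemma inf_norm_row_sum_le:
  "i < dim_row M \<Longrightarrow> (\<Sum>j<dim_col M. \<bar>M $$ (i, j)\<bar>) \<le> inf_norm M"
  unfolding inf_norm_def by (intro Max_ge) auto

lemma inf_norm_le:
  assumes "0 \<le> b" "\<And>i. i < dim_row M \<Longrightarrow> (\<Sum>j<dim_col M. \<bar>M $$ (i, j)\<bar>) \<le> b"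
  shows "inf_norm M \<le> b"
  unfolding inf_norm_def using assms by (subst Max_le_iff) auto

lemma inf_norm_nonneg: "0 \<le> inf_norm M"
  unfolding inf_norm_def by (intro Max_ge) auto

lemma abs_index_le_inf_norm:
  assumes "i < dim_row M" "j < dim_col M"
  shows "\<bar>M $$ (i, j)\<bar> \<le> inf_norm M"
proof -
  have "\<bar>M $$ (i, j)\<bar> \<le> (\<Sum>j<dim_col M. \<bar>M $$ (i, j)\<bar>)"
    using assms by (intro member_le_sum) auto
  then show ?thesis using inf_norm_row_sum_le[OF assms(1)] by linarith
qed

lemma inf_norm_mult:
  assumes X: "X \<in> carrier_mat p n" and Y: "Y \<in> carrier_mat n m"
  shows "inf_norm (X * Y) \<le> inf_norm X * inf_norm Y"
proof (rule inf_norm_le)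
  show "0 \<le> inf_norm X * inf_norm Y" by (simp add: inf_norm_nonneg)
  fix i assume "i < dim_row (X * Y)"
  then have i: "i < p" using X by simp
  have "(\<Sum>j<m. \<bar>(X * Y) $$ (i, j)\<bar>) \<le> (\<Sum>j<m. \<Sum>a<n. \<bar>X $$ (i, a)\<bar> * \<bar>Y $$ (a, j)\<bar>)"
  proof (rule sum_mono)
    fix j assume "j \<in> {..<m}"
    then have "(X * Y) $$ (i, j) = (\<Sum>a<n. X $$ (i, a) * Y $$ (a, j))"
      using X Y i by (auto simp: scalar_prod_def atLeast0LessThan)
    then show "\<bar>(X * Y) $$ (i, j)\<bar> \<le> (\<Sum>a<n. \<bar>X $$ (i, a)\<bar> * \<bar>Y $$ (a, j)\<bar>)"
      using sum_abs[of "\<lambda>a. X $$ (i, a) * Y $$ (a, j)" "{..<n}"] by (simp add: abs_mult)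
  qed
  also have "\<dots> = (\<Sum>a<n. \<bar>X $$ (i, a)\<bar> * (\<Sum>j<m. \<bar>Y $$ (a, j)\<bar>))"
    unfolding sum_distrib_left by (rule sum.swap)
  also have "\<dots> \<le> (\<Sum>a<n. \<bar>X $$ (i, a)\<bar> * inf_norm Y)"
    using Y inf_norm_row_sum_le[of _ Y] by (intro sum_mono mult_left_mono) auto
  also have "\<dots> \<le> inf_norm X * inf_norm Y"
    unfolding sum_distrib_right[symmetric] using X i inf_norm_row_sum_le[of i X] inf_norm_nonneg
    by (intro mult_right_mono) auto
  finally show "(\<Sum>j<dim_col (X * Y). \<bar>(X * Y) $$ (i, j)\<bar>) \<le> inf_norm X * inf_norm Y"
    using Y by simp
qed

lemma inf_norm_pow:
  assumes A: "A \<in> carrier_mat n n"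
  shows "inf_norm (A ^\<^sub>m j) \<le> max 1 (inf_norm A) ^ j"
proof (induction j)
  case 0
  show ?case using A by (intro inf_norm_le) (auto simp: if_distrib cong: if_cong)
next
  case (Suc j)
  have "inf_norm (A ^\<^sub>m j * A) \<le> inf_norm (A ^\<^sub>m j) * inf_norm A"
    by (rule inf_norm_mult[OF pow_carrier_mat[OF A] A])
  also have "\<dots> \<le> max 1 (inf_norm A) ^ j * max 1 (inf_norm A)"
    by (intro mult_mono Suc) (auto simp: inf_norm_nonneg)
  finally show ?case by (simp add: mult.commute)
qed

lemma abs_index_mult3_pow_le:
  assumes X: "X \<in> carrier_mat p q" and A: "A \<in> carrier_mat q q" and Y: "Y \<in> carrier_mat q m"
    and il: "i < p" "l < m" and j: "j \<le> N"
  shows "\<bar>(X * A ^\<^sub>m j * Y) $$ (i, l)\<bar> \<le> inf_norm X * inf_norm Y * max 1 (inf_norm A) ^ N"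
proof -
  have P: "A ^\<^sub>m j \<in> carrier_mat q q" using A by simp
  have "\<bar>(X * A ^\<^sub>m j * Y) $$ (i, l)\<bar> \<le> inf_norm (X * A ^\<^sub>m j * Y)"
    using X Y il by (intro abs_index_le_inf_norm) auto
  also have "\<dots> \<le> inf_norm (X * A ^\<^sub>m j) * inf_norm Y"
    using X P Y by (intro inf_norm_mult[of _ p q _ m]) auto
  also have "\<dots> \<le> (inf_norm X * inf_norm (A ^\<^sub>m j)) * inf_norm Y"
    by (intro mult_right_mono inf_norm_mult[OF X P] inf_norm_nonneg)
  also have "\<dots> \<le> (inf_norm X * max 1 (inf_norm A) ^ j) * inf_norm Y"
    by (intro mult_right_mono mult_left_mono inf_norm_pow[OF A] inf_norm_nonneg)
  also have "\<dots> \<le> (inf_norm X * max 1 (inf_norm A) ^ N) * inf_norm Y"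
    by (intro mult_right_mono mult_left_mono power_increasing j inf_norm_nonneg) auto
  finally show ?thesis by (simp add: mult_ac)
qed

text \<open>The eigenvalue equation is read at a coordinate of largest modulus of the
  eigenvector.\<close>

lemma eigenvalue_le_inf_norm:
  assumes A: "A \<in> carrier_mat n n" and z: "eigenvalue (cmat A) z"
  shows "cmod z \<le> inf_norm A"
proof -
  obtain v where v: "v \<in> carrier_vec n" "v \<noteq> 0\<^sub>v n" "cmat A *\<^sub>v v = z \<cdot>\<^sub>v v"
    using z A unfolding eigenvalue_def eigenvector_def by auto
  let ?m = "Max ((\<lambda>i. cmod (v $ i)) ` {..<n})"
  obtain a where a: "a < n" "v $ a \<noteq> 0" using v(1,2) by (metis carrier_vecD eq_vecI index_zero_vec)
  then have ne: "(\<lambda>i. cmod (v $ i)) ` {..<n} \<noteq> {}" by auto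
  have le: "cmod (v $ i) \<le> ?m" if "i < n" for i using that by (intro Max_ge) auto
  have pos: "0 < ?m" using le[OF a(1)] a(2) by (meson less_le_trans zero_less_norm_iff)
  obtain i where i: "i < n" "cmod (v $ i) = ?m" using Max_in[OF _ ne] by auto
  have "z * v $ i = (\<Sum>j<n. complex_of_real (A $$ (i, j)) * v $ j)"
    using arg_cong[OF v(3), of "\<lambda>w. w $ i"] v(1) i A by (simp add: scalar_prod_def atLeast0LessThan)
  then have "cmod z * ?m = cmod (\<Sum>j<n. complex_of_real (A $$ (i, j)) * v $ j)"
    using i(2) by (metis norm_mult)
  also have "\<dots> \<le> (\<Sum>j<n. \<bar>A $$ (i, j)\<bar> * ?m)"
    by (rule order_trans[OF norm_sum sum_mono]) (auto simp: norm_mult intro!: mult_left_mono le)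
  also have "\<dots> \<le> inf_norm A * ?m"
    unfolding sum_distrib_right[symmetric] using inf_norm_row_sum_le[of i A] A i pos
    by (intro mult_right_mono) auto
  finally show ?thesis using pos by (simp add: mult_le_cancel_right_pos)
qed

lemma sum_abs_mult_le_L2: "(\<Sum>a\<in>S. \<bar>f a * g a\<bar>) \<le> L2_set f S * L2_set g S" for f g :: "'a \<Rightarrow> real"
  using L2_set_mult_ineq[of f g S] by (simp add: abs_mult)

lemma frob_norm_eq:
  "frob_norm M = sqrt (\<Sum>i<dim_row M. \<Sum>j<dim_col M. (M $$ (i, j))\<^sup>2)"
  unfolding frob_norm_def L2_set_def sum.cartesian_product
  by (intro arg_cong[where f = sqrt] sum.cong) auto

lemma frob_norm_nonneg: "0 \<le> frob_norm X"
  by (simp add: frob_norm_def)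

lemma L2_row_le_frob_norm:
  assumes "i < dim_row M"
  shows "L2_set (\<lambda>a. M $$ (i, a)) {..<dim_col M} \<le> frob_norm M"
  unfolding frob_norm_eq L2_set_def using assms
  by (intro real_sqrt_le_mono member_le_sum[where f = "\<lambda>i. \<Sum>j<dim_col M. (M $$ (i, j))\<^sup>2"] sum_nonneg) auto

lemma L2_col_le_frob_norm:
  assumes "l < dim_col M"
  shows "L2_set (\<lambda>a. M $$ (a, l)) {..<dim_row M} \<le> frob_norm M"
  unfolding frob_norm_eq L2_set_def using assms
  by (intro real_sqrt_le_mono sum_mono member_le_sum[where f = "\<lambda>j. (M $$ (_, j))\<^sup>2"]) auto

lemma index_le_l2norm: "i < dim_vec x \<Longrightarrow> norm (x $ i) \<le> l2norm x"
  unfolding l2norm_def by (intro member_le_L2_set) auto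

lemma l2norm_le_spectral_norm:
  assumes x: "x \<in> carrier_vec (dim_col M)" "l2norm x \<le> 1"
  shows "l2norm (M *\<^sub>v x) \<le> spectral_norm M"
proof -
  \<comment> \<open>The supremum only bounds its members if the set is bounded above; the sum of the
    moduli of all entries serves as a bound.\<close>
  have "l2norm (M *\<^sub>v y) \<le> (\<Sum>i<dim_row M. \<Sum>j<dim_col M. cmod (M $$ (i, j)))"
    if y: "y \<in> carrier_vec (dim_col M)" "l2norm y \<le> 1" for y
  proof -
    have "l2norm (M *\<^sub>v y) \<le> (\<Sum>i<dim_row M. \<bar>norm ((M *\<^sub>v y) $ i)\<bar>)"
      unfolding l2norm_def dim_mult_mat_vec by (rule L2_set_le_sum_abs)
    also have "\<dots> \<le> (\<Sum>i<dim_row M. \<Sum>j<dim_col M. cmod (M $$ (i, j)))"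
    proof (rule sum_mono)
      fix i assume i: "i \<in> {..<dim_row M}"
      have "(M *\<^sub>v y) $ i = (\<Sum>j<dim_col M. M $$ (i, j) * y $ j)"
        using i y(1) by (simp add: scalar_prod_def atLeast0LessThan)
      also have "cmod \<dots> \<le> (\<Sum>j<dim_col M. cmod (M $$ (i, j)) * 1)"
        unfolding norm_mult[symmetric]
      proof (rule order_trans[OF norm_sum sum_mono])
        fix j assume "j \<in> {..<dim_col M}"
        then have "cmod (y $ j) \<le> 1" using y index_le_l2norm[of j y] by auto
        then show "cmod (M $$ (i, j) * y $ j) \<le> cmod (M $$ (i, j)) * 1"
          unfolding norm_mult by (intro mult_left_mono) auto
      qed
      finally show "\<bar>norm ((M *\<^sub>v y) $ i)\<bar> \<le> (\<Sum>j<dim_col M. cmod (M $$ (i, j)))" by simp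
    qed
    finally show ?thesis .
  qed
  then have "bdd_above {l2norm (M *\<^sub>v x) | x. x \<in> carrier_vec (dim_col M) \<and> l2norm x \<le> 1}"
    by (intro bdd_aboveI) blast
  then show ?thesis unfolding spectral_norm_def using x by (intro cSup_upper) blast+
qed

lemma L2_col_le_spectral_norm:
  assumes "l < dim_col M"
  shows "L2_set (\<lambda>a. cmod (M $$ (a, l))) {..<dim_row M} \<le> spectral_norm M"
proof -
  have "l2norm (unit_vec (dim_col M) l :: complex vec) = 1"
    using assms by (simp add: l2norm_def L2_set_def if_distrib[of norm] if_distrib[of "\<lambda>x. x\<^sup>2"] cong: if_cong)
  moreover have "M *\<^sub>v unit_vec (dim_col M) l = col M l"
    using assms by (intro eq_vecI) auto
  ultimately have "l2norm (col M l) \<le> spectral_norm M"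
    using l2norm_le_spectral_norm[of "unit_vec (dim_col M) l" M] by simp
  moreover have "l2norm (col M l) = L2_set (\<lambda>a. cmod (M $$ (a, l))) {..<dim_row M}"
    unfolding l2norm_def using assms by (intro L2_set_cong) auto
  ultimately show ?thesis by simp
qed

lemma L2_row_le_spectral_norm:
  assumes i: "i < dim_row M"
  shows "L2_set (\<lambda>a. cmod (M $$ (i, a))) {..<dim_col M} \<le> spectral_norm M"
proof -
  define R where "R = L2_set (\<lambda>a. cmod (M $$ (i, a))) {..<dim_col M}"
  have R0: "0 \<le> R" by (simp add: R_def)
  \<comment> \<open>The normalized conjugate row, at which the i-th coordinate of the image is the
    norm of the row. For a zero row, division by 0 makes \<open>x\<close> the zero vector, and the
    argument goes through unchanged.\<close>
  define x where "x = vec (dim_col M) (\<lambda>a. cnj (M $$ (i, a)) / complex_of_real R)"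
  have xc: "x \<in> carrier_vec (dim_col M)" by (simp add: x_def)
  have "l2norm x = L2_set (\<lambda>a. cmod (M $$ (i, a)) * (1 / R)) {..<dim_col M}"
    unfolding l2norm_def using R0 by (intro L2_set_cong) (auto simp: x_def norm_divide)
  also have "\<dots> = R * (1 / R)" unfolding R_def by (rule L2_set_left_distrib[symmetric]) (use R0 in \<open>simp add: R_def\<close>)
  finally have "l2norm x \<le> 1" by simp
  from l2norm_le_spectral_norm[OF xc this] have le: "l2norm (M *\<^sub>v x) \<le> spectral_norm M" .
  have "(M *\<^sub>v x) $ i = (\<Sum>a<dim_col M. complex_of_real ((cmod (M $$ (i, a)))\<^sup>2 / R))"
    using i by (simp add: x_def scalar_prod_def atLeast0LessThan flip: complex_norm_square)
  also have "\<dots> = complex_of_real (R\<^sup>2 / R)"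
    unfolding of_real_sum[symmetric] sum_divide_distrib[symmetric]
    by (simp add: R_def L2_set_def sum_nonneg)
  finally have "cmod ((M *\<^sub>v x) $ i) = R" using R0 by (simp add: power2_eq_square norm_mult norm_divide)
  then show ?thesis using le index_le_l2norm[of i "M *\<^sub>v x"] i by (simp add: R_def)
qed

lemma spectral_norm_nonneg: "0 \<le> spectral_norm M"
  using l2norm_le_spectral_norm[of "0\<^sub>v (dim_col M)" M]
  by (simp add: l2norm_def L2_set_def)

section \<open>Mode decomposition of the impulse response\<close>

lemma tau_mono: "k \<le> k' \<Longrightarrow> tau k \<le> tau k'"
  by (simp add: tau_def)

lemma tau_pos: "0 < tau k"
  by (simp add: tau_def)

text \<open>The smallest value of \<open>1 - 1 / tau k\<close> for \<open>k \<ge> 1\<close>.\<close>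

definition min_rate :: real where "min_rate = 1 - 1 / ln 3"

lemma min_rate: "0 < min_rate" "min_rate < 1"
  using ln3_gt_1 by (auto simp: min_rate_def field_simps)

lemma tau_gt_1: "1 \<le> k \<Longrightarrow> 1 < tau k"
proof -
  assume "1 \<le> k"
  then have "tau 1 \<le> tau k" by (rule tau_mono)
  moreover have "tau 1 = ln 3" by (simp add: tau_def)
  ultimately show ?thesis using ln3_gt_1 by linarith
qed

lemma rate_bounds:
  assumes "1 \<le> k"
  shows "min_rate \<le> 1 - 1 / tau k" "1 - 1 / tau k < 1"
proof -
  have "ln 3 \<le> tau k" using tau_mono[OF assms] by (simp add: tau_def add.commute)
  then show "min_rate \<le> 1 - 1 / tau k" using ln3_gt_1 by (simp add: min_rate_def frac_le)
  show "1 - 1 / tau k < 1" using tau_pos by simp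
qed

text \<open>The least value exists because the state dimension itself qualifies. As
  \<open>tau\<close> increases, the set of unstable eigenvalues shrinks with its index, so replacing
  the least value by its maximum with 1 keeps the count below the index.\<close>

lemma instability_complexity_bounds:
  assumes A: "A \<in> carrier_mat d d" and k: "k = instability_complexity A"
  shows "1 \<le> k" "(\<Sum>z\<in>unstable_eigs k A. alg_mult A z) \<le> k"
proof -
  let ?s = "\<lambda>k. \<Sum>z\<in>unstable_eigs k A. alg_mult A z"
  define l where "l = (LEAST k. ?s k \<le> k)"
  have sub: "unstable_eigs i A \<subseteq> {z. eigenvalue (cmat A) z}" for i by (auto simp: unstable_eigs_def)
  then have fin: "finite (unstable_eigs i A)" for i
    using finite_eigenvalues[OF A] finite_subset by blast
  have "?s d \<le> (\<Sum>z | eigenvalue (cmat A) z. alg_mult A z)"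
    using finite_eigenvalues[OF A] sub by (intro sum_mono2) auto
  then have "?s d \<le> d" using sum_alg_mult[OF A] by simp
  then have l: "?s l \<le> l" unfolding l_def by (rule LeastI)
  have kl: "k = max 1 l" by (simp add: k instability_complexity_def l_def)
  show "1 \<le> k" by (simp add: kl)
  have "unstable_eigs k A \<subseteq> unstable_eigs l A"
  proof -
    have "1 - 1 / tau l \<le> 1 - 1 / tau k"
      using tau_mono[of l k] tau_pos[of l] kl by (simp add: frac_le)
    then show ?thesis by (auto simp: unstable_eigs_def)
  qed
  then have "?s k \<le> ?s l" using fin by (intro sum_mono2) auto
  then show "?s k \<le> k" using l kl by linarith
qed

lemma pow_mat_comm:
  fixes A :: "'a::comm_semiring_1 mat"
  assumes A: "A \<in> carrier_mat n n"
  shows "A * A ^\<^sub>m j = A ^\<^sub>m j * A"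
proof (induction j)
  case (Suc j)
  have P: "A ^\<^sub>m j \<in> carrier_mat n n" by (rule pow_carrier_mat[OF A])
  have "A * (A ^\<^sub>m j * A) = (A * A ^\<^sub>m j) * A"
    by (rule assoc_mult_mat[OF A P A, symmetric])
  then show ?case using Suc by simp
qed (use A in simp)

lemma pow_mat_add:
  fixes A :: "'a::comm_semiring_1 mat"
  assumes A: "A \<in> carrier_mat n n"
  shows "A ^\<^sub>m (e + i) = A ^\<^sub>m e * A ^\<^sub>m i"
proof (induction i)
  case (Suc i)
  have "A ^\<^sub>m e * A ^\<^sub>m i * A = A ^\<^sub>m e * (A ^\<^sub>m i * A)"
    by (rule assoc_mult_mat[OF pow_carrier_mat[OF A] pow_carrier_mat[OF A] A])
  then show ?case using Suc by simp
qed (use A in simp)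

lemma cayley_hamilton_shift:
  fixes A :: "real mat"
  assumes A: "A \<in> carrier_mat n n" and ab: "a < n" "b < n"
  shows "(\<Sum>i\<le>n. coeff (char_poly A) i * (A ^\<^sub>m (e + i)) $$ (a, b)) = 0"
proof -
  have "(A ^\<^sub>m (e + i)) $$ (a, b) = (\<Sum>x<n. (A ^\<^sub>m e) $$ (a, x) * (A ^\<^sub>m i) $$ (x, b))" for i
    unfolding pow_mat_add[OF A] using A ab pow_carrier_mat[OF A, of e] pow_carrier_mat[OF A, of i]
    by (simp add: scalar_prod_def atLeast0LessThan)
  then have "(\<Sum>i\<le>n. coeff (char_poly A) i * (A ^\<^sub>m (e + i)) $$ (a, b))
      = (\<Sum>i\<le>n. \<Sum>x<n. (A ^\<^sub>m e) $$ (a, x) * (coeff (char_poly A) i * (A ^\<^sub>m i) $$ (x, b)))"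
    by (simp add: sum_distrib_left mult_ac)
  also have "\<dots> = (\<Sum>x<n. (A ^\<^sub>m e) $$ (a, x) * (\<Sum>i\<le>n. coeff (char_poly A) i * (A ^\<^sub>m i) $$ (x, b)))"
    unfolding sum_distrib_left by (rule sum.swap)
  also have "\<dots> = 0" using cayley_hamilton_entry[OF A _ ab(2)] by simp
  finally show ?thesis .
qed

text \<open>The impulse response formula. \<open>C\<close> varies in the induction: splitting off
  the last input leaves the earlier state observed through \<open>C * A\<close>.\<close>

lemma lds_output_index:
  assumes A: "A \<in> carrier_mat d d" and B: "B \<in> carrier_mat d m"
    and u: "\<And>t. 1 \<le> t \<Longrightarrow> u t \<in> carrier_vec m"
  shows "C \<in> carrier_mat p d \<Longrightarrow> i < p \<Longrightarrow>
    lds_output d A B C u t $ i = (\<Sum>j<t. \<Sum>l<m. (C * A ^\<^sub>m j * B) $$ (i, l) * (u (t - j) $ l))"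
  unfolding lds_output_def
proof (induction t arbitrary: C)
  case 0
  then show ?case by simp
next
  case (Suc t)
  note C = Suc.prems(1)
  let ?x = "lds_state d A B u"
  have x: "?x s \<in> carrier_vec d" for s
    using A B u by (induction s) (auto intro!: add_carrier_vec mult_mat_vec_carrier)
  have uS: "u (Suc t) \<in> carrier_vec m" by (rule u) simp
  have CA: "C * A \<in> carrier_mat p d" and CB: "C * B \<in> carrier_mat p m" using A B C by auto
  have "C *\<^sub>v ?x (Suc t) = C *\<^sub>v (A *\<^sub>v ?x t) + C *\<^sub>v (B *\<^sub>v u (Suc t))"
    using mult_add_distrib_mat_vec[OF C mult_mat_vec_carrier[OF A x] mult_mat_vec_carrier[OF B uS]] by simp
  also have "C *\<^sub>v (A *\<^sub>v ?x t) = (C * A) *\<^sub>v ?x t" using assoc_mult_mat_vec[OF C A x] by simp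
  also have "C *\<^sub>v (B *\<^sub>v u (Suc t)) = (C * B) *\<^sub>v u (Suc t)" using assoc_mult_mat_vec[OF C B uS] by simp
  finally have "(C *\<^sub>v ?x (Suc t)) $ i = ((C * A) *\<^sub>v ?x t) $ i + ((C * B) *\<^sub>v u (Suc t)) $ i"
    using Suc.prems CB by simp
  also have "((C * B) *\<^sub>v u (Suc t)) $ i = (\<Sum>l<m. (C * B) $$ (i, l) * (u (Suc t) $ l))"
  proof -
    define N where "N = C * B"
    have "N \<in> carrier_mat p m" using CB by (simp add: N_def)
    then have "(N *\<^sub>v u (Suc t)) $ i = (\<Sum>l<m. N $$ (i, l) * (u (Suc t) $ l))"
      using Suc.prems(2) uS by (auto simp: scalar_prod_def atLeast0LessThan)
    then show ?thesis by (simp only: N_def)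
  qed
  also have "((C * A) *\<^sub>v ?x t) $ i = (\<Sum>j<t. \<Sum>l<m. (C * A * A ^\<^sub>m j * B) $$ (i, l) * (u (t - j) $ l))"
    by (rule Suc.IH[OF CA Suc.prems(2)])
  also have "\<dots> = (\<Sum>j<t. \<Sum>l<m. (C * A ^\<^sub>m Suc j * B) $$ (i, l) * (u (Suc t - Suc j) $ l))"
  proof -
    have "C * A * A ^\<^sub>m j = C * A ^\<^sub>m Suc j" for j
      using assoc_mult_mat[OF C A pow_carrier_mat[OF A]] pow_mat_comm[OF A] by simp
    then show ?thesis by simp
  qed
  finally show ?case
    unfolding sum.lessThan_Suc_shift using C A by (simp add: right_mult_one_mat[OF C] add.commute)
qed

text \<open>With multiplicities, the spectrum of \<open>Au\<close> is the unstable part of that of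
  \<open>A\<close>; the dimension of the block is thus the number counted by the instability
  complexity.\<close>

lemma unstable_block_bounds:
  assumes sys: "lds_system d m p A B C k"
    and blk: "lds_blocks k A B C Au Bst Bu Bf Cst Cu Cf V W"
  shows "Au \<in> carrier_mat (dim_row Au) (dim_row Au)" "Bu \<in> carrier_mat (dim_row Au) m"
    "Cu \<in> carrier_mat p (dim_row Au)" "dim_row Au \<le> k" "unstable_eigs k A = {z. eigenvalue (cmat Au) z}"
    "(\<Sum>z\<in>unstable_eigs k A. alg_mult A z) \<le> k"
    "\<And>z. z \<in> unstable_eigs k A \<Longrightarrow> alg_mult A z = alg_mult Au z"
proof -
  have A: "A \<in> carrier_mat d d" and B: "B \<in> carrier_mat d m" and C: "C \<in> carrier_mat p d"
    and k: "k = instability_complexity A"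
    using sys by (auto simp: lds_system_def)
  obtain \<Lambda> Af P Q where bd: "block_diagonalization k A \<Lambda> Au Af P Q"
    and bc: "Bu = row_block (dim_row \<Lambda>) (dim_row Au) (Q * B)"
      "Cu = col_block (dim_row \<Lambda>) (dim_row Au) (C * P)"
    using blk unfolding lds_blocks_def Let_def by blast
  show Au: "Au \<in> carrier_mat (dim_row Au) (dim_row Au)"
    using bd unfolding block_diagonalization_def carrier_mat_def square_mat.simps by blast
  show "Bu \<in> carrier_mat (dim_row Au) m" "Cu \<in> carrier_mat p (dim_row Au)"
    by (subst bc, use B C in \<open>simp add: row_block_def col_block_def\<close>)+
  have m2: "alg_mult Au z = (if z \<in> unstable_eigs k A then alg_mult A z else 0)" for z
    using bd unfolding block_diagonalization_def by blast
  show uk: "(\<Sum>z\<in>unstable_eigs k A. alg_mult A z) \<le> k"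
    using instability_complexity_bounds[OF A k] by auto
  have "eigenvalue (cmat Au) z \<longleftrightarrow> z \<in> unstable_eigs k A" for z
    using alg_mult_eq_0_iff[OF Au, of z] alg_mult_eq_0_iff[OF A, of z] m2[of z]
    by (auto simp: unstable_eigs_def split: if_splits)
  then show un: "unstable_eigs k A = {z. eigenvalue (cmat Au) z}" by blast
  show "alg_mult A z = alg_mult Au z" if "z \<in> unstable_eigs k A" for z using m2 that by simp
  then have "(\<Sum>z\<in>unstable_eigs k A. alg_mult A z) = (\<Sum>z\<in>unstable_eigs k A. alg_mult Au z)"
    by (rule sum.cong[OF refl])
  then show "dim_row Au \<le> k" using sum_alg_mult[OF Au] uk unfolding un by linarith
qed

lemma diag_block_mat3:
  assumes "X \<in> carrier_mat r r" "Y \<in> carrier_mat q q" "Z \<in> carrier_mat s s"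
  shows "diag_block_mat [X, Y, Z] = four_block_mat X (0\<^sub>m r (q + s)) (0\<^sub>m (q + s) r)
    (four_block_mat Y (0\<^sub>m q s) (0\<^sub>m s q) Z)"
  by (simp only: diag_block_mat.simps(2)[of X] diag_block_mat.simps(2)[of Y] diag_block_mat_singleton Let_def)
    (simp add: carrier_matD[OF assms(1)] carrier_matD[OF assms(2)] carrier_matD[OF assms(3)])

text \<open>The two quantities of which \<open>L_ustb\<close> is composed. They are kept apart
  because \<open>root_prod\<close> bounds the autoregressive coefficients, while
  \<open>unstable_gain\<close> bounds the impulse response of the unstable block at the lags before
  the recursion sets in.\<close>

definition root_prod :: "nat \<Rightarrow> real mat \<Rightarrow> real" where
  "root_prod k A = (\<Prod>z\<in>unstable_eigs k A. (1 + cmod z) ^ alg_mult A z)"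

definition unstable_gain :: "real mat \<Rightarrow> real mat \<Rightarrow> real mat \<Rightarrow> real" where
  "unstable_gain Au Bu Cu = inf_norm Cu * inf_norm Bu * max 1 (inf_norm Au) ^ (dim_row Au - 1)"

lemma root_prod_ge_1: "1 \<le> root_prod k A"
  unfolding root_prod_def by (intro prod_ge_1 one_le_power) auto

lemma unstable_gain_nonneg: "0 \<le> unstable_gain Au Bu Cu"
  unfolding unstable_gain_def by (intro mult_nonneg_nonneg inf_norm_nonneg zero_le_power) auto

text \<open>The impulse response splits along the three blocks. The recursion \<open>c\<close> comes
  from the characteristic polynomial of \<open>Au\<close> and is chosen before the entry (i, l),
  whereas the gains and the unstable part depend on the entry. This lets one set of autoregressive
  weights serve all inputs of an output coordinate. The gains are bounded by Cauchy--Schwarz for a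
  row of one factor and a column of the other.\<close>

lemma lds_blocks_kernel:
  assumes sys: "lds_system d m p A B C k"
    and blk: "lds_blocks k A B C Au Bst Bu Bf Cst Cu Cf V W"
  obtains q r s :: nat and c lam :: "nat \<Rightarrow> real" and z :: "nat \<Rightarrow> complex" where
    "q \<le> k" "c 0 = 1" "(\<Sum>i\<le>q. \<bar>c i\<bar>) \<le> root_prod k A"
    "\<forall>a<r. complex_of_real (lam a) \<in> slow_eigs k A"
    "\<forall>a<s. cmod (z a) \<le> 1 - 1 / tau k"
    "\<forall>i<p. \<forall>l<m. \<exists>g f U. (\<Sum>a<r. \<bar>g a\<bar>) \<le> frob_norm Cst * frob_norm Bst \<and>
       (\<Sum>a<s. cmod (f a)) \<le> fast_gain Bf Cf V W \<and>
       (\<forall>j<q. \<bar>U j\<bar> \<le> unstable_gain Au Bu Cu) \<and>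
       (\<forall>j\<ge>q. (\<Sum>i\<le>q. c i * U (j - i)) = 0) \<and>
       (\<forall>j. (C * A ^\<^sub>m j * B) $$ (i, l)
          = (\<Sum>a<r. g a * lam a ^ j) + U j + Re (\<Sum>a<s. f a * z a ^ j))"
proof -
  have A: "A \<in> carrier_mat d d" and B: "B \<in> carrier_mat d m" and C: "C \<in> carrier_mat p d"
    and k: "k = instability_complexity A"
    using sys by (auto simp: lds_system_def)
  obtain \<Lambda> Af P Q D where bd: "block_diagonalization k A \<Lambda> Au Af P Q"
    and blocks: "Bst = row_block 0 (dim_row \<Lambda>) (Q * B)" "Bu = row_block (dim_row \<Lambda>) (dim_row Au) (Q * B)"
      "Bf = row_block (dim_row \<Lambda> + dim_row Au) (dim_row Af) (Q * B)"
      "Cst = col_block 0 (dim_row \<Lambda>) (C * P)" "Cu = col_block (dim_row \<Lambda>) (dim_row Au) (C * P)"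
      "Cf = col_block (dim_row \<Lambda> + dim_row Au) (dim_row Af) (C * P)"
    and simf: "similar_mat_wit (cmat Af) D V W" and D: "diagonal_mat D"
    using blk unfolding lds_blocks_def Let_def by blast
  define r q s where "r = dim_row \<Lambda>" and "q = dim_row Au" and "s = dim_row Af"
  note dims = r_def[symmetric] q_def[symmetric] s_def[symmetric]
  note blocks = blocks[unfolded dims]
  have \<Lambda>: "\<Lambda> \<in> carrier_mat r r" "diagonal_mat \<Lambda>" and Au: "Au \<in> carrier_mat q q" and Af: "Af \<in> carrier_mat s s"
    and sim: "similar_mat_wit A (diag_block_mat [\<Lambda>, Au, Af]) P Q"
    and m1: "\<And>z. alg_mult \<Lambda> z = (if z \<in> slow_eigs k A then alg_mult A z else 0)"
    and m2: "\<And>z. alg_mult Au z = (if z \<in> unstable_eigs k A then alg_mult A z else 0)"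
    and m3: "\<And>z. alg_mult Af z = (if z \<in> fast_eigs k A then alg_mult A z else 0)"
    using bd unfolding block_diagonalization_def r_def q_def s_def carrier_mat_def square_mat.simps by blast+
  have k1: "1 \<le> k" using instability_complexity_bounds[OF A k] by auto
  have un: "{z. eigenvalue (cmat Au) z} = unstable_eigs k A" and qk: "q \<le> k"
    unfolding q_def using unstable_block_bounds(4,5)[OF sys blk] by blast+
  have dm: "D \<in> carrier_mat s s" "V \<in> carrier_mat s s" "W \<in> carrier_mat s s" "W * V = 1\<^sub>m s"
    using simf Af by (auto simp: similar_mat_wit_def Let_def)
  have PQ: "P \<in> carrier_mat d d" "Q \<in> carrier_mat d d" "diag_block_mat [\<Lambda>, Au, Af] \<in> carrier_mat d d"
    using sim A by (auto simp: similar_mat_wit_def Let_def)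
  have d: "d = r + (q + s)"
    using PQ(3) \<Lambda> Au Af by (auto simp: Let_def)
  define X Y where "X = C * P" and "Y = Q * B"
  have X: "X \<in> carrier_mat p (r + (q + s))" and Y: "Y \<in> carrier_mat (r + (q + s)) m"
    using PQ B C d by (auto simp: X_def Y_def)
  have cst: "Cst \<in> carrier_mat p r" "Bst \<in> carrier_mat r m" and cu: "Cu \<in> carrier_mat p q" "Bu \<in> carrier_mat q m"
    and cf: "Cf \<in> carrier_mat p s" "Bf \<in> carrier_mat s m"
    using X Y unfolding blocks X_def[symmetric] Y_def[symmetric] by (auto simp: col_block_def row_block_def)
  define M1 M2 where "M1 = cmat Cf * V" and "M2 = W * cmat Bf"
  have M: "M1 \<in> carrier_mat p s" "M2 \<in> carrier_mat s m" using cf dm by (auto simp: M1_def M2_def)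
  have split: "(C * A ^\<^sub>m j * B) $$ (i, l) = (Cst * \<Lambda> ^\<^sub>m j * Bst) $$ (i, l)
      + (Cu * Au ^\<^sub>m j * Bu) $$ (i, l) + (Cf * Af ^\<^sub>m j * Bf) $$ (i, l)" if il: "i < p" "l < m" for i l j
  proof -
    let ?D = "diag_block_mat [\<Lambda>, Au, Af]"
    let ?F = "four_block_mat (Au ^\<^sub>m j) (0\<^sub>m q s) (0\<^sub>m s q) (Af ^\<^sub>m j)"
    have Dj: "?D ^\<^sub>m j \<in> carrier_mat d d" using PQ(3) by (rule pow_carrier_mat)
    have "C * (P * ?D ^\<^sub>m j * Q) * B = X * ?D ^\<^sub>m j * Y"
    proof -
      have "C * (P * ?D ^\<^sub>m j * Q) = (C * (P * ?D ^\<^sub>m j)) * Q"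
        using assoc_mult_mat[OF C mult_carrier_mat[OF PQ(1) Dj] PQ(2)] by simp
      also have "C * (P * ?D ^\<^sub>m j) = X * ?D ^\<^sub>m j"
        using assoc_mult_mat[OF C PQ(1) Dj] by (simp add: X_def)
      finally show ?thesis
        using assoc_mult_mat[OF mult_carrier_mat[OF X[folded d] Dj] PQ(2) B] by (simp add: Y_def)
    qed
    moreover have "?D ^\<^sub>m j = four_block_mat (\<Lambda> ^\<^sub>m j) (0\<^sub>m r (q + s)) (0\<^sub>m (q + s) r) ?F"
    proof -
      have "?D ^\<^sub>m j = diag_block_mat [\<Lambda> ^\<^sub>m j, Au ^\<^sub>m j, Af ^\<^sub>m j]"
        using \<Lambda> Au Af by (subst diag_block_pow_mat) auto
      then show ?thesis
        by (simp only: diag_block_mat3[OF pow_carrier_mat[OF \<Lambda>(1)] pow_carrier_mat[OF Au] pow_carrier_mat[OF Af]])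
    qed
    ultimately have e: "C * A ^\<^sub>m j * B = X * four_block_mat (\<Lambda> ^\<^sub>m j) (0\<^sub>m r (q + s)) (0\<^sub>m (q + s) r) ?F * Y"
      using similar_mat_wit_pow_id[OF sim, of j] by simp
    have F: "?F \<in> carrier_mat (q + s) (q + s)"
      by (rule four_block_carrier_mat[OF pow_carrier_mat[OF Au] pow_carrier_mat[OF Af]])
    have c2: "col_block r (q + s) X \<in> carrier_mat p (q + s)" "row_block r (q + s) Y \<in> carrier_mat (q + s) m"
      using X Y by (auto simp: col_block_def row_block_def)
    have b: "col_block 0 q (col_block r (q + s) X) = Cu" "col_block q s (col_block r (q + s) X) = Cf"
      "row_block 0 q (row_block r (q + s) Y) = Bu" "row_block q s (row_block r (q + s) Y) = Bf"
      unfolding blocks X_def[symmetric] Y_def[symmetric]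
      by (auto simp: col_block_def row_block_def add.assoc intro!: eq_matI)
    show ?thesis
      unfolding e index_mult_four_block[OF X pow_carrier_mat[OF \<Lambda>(1)] F Y il]
        index_mult_four_block[OF c2(1) pow_carrier_mat[OF Au] pow_carrier_mat[OF Af] c2(2) il] b
      by (simp add: blocks X_def Y_def)
  qed
  have fast: "complex_of_real ((Cf * Af ^\<^sub>m j * Bf) $$ (i, l))
      = (\<Sum>a<s. M1 $$ (i, a) * M2 $$ (a, l) * D $$ (a, a) ^ j)" if il: "i < p" "l < m" for i l j
  proof -
    have Afj: "Af ^\<^sub>m j \<in> carrier_mat s s" by (rule pow_carrier_mat[OF Af])
    have Dj: "D ^\<^sub>m j \<in> carrier_mat s s" by (rule pow_carrier_mat[OF dm(1)])
    have cCf: "cmat Cf \<in> carrier_mat p s" "cmat Bf \<in> carrier_mat s m" using cf by auto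
    have "cmat (Cf * Af ^\<^sub>m j * Bf) = cmat Cf * (cmat Af ^\<^sub>m j) * cmat Bf"
      unfolding of_real_hom.mat_hom_mult[OF mult_carrier_mat[OF cf(1) Afj] cf(2)]
        of_real_hom.mat_hom_mult[OF cf(1) Afj] of_real_hom.mat_hom_pow[OF Af] ..
    also have "cmat Af ^\<^sub>m j = V * D ^\<^sub>m j * W" by (rule similar_mat_wit_pow_id[OF simf])
    also have "cmat Cf * (V * D ^\<^sub>m j * W) * cmat Bf = M1 * D ^\<^sub>m j * M2"
    proof -
      have "cmat Cf * (V * D ^\<^sub>m j * W) = (cmat Cf * (V * D ^\<^sub>m j)) * W"
        using assoc_mult_mat[OF cCf(1) mult_carrier_mat[OF dm(2) Dj] dm(3)] by simp
      also have "cmat Cf * (V * D ^\<^sub>m j) = M1 * D ^\<^sub>m j"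
        using assoc_mult_mat[OF cCf(1) dm(2) Dj] by (simp add: M1_def)
      finally show ?thesis
        using assoc_mult_mat[OF mult_carrier_mat[OF M(1) Dj] dm(3) cCf(2)] by (simp add: M2_def)
    qed
    finally have e: "cmat (Cf * Af ^\<^sub>m j * Bf) = M1 * D ^\<^sub>m j * M2" .
    have "complex_of_real ((Cf * Af ^\<^sub>m j * Bf) $$ (i, l)) = cmat (Cf * Af ^\<^sub>m j * Bf) $$ (i, l)"
      using il cf by simp
    then show ?thesis unfolding e index_mult_diagonal[OF M(1) dm(1) D M(2) il] .
  qed
  \<comment> \<open>The coefficients in reverse order, so that \<open>c i\<close> multiplies the
    value i steps back; monicity becomes \<open>c 0 = 1\<close>.\<close>
  define c where "c i = coeff (char_poly Au) (q - i)" for i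
  show thesis
  proof (rule that[of q c r "\<lambda>a. \<Lambda> $$ (a, a)" s "\<lambda>a. D $$ (a, a)"])
    show "q \<le> k" by (rule qk)
    show "c 0 = 1" using degree_monic_char_poly[OF Au] by (simp add: c_def)
    have "(\<Sum>i\<le>q. \<bar>c i\<bar>) = (\<Sum>i\<le>q. \<bar>coeff (char_poly Au) i\<bar>)"
      unfolding c_def by (rule sum.nat_diff_reindex[of "\<lambda>i. \<bar>coeff (char_poly Au) i\<bar>" "Suc q", unfolded lessThan_Suc_atMost, simplified])
    also have "\<dots> \<le> (\<Prod>z\<in>unstable_eigs k A. (1 + cmod z) ^ alg_mult Au z)"
      using coeff_char_poly_l1[OF Au] unfolding un .
    also have "\<dots> = (\<Prod>z\<in>unstable_eigs k A. (1 + cmod z) ^ alg_mult A z)"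
      by (intro prod.cong refl) (simp add: m2)
    finally show "(\<Sum>i\<le>q. \<bar>c i\<bar>) \<le> root_prod k A" by (simp add: root_prod_def)
    show "\<forall>a<r. complex_of_real (\<Lambda> $$ (a, a)) \<in> slow_eigs k A"
    proof (intro allI impI)
      fix a assume that: "a < r"
      have "diagonal_mat (cmat \<Lambda>)" using \<Lambda> by (auto simp: diagonal_mat_def)
      then have "eigenvalue (cmat \<Lambda>) (complex_of_real (\<Lambda> $$ (a, a)))"
        using diagonal_eigenvalue[of "cmat \<Lambda>" r a] \<Lambda> that by simp
      then show "complex_of_real (\<Lambda> $$ (a, a)) \<in> slow_eigs k A"
        using alg_mult_eq_0_iff[OF \<Lambda>(1)] m1 by (metis)
    qed
    show "\<forall>a<s. cmod (D $$ (a, a)) \<le> 1 - 1 / tau k"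
    proof (intro allI impI)
      fix a assume that: "a < s"
      have "eigenvalue D (D $$ (a, a))" by (rule diagonal_eigenvalue[OF dm(1) D that])
      moreover have "char_poly D = char_poly (cmat Af)"
        using simf by (metis char_poly_similar similar_mat_def)
      ultimately have "eigenvalue (cmat Af) (D $$ (a, a))"
        using eigenvalue_root_char_poly[OF dm(1)] eigenvalue_root_char_poly[of "cmat Af" s] Af by simp
      then have "D $$ (a, a) \<in> fast_eigs k A" using alg_mult_eq_0_iff[OF Af] m3 by metis
      then have *: "eigenvalue (cmat A) (D $$ (a, a))" "D $$ (a, a) \<notin> unstable_eigs k A" "D $$ (a, a) \<notin> slow_eigs k A"
        by (auto simp: fast_eigs_def)
      show "cmod (D $$ (a, a)) \<le> 1 - 1 / tau k"
      \<comment> \<open>Above the threshold, an eigenvalue that is not unstable must be semisimple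
        and lie in the real interval (-1, 1), which makes it slow.\<close>
      proof (rule ccontr)
        assume "\<not> cmod (D $$ (a, a)) \<le> 1 - 1 / tau k"
        then have gt: "1 - 1 / tau k < cmod (D $$ (a, a))" by simp
        then obtain x where x: "D $$ (a, a) = complex_of_real x" "- 1 < x" "x < 1" "semisimple A (D $$ (a, a))"
          using *(1,2) by (auto simp: unstable_eigs_def)
        then show False using *(1,3) gt by (auto simp: slow_eigs_def abs_less_iff)
      qed
    qed
    show "\<forall>i<p. \<forall>l<m. \<exists>g f U. (\<Sum>a<r. \<bar>g a\<bar>) \<le> frob_norm Cst * frob_norm Bst \<and>
       (\<Sum>a<s. cmod (f a)) \<le> fast_gain Bf Cf V W \<and>
       (\<forall>j<q. \<bar>U j\<bar> \<le> unstable_gain Au Bu Cu) \<and>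
       (\<forall>j\<ge>q. (\<Sum>i\<le>q. c i * U (j - i)) = 0) \<and>
       (\<forall>j. (C * A ^\<^sub>m j * B) $$ (i, l)
          = (\<Sum>a<r. g a * (\<Lambda> $$ (a, a)) ^ j) + U j + Re (\<Sum>a<s. f a * (D $$ (a, a)) ^ j))"
    proof (intro allI impI)
      fix i l assume il: "i < p" "l < m"
      define g where "g a = Cst $$ (i, a) * Bst $$ (a, l)" for a
      define f where "f a = M1 $$ (i, a) * M2 $$ (a, l)" for a
      define U where "U j = (Cu * Au ^\<^sub>m j * Bu) $$ (i, l)" for j
      show "\<exists>g f U. (\<Sum>a<r. \<bar>g a\<bar>) \<le> frob_norm Cst * frob_norm Bst \<and>
         (\<Sum>a<s. cmod (f a)) \<le> fast_gain Bf Cf V W \<and>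
         (\<forall>j<q. \<bar>U j\<bar> \<le> unstable_gain Au Bu Cu) \<and>
         (\<forall>j\<ge>q. (\<Sum>i\<le>q. c i * U (j - i)) = 0) \<and>
         (\<forall>j. (C * A ^\<^sub>m j * B) $$ (i, l)
            = (\<Sum>a<r. g a * (\<Lambda> $$ (a, a)) ^ j) + U j + Re (\<Sum>a<s. f a * (D $$ (a, a)) ^ j))"
      proof (intro exI conjI allI impI)
        have "(\<Sum>a<r. \<bar>g a\<bar>) \<le> L2_set (\<lambda>a. Cst $$ (i, a)) {..<r} * L2_set (\<lambda>a. Bst $$ (a, l)) {..<r}"
          unfolding g_def by (rule sum_abs_mult_le_L2)
        also have "\<dots> \<le> frob_norm Cst * frob_norm Bst"
          using L2_row_le_frob_norm[of i Cst] L2_col_le_frob_norm[of l Bst] cst il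
          by (intro mult_mono L2_set_nonneg) (auto simp: frob_norm_def)
        finally show "(\<Sum>a<r. \<bar>g a\<bar>) \<le> frob_norm Cst * frob_norm Bst" .
        have "(\<Sum>a<s. cmod (f a)) \<le> L2_set (\<lambda>a. cmod (M1 $$ (i, a))) {..<s} * L2_set (\<lambda>a. cmod (M2 $$ (a, l))) {..<s}"
          unfolding f_def using sum_abs_mult_le_L2[of "\<lambda>a. cmod (M1 $$ (i, a))" "\<lambda>a. cmod (M2 $$ (a, l))" "{..<s}"]
          by (simp add: norm_mult)
        also have "\<dots> \<le> spectral_norm M1 * spectral_norm M2"
          using L2_row_le_spectral_norm[of i M1] L2_col_le_spectral_norm[of l M2] M il spectral_norm_nonneg
          by (intro mult_mono L2_set_nonneg) auto
        finally show "(\<Sum>a<s. cmod (f a)) \<le> fast_gain Bf Cf V W" by (simp add: fast_gain_def M1_def M2_def)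
        show "\<bar>U j\<bar> \<le> unstable_gain Au Bu Cu" if "j < q" for j
          unfolding U_def unstable_gain_def q_def[symmetric] using that by (intro abs_index_mult3_pow_le[OF cu(1) Au cu(2) il]) auto
        show "(C * A ^\<^sub>m j * B) $$ (i, l)
            = (\<Sum>a<r. g a * (\<Lambda> $$ (a, a)) ^ j) + U j + Re (\<Sum>a<s. f a * (D $$ (a, a)) ^ j)" for j
          unfolding split[OF il] g_def f_def U_def fast[OF il, symmetric]
            index_mult_diagonal[OF cst(1) \<Lambda> cst(2) il] by simp
        show "(\<Sum>i\<le>q. c i * U (j - i)) = 0" if "q \<le> j" for j
        proof -
          \<comment> \<open>Undoing the reversal turns the recursion at lag j into the
            Cayley--Hamilton identity multiplied by the power j - q of \<open>Au\<close>.\<close>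
          have "(\<Sum>i\<le>q. c i * U (j - i)) = (\<Sum>i\<le>q. coeff (char_poly Au) i * U (j - (q - i)))"
            unfolding c_def
            by (rule sum.reindex_bij_witness[of _ "\<lambda>i. q - i" "\<lambda>i. q - i"]) auto
          also have "\<dots> = (\<Sum>e\<le>q. \<Sum>a<q. \<Sum>b<q. Cu $$ (i, a) * (coeff (char_poly Au) e * (Au ^\<^sub>m (j - q + e)) $$ (a, b)) * Bu $$ (b, l))"
            unfolding U_def index_mult3[OF cu(1) pow_carrier_mat[OF Au] cu(2) il] sum_distrib_left
            using that by (intro sum.cong refl) (simp add: mult_ac)
          also have "\<dots> = (\<Sum>a<q. \<Sum>b<q. \<Sum>e\<le>q. Cu $$ (i, a) * (coeff (char_poly Au) e * (Au ^\<^sub>m (j - q + e)) $$ (a, b)) * Bu $$ (b, l))"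
            by (subst sum.swap, intro sum.cong refl sum.swap)
          also have "\<dots> = (\<Sum>a<q. \<Sum>b<q. Cu $$ (i, a) * (\<Sum>e\<le>q. coeff (char_poly Au) e * (Au ^\<^sub>m (j - q + e)) $$ (a, b)) * Bu $$ (b, l))"
            by (simp only: sum_distrib_left sum_distrib_right)
          also have "\<dots> = 0" using cayley_hamilton_shift[OF Au] by simp
          finally show ?thesis .
        qed
      qed
    qed
  qed
qed

section \<open>The comparator\<close>

lemma sum_mult_div_mod:
  "(\<Sum>g<N * m. F (g div m) (g mod m)) = (\<Sum>a<N. \<Sum>l<m. F a l)" for m :: nat
proof (induction N)
  case (Suc N)
  have "(\<Sum>g<Suc N * m. F (g div m) (g mod m)) = (\<Sum>g<N * m + m. F (g div m) (g mod m))"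
    by (simp add: add.commute)
  also have "\<dots> = (\<Sum>g<N * m. F (g div m) (g mod m)) + (\<Sum>l<m. F ((N * m + l) div m) ((N * m + l) mod m))"
    by (rule sum_lessThan_add)
  also have "(\<Sum>l<m. F ((N * m + l) div m) ((N * m + l) mod m)) = (\<Sum>l<m. F N l)"
    by (intro sum.cong refl) simp
  finally show ?case using Suc by simp
qed simp

definition conv :: "nat \<Rightarrow> (nat \<Rightarrow> real) \<Rightarrow> (nat \<Rightarrow> real) \<Rightarrow> nat \<Rightarrow> real" where
  "conv q c X j = (\<Sum>e\<le>q. if e \<le> j then c e * X (j - e) else 0)"

text \<open>Applying the autoregressive filter to the outputs amounts to convolving the impulse
  response with it. The conditions on both sides discard what would refer to times before 1.\<close>

lemma sum_shift_eq_conv: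
  "(\<Sum>e\<le>q. if e < t then c e * (\<Sum>j<t - e. X j * v (t - e - j)) else 0)
    = (\<Sum>j<t. conv q c X j * v (t - j))"
proof -
  have "(\<Sum>e\<le>q. if e < t then c e * (\<Sum>j<t - e. X j * v (t - e - j)) else 0)
      = (\<Sum>e\<le>q. \<Sum>j<t. (if e \<le> j then c e * X (j - e) else 0) * v (t - j))"
  proof (intro sum.cong refl)
    fix e assume "e \<in> {..q}"
    have "(\<Sum>j<t. (if e \<le> j then c e * X (j - e) else 0) * v (t - j))
        = (\<Sum>j\<in>{e..<t}. c e * X (j - e) * v (t - j))"
      by (rule sum.mono_neutral_cong_right) auto
    also have "\<dots> = (\<Sum>j\<in>{..<t - e}. c e * X j * v (t - e - j))"
      by (rule sum.reindex_bij_witness[of _ "\<lambda>j. j + e" "\<lambda>j. j - e"]) (auto simp: algebra_simps)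
    finally show "(if e < t then c e * (\<Sum>j<t - e. X j * v (t - e - j)) else 0)
        = (\<Sum>j<t. (if e \<le> j then c e * X (j - e) else 0) * v (t - j))"
      by (simp add: sum_distrib_left mult.assoc)
  qed
  then show ?thesis unfolding conv_def sum_distrib_right by (subst (asm) sum.swap) simp
qed

lemma conv_add: "conv q c (\<lambda>j. X j + Y j) j = conv q c X j + conv q c Y j"
  unfolding conv_def sum.distrib[symmetric] by (intro sum.cong refl) (simp add: distrib_left)

lemma abs_conv_le:
  assumes "\<And>j. \<bar>X j\<bar> \<le> b" "0 \<le> b"
  shows "\<bar>conv q c X j\<bar> \<le> (\<Sum>e\<le>q. \<bar>c e\<bar>) * b"
  unfolding conv_def sum_distrib_right
  by (rule order_trans[OF sum_abs sum_mono]) (use assms in \<open>auto simp: abs_mult intro!: mult_left_mono\<close>)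

text \<open>The scalar data of one entry of the impulse response, as provided by
  \<open>lds_blocks_kernel\<close>; \<rho> stands for \<open>1 - 1 / tau k\<close>, the rate that
  separates fast from slow modes.\<close>

locale mode_kernel =
  fixes q r s k :: nat and c lam g U :: "nat \<Rightarrow> real" and z f :: "nat \<Rightarrow> complex"
    and l1 Gs Gu Gf \<rho> :: real
  assumes qk: "q \<le> k" and c_l1: "(\<Sum>e\<le>q. \<bar>c e\<bar>) \<le> l1"
    and rho: "0 < \<rho>" "\<rho> < 1"
    and lam: "\<And>a. a < r \<Longrightarrow> \<rho> < \<bar>lam a\<bar>" "\<And>a. a < r \<Longrightarrow> \<bar>lam a\<bar> < 1"
    and z: "\<And>a. a < s \<Longrightarrow> cmod (z a) \<le> \<rho>"
    and g: "(\<Sum>a<r. \<bar>g a\<bar>) \<le> Gs" and f: "(\<Sum>a<s. cmod (f a)) \<le> Gf"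
    and U: "\<And>j. j < q \<Longrightarrow> \<bar>U j\<bar> \<le> Gu" "\<And>j. q \<le> j \<Longrightarrow> (\<Sum>e\<le>q. c e * U (j - e)) = 0"
    and Gu: "0 \<le> Gu"
begin

definition slow where "slow j = (\<Sum>a<r. g a * lam a ^ j)"
definition fast where "fast j = Re (\<Sum>a<s. f a * z a ^ j)"

text \<open>
  For lags from \<open>q\<close> on, the filtered slow kernel is \<open>\<Sum> filt a * lam a ^ j\<close>. Dividing by
  \<open>lam a ^ q\<close> extends this formula to all lags, which is what the filters see; the first \<open>q\<close>
  lags are corrected by the finite memory.
\<close>

definition filt where "filt a = g a * (\<Sum>e\<le>q. c e * lam a ^ (q - e)) / lam a ^ q"
definition ext where "ext j = (\<Sum>a<r. filt a * lam a ^ j)"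
definition mem where "mem j = conv q c (\<lambda>j. slow j + U j + fast j) j - ext j"

lemma l1_nonneg: "0 \<le> l1" by (rule order_trans[OF sum_nonneg c_l1]) simp
lemma Gs_nonneg: "0 \<le> Gs" by (rule order_trans[OF sum_nonneg g]) simp
lemma Gf_nonneg: "0 \<le> Gf" by (rule order_trans[OF sum_nonneg f]) simp

lemma abs_slow_le: "\<bar>slow j\<bar> \<le> Gs"
proof -
  have "\<bar>slow j\<bar> \<le> (\<Sum>a<r. \<bar>g a\<bar>)"
    unfolding slow_def
  proof (rule order_trans[OF sum_abs sum_mono])
    fix a assume "a \<in> {..<r}"
    then have "\<bar>lam a ^ j\<bar> \<le> 1" using lam(2)[of a] by (simp add: power_abs power_le_one)
    then show "\<bar>g a * lam a ^ j\<bar> \<le> \<bar>g a\<bar>" by (simp add: abs_mult mult_left_le)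
  qed
  then show ?thesis using g by linarith
qed

lemma abs_fast_le: "\<bar>fast j\<bar> \<le> Gf * \<rho> ^ j"
proof -
  have "\<bar>fast j\<bar> \<le> cmod (\<Sum>a<s. f a * z a ^ j)" unfolding fast_def by (rule abs_Re_le_cmod)
  also have "\<dots> \<le> (\<Sum>a<s. cmod (f a) * \<rho> ^ j)"
    by (rule order_trans[OF norm_sum sum_mono])
      (auto simp: norm_mult norm_power intro!: mult_left_mono power_mono z)
  also have "\<dots> \<le> Gf * \<rho> ^ j"
    unfolding sum_distrib_right[symmetric] using f rho by (intro mult_right_mono) auto
  finally show ?thesis .
qed

lemma abs_fast_le': "\<bar>fast j\<bar> \<le> Gf"
  using abs_fast_le[of j] mult_left_le[of "\<rho> ^ j" Gf] Gf_nonneg rho power_le_one[of \<rho> j] by simp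

lemma conv_fast_le:
  assumes "q \<le> j"
  shows "\<bar>conv q c fast j\<bar> \<le> l1 * Gf * \<rho> ^ (j - q)"
proof -
  have "\<bar>conv q c fast j\<bar> \<le> (\<Sum>e\<le>q. \<bar>c e\<bar> * (Gf * \<rho> ^ (j - q)))"
    unfolding conv_def
  proof (rule order_trans[OF sum_abs sum_mono])
    fix e assume e: "e \<in> {..q}"
    have "\<bar>fast (j - e)\<bar> \<le> Gf * \<rho> ^ (j - e)" by (rule abs_fast_le)
    also have "\<dots> \<le> Gf * \<rho> ^ (j - q)"
      using e assms rho Gf_nonneg by (intro mult_left_mono power_decreasing) auto
    finally show "\<bar>if e \<le> j then c e * fast (j - e) else 0\<bar> \<le> \<bar>c e\<bar> * (Gf * \<rho> ^ (j - q))"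
      using e assms by (auto simp: abs_mult intro!: mult_left_mono)
  qed
  also have "\<dots> \<le> l1 * (Gf * \<rho> ^ (j - q))"
    unfolding sum_distrib_right[symmetric] using c_l1 rho Gf_nonneg by (intro mult_right_mono) auto
  finally show ?thesis by (simp add: mult.assoc)
qed

lemma conv_slow_eq_ext:
  assumes "q \<le> j"
  shows "conv q c slow j = ext j"
proof -
  have "conv q c slow j = (\<Sum>e\<le>q. \<Sum>a<r. g a * (c e * lam a ^ (j - e)))"
    unfolding conv_def slow_def using assms by (intro sum.cong refl) (auto simp: sum_distrib_left mult_ac)
  also have "\<dots> = (\<Sum>a<r. g a * (\<Sum>e\<le>q. c e * lam a ^ (j - e)))"
    unfolding sum_distrib_left by (rule sum.swap)
  also have "\<dots> = ext j"
    unfolding ext_def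
  proof (intro sum.cong refl)
    fix a assume "a \<in> {..<r}"
    then have nz: "lam a \<noteq> 0" using lam(1)[of a] rho by auto
    have "(\<Sum>e\<le>q. c e * lam a ^ (j - e)) = (\<Sum>e\<le>q. c e * lam a ^ (q - e)) * lam a ^ (j - q)"
      unfolding sum_distrib_right using assms
      by (intro sum.cong refl) (simp add: mult.assoc power_add[symmetric])
    moreover have "lam a ^ j = lam a ^ q * lam a ^ (j - q)" using assms by (simp add: power_add[symmetric])
    ultimately show "g a * (\<Sum>e\<le>q. c e * lam a ^ (j - e)) = filt a * lam a ^ j"
      using nz by (simp add: filt_def)
  qed
  finally show ?thesis .
qed

lemma conv_U_zero: "q \<le> j \<Longrightarrow> conv q c U j = 0"
  using U(2)[of j] by (simp add: conv_def)

text \<open>Dividing by \<open>lam a ^ q\<close> costs at most \<rho>^-k because slow eigenvalues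
  have modulus above \<rho>. This is the origin of the power in the denominator of
  \<open>L_tilde\<close>.\<close>

lemma abs_filt_le: "a < r \<Longrightarrow> \<bar>filt a\<bar> \<le> \<bar>g a\<bar> * (l1 / \<rho> ^ k)"
proof -
  assume a: "a < r"
  have "\<bar>\<Sum>e\<le>q. c e * lam a ^ (q - e)\<bar> \<le> (\<Sum>e\<le>q. \<bar>c e\<bar>)"
  proof (rule order_trans[OF sum_abs sum_mono])
    fix e
    have "\<bar>lam a ^ (q - e)\<bar> \<le> 1" using lam(2)[OF a] by (simp add: power_abs power_le_one)
    then show "\<bar>c e * lam a ^ (q - e)\<bar> \<le> \<bar>c e\<bar>" by (simp add: abs_mult mult_left_le)
  qed
  then have 1: "\<bar>\<Sum>e\<le>q. c e * lam a ^ (q - e)\<bar> \<le> l1" using c_l1 by linarith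
  have "\<rho> ^ k \<le> \<rho> ^ q" using qk rho by (intro power_decreasing) auto
  also have "\<dots> \<le> \<bar>lam a\<bar> ^ q" using lam(1)[OF a] rho by (intro power_mono) auto
  finally have 2: "\<rho> ^ k \<le> \<bar>lam a\<bar> ^ q" .
  have "\<bar>filt a\<bar> = \<bar>g a\<bar> * (\<bar>\<Sum>e\<le>q. c e * lam a ^ (q - e)\<bar> / \<bar>lam a\<bar> ^ q)"
    by (simp add: filt_def abs_mult power_abs)
  also have "\<dots> \<le> \<bar>g a\<bar> * (l1 / \<rho> ^ k)"
    using 1 2 rho l1_nonneg by (intro mult_left_mono frac_le) auto
  finally show ?thesis .
qed

lemma sum_abs_filt_le: "(\<Sum>a<r. \<bar>filt a\<bar>) \<le> Gs * (l1 / \<rho> ^ k)"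
proof -
  have "(\<Sum>a<r. \<bar>filt a\<bar>) \<le> (\<Sum>a<r. \<bar>g a\<bar> * (l1 / \<rho> ^ k))"
    by (intro sum_mono abs_filt_le) simp
  also have "\<dots> \<le> Gs * (l1 / \<rho> ^ k)"
    unfolding sum_distrib_right[symmetric] using g l1_nonneg rho by (intro mult_right_mono) auto
  finally show ?thesis .
qed

lemma abs_ext_le: "\<bar>ext j\<bar> \<le> Gs * (l1 / \<rho> ^ k)"
proof -
  have "\<bar>ext j\<bar> \<le> (\<Sum>a<r. \<bar>filt a\<bar>)"
    unfolding ext_def
  proof (rule order_trans[OF sum_abs sum_mono])
    fix a assume "a \<in> {..<r}"
    then have "\<bar>lam a ^ j\<bar> \<le> 1" using lam(2)[of a] by (simp add: power_abs power_le_one)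
    then show "\<bar>filt a * lam a ^ j\<bar> \<le> \<bar>filt a\<bar>" by (simp add: abs_mult mult_left_le)
  qed
  then show ?thesis using sum_abs_filt_le by linarith
qed

lemma conv_U_le: "\<bar>conv q c U j\<bar> \<le> l1 * Gu"
proof (cases "q \<le> j")
  case True
  then show ?thesis using conv_U_zero l1_nonneg Gu by simp
next
  case False
  have "\<bar>conv q c U j\<bar> \<le> (\<Sum>e\<le>q. \<bar>c e\<bar> * Gu)"
    unfolding conv_def
    by (rule order_trans[OF sum_abs sum_mono]) (use False U(1) Gu in \<open>auto simp: abs_mult intro!: mult_left_mono\<close>)
  also have "\<dots> \<le> l1 * Gu"
    unfolding sum_distrib_right[symmetric] using c_l1 Gu by (intro mult_right_mono) auto
  finally show ?thesis .
qed

lemma abs_mem_le: "\<bar>mem j\<bar> \<le> l1 * (Gu + Gs + Gf) + Gs * (l1 / \<rho> ^ k)"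
proof -
  have cm: "(\<Sum>e\<le>q. \<bar>c e\<bar>) * b \<le> l1 * b" if "0 \<le> b" for b using c_l1 that by (rule mult_right_mono)
  have "\<bar>conv q c slow j\<bar> \<le> l1 * Gs"
    by (rule order_trans[OF abs_conv_le[OF abs_slow_le Gs_nonneg] cm[OF Gs_nonneg]])
  moreover have "\<bar>conv q c fast j\<bar> \<le> l1 * Gf"
    by (rule order_trans[OF abs_conv_le[OF abs_fast_le' Gf_nonneg] cm[OF Gf_nonneg]])
  ultimately show ?thesis
    using conv_U_le[of j] abs_ext_le[of j] unfolding mem_def conv_add distrib_left by linarith
qed

lemma sum_geometric_tail_le: "(\<Sum>j\<in>{N..<T}. \<rho> ^ j) \<le> \<rho> ^ N / (1 - \<rho>)"
proof (cases "N \<le> T")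
  case True
  have "(\<Sum>j\<in>{N..<T}. \<rho> ^ j) = (\<rho> ^ N - \<rho> ^ T) / (1 - \<rho>)"
    using sum_gp_multiplied[of N "T - 1" \<rho>] True rho
    by (cases "T = N") (auto simp: field_simps atLeastLessThanSuc_atLeastAtMost[symmetric])
  also have "\<dots> \<le> \<rho> ^ N / (1 - \<rho>)" using rho by (intro divide_right_mono) auto
  finally show ?thesis .
qed (use rho in simp)

text \<open>Up to lag N the memory weights are exact, being defined as the difference between the
  filtered kernel and its extension. From lag N on the unstable part is annihilated, since N is at
  least k and hence at least q, so only the fast part is lost there. By Parseval the extended slow
  part is a sum over all T filters, of which those from h on are lost; Cauchy--Schwarz pairs their
  moment coefficients with an input history of norm at most
  \<open>sqrt (real T) * K\<close>.\<close>

lemma prediction_error_le: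
  fixes v :: "nat \<Rightarrow> real"
  assumes sf: "spectral_filters T \<phi> \<sigma>" and v: "\<And>j. \<bar>v j\<bar> \<le> K"
    and tail: "\<And>\<alpha>. \<bar>\<alpha>\<bar> \<le> 1 \<Longrightarrow> (\<Sum>j\<in>{h..<T}. (\<Sum>i<T. \<phi> j $ i * \<alpha> ^ i)\<^sup>2) \<le> R\<^sup>2" and R: "0 \<le> R"
    and N: "k \<le> N"
  shows "\<bar>(\<Sum>a<N. if a < T then mem a * v a else 0)
      + (\<Sum>b<h. if b < T then (\<Sum>a<r. filt a * (\<Sum>i<T. \<phi> b $ i * lam a ^ i)) * (\<Sum>i<T. \<phi> b $ i * v i) else 0)
      - (\<Sum>j<T. conv q c (\<lambda>j. slow j + U j + fast j) j * v j)\<bar>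
    \<le> K * l1 * Gf * \<rho> ^ (N - k) / (1 - \<rho>) + Gs * (l1 / \<rho> ^ k) * (R * (sqrt (real T) * K))"
proof -
  interpret filters T \<phi> \<sigma> by unfold_locales (rule sf)
  have K: "0 \<le> K" using v[of 0] by linarith
  let ?H = "\<lambda>j. conv q c (\<lambda>j. slow j + U j + fast j) j"
  define A where "A b = (\<lambda>a. \<Sum>i<T. \<phi> b $ i * lam a ^ i)" for b
  define V where "V b = (\<Sum>i<T. \<phi> b $ i * v i)" for b
  have vsq: "(\<Sum>b<T. (V b)\<^sup>2) \<le> (sqrt (real T) * K)\<^sup>2"
  proof -
    have "(\<Sum>b<T. (V b)\<^sup>2) = (\<Sum>i<T. (v i)\<^sup>2)" unfolding V_def by (rule parseval_sq)
    also have "\<dots> \<le> (\<Sum>i<T. K\<^sup>2)"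
      by (intro sum_mono) (metis v abs_ge_zero power2_abs power_mono)
    finally show ?thesis by (simp add: power_mult_distrib)
  qed
  have e1: "(\<Sum>a<N. if a < T then mem a * v a else 0) = (\<Sum>a<T. if a < N then mem a * v a else 0)"
  proof -
    have "(\<Sum>a<N. if a < T then mem a * v a else 0) = (\<Sum>a\<in>{..<min N T}. mem a * v a)"
      by (rule sum.mono_neutral_cong_right) auto
    also have "\<dots> = (\<Sum>a<T. if a < N then mem a * v a else 0)"
      by (rule sum.mono_neutral_cong_left) auto
    finally show ?thesis .
  qed
  have e2: "(\<Sum>a<T. if a < N then mem a * v a else 0) - (\<Sum>j<T. ?H j * v j)
      = - (\<Sum>j\<in>{N..<T}. conv q c fast j * v j) - (\<Sum>j<T. ext j * v j)"
  proof -
    have "(\<Sum>a<T. if a < N then mem a * v a else 0) - (\<Sum>j<T. ?H j * v j)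
        = (\<Sum>j<T. - (if N \<le> j then conv q c fast j * v j else 0) - ext j * v j)"
      unfolding sum_subtractf[symmetric]
    proof (intro sum.cong refl)
      fix j
      show "(if j < N then mem j * v j else 0) - ?H j * v j
          = - (if N \<le> j then conv q c fast j * v j else 0) - ext j * v j"
      proof (cases "j < N")
        case False
        then have "?H j = ext j + conv q c fast j"
          using N qk conv_slow_eq_ext[of j] conv_U_zero[of j] by (simp add: conv_add)
        then show ?thesis using False by (simp add: algebra_simps)
      qed (simp add: mem_def algebra_simps)
    qed
    moreover have "(\<Sum>j<T. if N \<le> j then conv q c fast j * v j else 0) = (\<Sum>j\<in>{N..<T}. conv q c fast j * v j)"
      by (rule sum.mono_neutral_cong_right) auto
    ultimately show ?thesis by (simp add: sum_subtractf sum_negf)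
  qed
  have e3: "(\<Sum>j<T. ext j * v j) = (\<Sum>a<r. filt a * (\<Sum>b<T. A b a * V b))"
  proof -
    have "(\<Sum>j<T. ext j * v j) = (\<Sum>a<r. filt a * (\<Sum>j<T. lam a ^ j * v j))"
      unfolding ext_def sum_distrib_right sum_distrib_left by (subst sum.swap) (simp add: mult.assoc)
    then show ?thesis unfolding A_def V_def by (simp add: parseval)
  qed
  \<comment> \<open>The count h may exceed T, in which case the components from T on are 0; the
    minimum covers both cases.\<close>
  have e4: "(\<Sum>b<h. if b < T then (\<Sum>a<r. filt a * A b a) * V b else 0)
      = (\<Sum>a<r. filt a * (\<Sum>b\<in>{..<min h T}. A b a * V b))"
  proof -
    have "(\<Sum>b<h. if b < T then (\<Sum>a<r. filt a * A b a) * V b else 0)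
        = (\<Sum>b\<in>{..<min h T}. (\<Sum>a<r. filt a * A b a) * V b)"
      by (rule sum.mono_neutral_cong_right) auto
    then show ?thesis unfolding sum_distrib_right sum_distrib_left by (subst (asm) sum.swap) (simp add: mult.assoc)
  qed
  have e5: "(\<Sum>b\<in>{..<min h T}. A b a * V b) - (\<Sum>b<T. A b a * V b) = - (\<Sum>b\<in>{h..<T}. A b a * V b)" for a
  proof -
    have "{..<T} = {..<min h T} \<union> {h..<T}" by auto
    then have "(\<Sum>b<T. A b a * V b) = (\<Sum>b\<in>{..<min h T} \<union> {h..<T}. A b a * V b)" by simp
    also have "\<dots> = (\<Sum>b\<in>{..<min h T}. A b a * V b) + (\<Sum>b\<in>{h..<T}. A b a * V b)"
      by (rule sum.union_disjoint) auto
    finally have "(\<Sum>b<T. A b a * V b) = (\<Sum>b\<in>{..<min h T}. A b a * V b) + (\<Sum>b\<in>{h..<T}. A b a * V b)" .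
    then show ?thesis by simp
  qed
  have b1: "\<bar>\<Sum>j\<in>{N..<T}. conv q c fast j * v j\<bar> \<le> K * l1 * Gf * \<rho> ^ (N - k) / (1 - \<rho>)"
  proof -
    have "\<bar>\<Sum>j\<in>{N..<T}. conv q c fast j * v j\<bar> \<le> (\<Sum>j\<in>{N..<T}. l1 * Gf * K / \<rho> ^ q * \<rho> ^ j)"
    proof (rule order_trans[OF sum_abs sum_mono])
      fix j assume j: "j \<in> {N..<T}"
      have "\<bar>conv q c fast j\<bar> * \<bar>v j\<bar> \<le> (l1 * Gf * \<rho> ^ (j - q)) * K"
        using j N qk v K l1_nonneg Gf_nonneg rho by (intro mult_mono conv_fast_le) auto
      moreover have "\<rho> ^ (j - q) = \<rho> ^ j / \<rho> ^ q" using j N qk rho by (simp add: power_diff)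
      ultimately show "\<bar>conv q c fast j * v j\<bar> \<le> l1 * Gf * K / \<rho> ^ q * \<rho> ^ j"
        by (simp add: abs_mult mult_ac)
    qed
    also have "\<dots> \<le> l1 * Gf * K / \<rho> ^ q * (\<rho> ^ N / (1 - \<rho>))"
      unfolding sum_distrib_left[symmetric] using l1_nonneg Gf_nonneg rho K
      by (intro mult_left_mono sum_geometric_tail_le) auto
    also have "\<dots> = l1 * Gf * K * (\<rho> ^ (N - q) / (1 - \<rho>))"
      using N qk rho by (simp add: power_diff)
    also have "\<dots> \<le> l1 * Gf * K * (\<rho> ^ (N - k) / (1 - \<rho>))"
      using l1_nonneg Gf_nonneg rho K qk
      by (intro mult_left_mono divide_right_mono power_decreasing) auto
    finally show ?thesis by (simp add: mult_ac)
  qed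
  have b2: "\<bar>\<Sum>a<r. filt a * (\<Sum>b\<in>{h..<T}. A b a * V b)\<bar> \<le> Gs * (l1 / \<rho> ^ k) * (R * (sqrt (real T) * K))"
  proof -
    have "\<bar>\<Sum>b\<in>{h..<T}. A b a * V b\<bar> \<le> R * (sqrt (real T) * K)" if "a < r" for a
    proof -
      have "(\<Sum>b\<in>{h..<T}. A b a * V b)\<^sup>2 \<le> (\<Sum>b\<in>{h..<T}. (A b a)\<^sup>2) * (\<Sum>b\<in>{h..<T}. (V b)\<^sup>2)"
        by (rule Cauchy_Schwarz_ineq_sum)
      also have "\<dots> \<le> R\<^sup>2 * (sqrt (real T) * K)\<^sup>2"
      proof (rule mult_mono)
        show "(\<Sum>b\<in>{h..<T}. (A b a)\<^sup>2) \<le> R\<^sup>2" unfolding A_def using lam(2)[OF that] by (intro tail) simp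
        have "(\<Sum>b\<in>{h..<T}. (V b)\<^sup>2) \<le> (\<Sum>b<T. (V b)\<^sup>2)" by (intro sum_mono2) auto
        then show "(\<Sum>b\<in>{h..<T}. (V b)\<^sup>2) \<le> (sqrt (real T) * K)\<^sup>2" using vsq by linarith
      qed (auto intro!: sum_nonneg)
      finally have "\<bar>\<Sum>b\<in>{h..<T}. A b a * V b\<bar>\<^sup>2 \<le> (R * (sqrt (real T) * K))\<^sup>2"
        by (simp add: power_mult_distrib)
      then show ?thesis by (rule power2_le_imp_le) (use R K in simp)
    qed
    then have "\<bar>\<Sum>a<r. filt a * (\<Sum>b\<in>{h..<T}. A b a * V b)\<bar> \<le> (\<Sum>a<r. \<bar>filt a\<bar> * (R * (sqrt (real T) * K)))"
      by (intro order_trans[OF sum_abs sum_mono]) (auto simp: abs_mult intro!: mult_left_mono)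
    also have "\<dots> \<le> Gs * (l1 / \<rho> ^ k) * (R * (sqrt (real T) * K))"
      unfolding sum_distrib_right[symmetric] using R K by (intro mult_right_mono sum_abs_filt_le) auto
    finally show ?thesis .
  qed
  have "(\<Sum>a<N. if a < T then mem a * v a else 0)
      + (\<Sum>b<h. if b < T then (\<Sum>a<r. filt a * A b a) * V b else 0) - (\<Sum>j<T. ?H j * v j)
    = - (\<Sum>j\<in>{N..<T}. conv q c fast j * v j) - (\<Sum>a<r. filt a * (\<Sum>b\<in>{h..<T}. A b a * V b))"
  proof -
    have "(\<Sum>a<r. filt a * (\<Sum>b\<in>{..<min h T}. A b a * V b)) - (\<Sum>a<r. filt a * (\<Sum>b<T. A b a * V b))
        = - (\<Sum>a<r. filt a * (\<Sum>b\<in>{h..<T}. A b a * V b))"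
      unfolding sum_subtractf[symmetric] right_diff_distrib[symmetric] e5 by (simp add: sum_negf)
    then show ?thesis using e2 unfolding e1 e4 e3 by linarith
  qed
  then show ?thesis using b1 b2 unfolding A_def V_def by linarith
qed

end

text \<open>The existential hides the kernels, so that the weights of the various input coordinates
  can be combined outside the locale. \<Theta> bounds the norm of the slow moment vectors: the
  square root of T always does, and for one system a constant does.\<close>

lemma (in mode_kernel) comparator_components:
  assumes sf: "spectral_filters T \<phi> \<sigma>"
    and tail: "\<And>\<alpha>. \<bar>\<alpha>\<bar> \<le> 1 \<Longrightarrow> (\<Sum>j\<in>{h..<T}. (\<Sum>i<T. \<phi> j $ i * \<alpha> ^ i)\<^sup>2) \<le> R\<^sup>2" and R: "0 \<le> R"
    and N: "k \<le> N"
    and \<Theta>: "\<And>a. a < r \<Longrightarrow> (\<Sum>i<T. (lam a ^ i)\<^sup>2) \<le> \<Theta>\<^sup>2" "0 \<le> \<Theta>"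
  shows "\<exists>me th. (\<forall>j. \<bar>me j\<bar> \<le> l1 * (Gu + Gs + Gf) + Gs * (l1 / \<rho> ^ k)) \<and>
    (\<forall>b<T. \<bar>th b\<bar> \<le> Gs * (l1 / \<rho> ^ k) * \<Theta>) \<and>
    (\<forall>v. (\<forall>j. \<bar>v j\<bar> \<le> K) \<longrightarrow>
      \<bar>(\<Sum>a<N. if a < T then me a * v a else 0)
      + (\<Sum>b<h. if b < T then th b * (\<Sum>i<T. \<phi> b $ i * v i) else 0)
      - (\<Sum>j<T. conv q c (\<lambda>j. slow j + U j + fast j) j * v j)\<bar>
      \<le> K * l1 * Gf * \<rho> ^ (N - k) / (1 - \<rho>) + Gs * (l1 / \<rho> ^ k) * (R * (sqrt (real T) * K)))"
proof (intro exI conjI allI impI)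
  interpret filters T \<phi> \<sigma> by unfold_locales (rule sf)
  show "\<bar>mem j\<bar> \<le> l1 * (Gu + Gs + Gf) + Gs * (l1 / \<rho> ^ k)" for j by (rule abs_mem_le)
  show "\<bar>\<Sum>a<r. filt a * (\<Sum>i<T. \<phi> b $ i * lam a ^ i)\<bar> \<le> Gs * (l1 / \<rho> ^ k) * \<Theta>" if "b < T" for b
  proof -
    have "\<bar>\<Sum>i<T. \<phi> b $ i * lam a ^ i\<bar> \<le> \<Theta>" if "a < r" for a
    proof -
      have "(\<Sum>i<T. \<phi> b $ i * lam a ^ i)\<^sup>2 \<le> (\<Sum>i<T. (\<phi> b $ i)\<^sup>2) * (\<Sum>i<T. (lam a ^ i)\<^sup>2)"
        by (rule Cauchy_Schwarz_ineq_sum)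
      also have "(\<Sum>i<T. (\<phi> b $ i)\<^sup>2) = 1"
        using phi_orthonormal[OF \<open>b < T\<close> \<open>b < T\<close>] by (simp add: power2_eq_square)
      finally have "\<bar>\<Sum>i<T. \<phi> b $ i * lam a ^ i\<bar>\<^sup>2 \<le> \<Theta>\<^sup>2" using \<Theta>(1)[OF that] by simp
      then show ?thesis by (rule power2_le_imp_le) (rule \<Theta>(2))
    qed
    then have "\<bar>\<Sum>a<r. filt a * (\<Sum>i<T. \<phi> b $ i * lam a ^ i)\<bar> \<le> (\<Sum>a<r. \<bar>filt a\<bar> * \<Theta>)"
      by (intro order_trans[OF sum_abs sum_mono]) (auto simp: abs_mult intro!: mult_left_mono)
    also have "\<dots> \<le> Gs * (l1 / \<rho> ^ k) * \<Theta>"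
      unfolding sum_distrib_right[symmetric] by (intro mult_right_mono sum_abs_filt_le \<Theta>(2))
    finally show ?thesis .
  qed
  fix v :: "nat \<Rightarrow> real" assume v: "\<forall>j. \<bar>v j\<bar> \<le> K"
  show "\<bar>(\<Sum>a<N. if a < T then mem a * v a else 0)
      + (\<Sum>b<h. if b < T then (\<Sum>a<r. filt a * (\<Sum>i<T. \<phi> b $ i * lam a ^ i)) * (\<Sum>i<T. \<phi> b $ i * v i) else 0)
      - (\<Sum>j<T. conv q c (\<lambda>j. slow j + U j + fast j) j * v j)\<bar>
      \<le> K * l1 * Gf * \<rho> ^ (N - k) / (1 - \<rho>) + Gs * (l1 / \<rho> ^ k) * (R * (sqrt (real T) * K))"
    using v by (intro prediction_error_le[OF sf _ tail R N]) auto
qed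

text \<open>Bounds on the coordinates accompany the error bound because the regret is charged with
  \<open>lam\<close> times the squared norm of the comparator. The factor m in the error counts the
  input coordinates, whose kernels are approximated separately.\<close>

lemma comparator_exists:
  assumes sys: "lds_system d m p A B C k"
    and blk: "lds_blocks k A B C Au Bst Bu Bf Cst Cu Cf V W"
    and sf: "spectral_filters T \<phi> \<sigma>" and u: "controlled_run d m A B C K By u" and K: "0 \<le> K"
    and tail: "\<And>\<alpha>. \<bar>\<alpha>\<bar> \<le> 1 \<Longrightarrow> (\<Sum>j\<in>{h..<T}. (\<Sum>i<T. \<phi> j $ i * \<alpha> ^ i)\<^sup>2) \<le> R\<^sup>2" and R: "0 \<le> R"
    and \<Theta>: "\<And>x. complex_of_real x \<in> slow_eigs k A \<Longrightarrow> (\<Sum>i<T. (x ^ i)\<^sup>2) \<le> \<Theta>\<^sup>2" "0 \<le> \<Theta>"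
    and i: "i < p"
  defines "\<rho> \<equiv> 1 - 1 / tau k" and "l1 \<equiv> root_prod k A" and "Gs \<equiv> frob_norm Cst * frob_norm Bst"
    and "Gu \<equiv> unstable_gain Au Bu Cu" and "Gf \<equiv> fast_gain Bf Cf V W"
    and "y \<equiv> lds_output d A B C u"
  shows "\<exists>w \<in> carrier_vec (feat_dim m k L h).
    (\<forall>j<feat_dim m k L h. \<bar>w $ j\<bar> \<le> l1 * (1 + Gu + Gs + Gf) + Gs * (l1 / \<rho> ^ k) * (1 + \<Theta>)) \<and>
    (\<forall>t\<in>{1..T}. \<bar>unified_feature m p k L h T \<phi> u y i t \<bullet> w - y t $ i\<bar>
      \<le> real m * (K * l1 * Gf * \<rho> ^ Suc L * tau k + Gs * (l1 / \<rho> ^ k) * (R * (sqrt (real T) * K))))"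
proof -
  have A: "A \<in> carrier_mat d d" and B: "B \<in> carrier_mat d m" and C: "C \<in> carrier_mat p d"
    and k: "k = instability_complexity A"
    using sys by (auto simp: lds_system_def)
  have k1: "1 \<le> k" using instability_complexity_bounds[OF A k] by auto
  have rho: "0 < \<rho>" "\<rho> < 1" using rate_bounds[OF k1] min_rate unfolding \<rho>_def by linarith+
  have uc: "\<And>t. 1 \<le> t \<Longrightarrow> u t \<in> carrier_vec m" and uK: "\<And>t. 1 \<le> t \<Longrightarrow> l2norm (u t) \<le> K"
    using u by (auto simp: controlled_run_def)
  obtain q r s :: nat and c lam :: "nat \<Rightarrow> real" and z :: "nat \<Rightarrow> complex" where q: "q \<le> k" and c0: "c 0 = 1"
    and cl: "(\<Sum>i\<le>q. \<bar>c i\<bar>) \<le> l1"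
    and ev: "\<forall>a<r. complex_of_real (lam a) \<in> slow_eigs k A"
    and z: "\<forall>a<s. cmod (z a) \<le> \<rho>"
    and ker: "\<forall>i<p. \<forall>l<m. \<exists>g f U. (\<Sum>a<r. \<bar>g a\<bar>) \<le> Gs \<and> (\<Sum>a<s. cmod (f a)) \<le> Gf \<and>
       (\<forall>j<q. \<bar>U j\<bar> \<le> Gu) \<and> (\<forall>j\<ge>q. (\<Sum>i\<le>q. c i * U (j - i)) = 0) \<and>
       (\<forall>j. (C * A ^\<^sub>m j * B) $$ (i, l)
          = (\<Sum>a<r. g a * lam a ^ j) + U j + Re (\<Sum>a<s. f a * z a ^ j))"
    unfolding l1_def Gs_def Gf_def Gu_def \<rho>_def
  proof (rule lds_blocks_kernel[OF sys blk], goal_cases)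
    case (1 q r s c lam z)
    show ?case by (rule 1(1)[of q c r lam s z, OF 1(2-7)])
  qed
  have lam': "\<rho> < \<bar>lam a\<bar>" "\<bar>lam a\<bar> < 1" if "a < r" for a
    using ev that by (auto simp: slow_eigs_def \<rho>_def)
  define H where "H l j = (C * A ^\<^sub>m j * B) $$ (i, l)" for l j
  \<comment> \<open>The number of input lags in the feature. The k extra lags pay for the look-back
    of the autoregressive filter, so what is lost of the fast modes still carries the factor \<rho>
    to the power \<open>Suc L\<close>.\<close>
  define N where "N = L + k + 1"
  define Wm where "Wm = l1 * (Gu + Gs + Gf) + Gs * (l1 / \<rho> ^ k)"
  define Wt where "Wt = Gs * (l1 / \<rho> ^ k) * \<Theta>"
  define E where "E = K * l1 * Gf * \<rho> ^ Suc L * tau k + Gs * (l1 / \<rho> ^ k) * (R * (sqrt (real T) * K))"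
  have l1: "1 \<le> l1" and Gu: "0 \<le> Gu" by (simp_all add: l1_def Gu_def root_prod_ge_1 unstable_gain_nonneg)
  have Gs: "0 \<le> Gs" by (simp add: Gs_def frob_norm_def)
  have Gf: "0 \<le> Gf" by (simp add: Gf_def fast_gain_def spectral_norm_nonneg)
  define good where "good l me th \<longleftrightarrow> (\<forall>j. \<bar>me j\<bar> \<le> Wm) \<and> (\<forall>b<T. \<bar>th b\<bar> \<le> Wt) \<and>
    (\<forall>v. (\<forall>j. \<bar>v j\<bar> \<le> K) \<longrightarrow>
      \<bar>(\<Sum>a<N. if a < T then me a * v a else 0)
      + (\<Sum>b<h. if b < T then th b * (\<Sum>i<T. \<phi> b $ i * v i) else 0)
      - (\<Sum>j<T. conv q c (H l) j * v j)\<bar> \<le> E)" for l and me th :: "nat \<Rightarrow> real"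
  have ex: "\<exists>me th. good l me th" if l: "l < m" for l
  proof -
    obtain g f U where gfU: "(\<Sum>a<r. \<bar>g a\<bar>) \<le> Gs" "(\<Sum>a<s. cmod (f a)) \<le> Gf"
      "\<forall>j<q. \<bar>U j\<bar> \<le> Gu" "\<forall>j\<ge>q. (\<Sum>i\<le>q. c i * U (j - i)) = 0"
      and H: "\<forall>j. H l j = (\<Sum>a<r. g a * lam a ^ j) + U j + Re (\<Sum>a<s. f a * z a ^ j)"
      using ker[rule_format, OF i l] unfolding H_def by blast
    interpret mode_kernel q r s k c lam g U z f l1 Gs Gu Gf \<rho>
      by unfold_locales (use q cl rho lam' z gfU Gu in \<open>auto\<close>)
    have Heq: "H l = (\<lambda>j. slow j + U j + fast j)" using H by (simp add: fun_eq_iff slow_def fast_def)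
    have Ns: "N - k = Suc L" "k \<le> N" by (simp_all add: N_def)
    have rt: "x / (1 - \<rho>) = x * tau k" for x by (simp add: \<rho>_def)
    show ?thesis
      using comparator_components[OF sf tail R Ns(2) \<Theta>(1)[OF ev[rule_format]] \<Theta>(2), of K]
      unfolding good_def Heq Wm_def Wt_def E_def Ns(1) rt .
  qed
  define me where "me l = (SOME me. \<exists>th. good l me th)" for l
  define th where "th l = (SOME th. good l (me l) th)" for l
  have gd: "good l (me l) (th l)" if "l < m" for l
  proof -
    have "\<exists>th. good l (me l) th" unfolding me_def using someI_ex[OF ex[OF that]] .
    then show ?thesis unfolding th_def by (rule someI_ex)
  qed
  have me: "\<bar>me l j\<bar> \<le> Wm" if "l < m" for l j
    using gd[OF that] by (simp only: good_def)
  have th: "\<bar>th l b\<bar> \<le> Wt" if "l < m" "b < T" for l b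
    using gd[OF that(1)] that(2) by (simp only: good_def)
  have err: "\<bar>(\<Sum>a<N. if a < T then me l a * v a else 0)
      + (\<Sum>b<h. if b < T then th l b * (\<Sum>i<T. \<phi> b $ i * v i) else 0)
      - (\<Sum>j<T. conv q c (H l) j * v j)\<bar> \<le> E" if "l < m" "\<And>j. \<bar>v j\<bar> \<le> K" for l v
    using gd[OF that(1)] that(2) unfolding good_def by blast
  \<comment> \<open>Coordinate j multiplies the output at time t - 1 - j, hence the shift by one;
    the sign comes from solving the filtered equation for the current output, whose coefficient is
    \<open>c 0 = 1\<close>.\<close>
  define w1 where "w1 = vec k (\<lambda>j. if j < q then - c (Suc j) else 0)"
  define w2 where "w2 = vec (m * N) (\<lambda>j. if j div m < T then me (j mod m) (j div m) else 0)"
  define w3 where "w3 = vec (h * m) (\<lambda>j. if j div m < T then th (j mod m) (j div m) else 0)"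
  define w where "w = w1 @\<^sub>v w2 @\<^sub>v w3"
  have wc: "w \<in> carrier_vec (feat_dim m k L h)"
    by (rule carrier_vecI) (simp add: w_def w1_def w2_def w3_def feat_dim_def N_def)
  define WW where "WW = l1 * (1 + Gu + Gs + Gf) + Gs * (l1 / \<rho> ^ k) * (1 + \<Theta>)"
  have P: "0 \<le> Gs * (l1 / \<rho> ^ k)" using Gs l1 rho(1) by (intro mult_nonneg_nonneg divide_nonneg_nonneg zero_le_power) linarith+
  have WWge: "l1 \<le> WW" "Wm \<le> WW" "Wt \<le> WW" "0 \<le> WW"
  proof -
    have "WW = l1 + l1 * (Gu + Gs + Gf) + Gs * (l1 / \<rho> ^ k) + Wt"
      unfolding WW_def Wt_def by (simp only: distrib_left mult_1_right add.assoc)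
    moreover have "0 \<le> l1 * (Gu + Gs + Gf)" using l1 Gu Gs Gf by (intro mult_nonneg_nonneg) linarith+
    moreover have "0 \<le> Wt" unfolding Wt_def by (rule mult_nonneg_nonneg[OF P \<Theta>(2)])
    ultimately show "l1 \<le> WW" "Wm \<le> WW" "Wt \<le> WW" "0 \<le> WW" using P l1 unfolding Wm_def by linarith+
  qed
  have w1b: "\<bar>w1 $ j\<bar> \<le> WW" if "j < k" for j
  proof (cases "j < q")
    case True
    then have "\<bar>c (Suc j)\<bar> \<le> (\<Sum>i\<le>q. \<bar>c i\<bar>)" by (intro member_le_sum) auto
    then have "\<bar>c (Suc j)\<bar> \<le> WW" using cl WWge(1) by linarith
    then show ?thesis using True that by (simp add: w1_def)
  qed (use that WWge(4) in \<open>simp add: w1_def\<close>)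
  have w2b: "\<bar>w2 $ j\<bar> \<le> WW" if "j < m * N" for j
  proof -
    have "0 < m" using that by (cases m) auto
    then have "\<bar>me (j mod m) (j div m)\<bar> \<le> WW" by (intro order_trans[OF me WWge(2)]) simp
    then show ?thesis using that WWge(4) by (simp add: w2_def)
  qed
  have w3b: "\<bar>w3 $ j\<bar> \<le> WW" if "j < h * m" for j
  proof -
    have "0 < m" using that by (cases m) auto
    then have "\<bar>th (j mod m) (j div m)\<bar> \<le> WW" if "j div m < T"
      using that by (intro order_trans[OF th WWge(3)]) simp_all
    then show ?thesis using that WWge(4) by (simp add: w3_def)
  qed
  have wb: "\<bar>w $ j\<bar> \<le> WW" if "j < feat_dim m k L h" for j
  proof -
    have d: "dim_vec w1 = k" "dim_vec w2 = m * N" "dim_vec w3 = h * m"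
      by (simp_all add: w1_def w2_def w3_def)
    have j: "j < k + (m * N + h * m)" using that by (simp add: feat_dim_def N_def)
    consider "j < k" | "k \<le> j" "j - k < m * N" | "k \<le> j" "m * N \<le> j - k" "j - k - m * N < h * m"
      using j by linarith
    then show ?thesis
    proof cases
      case 1
      then show ?thesis using w1b[of j] d j by (simp add: w_def)
    next
      case 2
      then show ?thesis using w2b[of "j - k"] d j by (simp add: w_def)
    next
      case 3
      then show ?thesis using w3b[of "j - k - m * N"] d j by (simp add: w_def)
    qed
  qed
  have errw: "\<bar>unified_feature m p k L h T \<phi> u y i t \<bullet> w - y t $ i\<bar> \<le> real m * E" if t: "t \<in> {1..T}" for t
  proof -
    have t1: "1 \<le> t" "t \<le> T" using t by auto
    define v where "v l j = lagged u m t j $ l" for l j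
    have vK: "\<bar>v l j\<bar> \<le> K" if "l < m" for l j
    proof (cases "j < t")
      case True
      then have "norm (u (t - j) $ l) \<le> l2norm (u (t - j))"
        using carrier_vecD[OF uc[of "t - j"]] that by (intro index_le_l2norm) auto
      also have "\<dots> \<le> K" using True by (intro uK) simp
      finally show ?thesis using True by (simp add: v_def lagged_def)
    qed (use K that in \<open>simp add: v_def lagged_def\<close>)
    have v0: "v l j = 0" if "l < m" "t \<le> j" for l j using that by (simp add: v_def lagged_def)
    have yi: "y x $ i = (\<Sum>l<m. \<Sum>j<x. H l j * (u (x - j) $ l))" for x
    proof -
      have "y x $ i = (\<Sum>j<x. \<Sum>l<m. H l j * (u (x - j) $ l))"
        unfolding y_def H_def by (rule lds_output_index[OF A B uc C i])
      then show ?thesis by (subst sum.swap)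
    qed
    have ar: "(\<Sum>e\<le>q. if e < t then c e * y (t - e) $ i else 0) = (\<Sum>l<m. \<Sum>j<T. conv q c (H l) j * v l j)"
    proof -
      have "(\<Sum>e\<le>q. if e < t then c e * y (t - e) $ i else 0)
          = (\<Sum>e\<le>q. \<Sum>l<m. if e < t then c e * (\<Sum>j<t - e. H l j * (u (t - e - j) $ l)) else 0)"
        unfolding yi by (intro sum.cong refl) (simp add: sum_distrib_left)
      also have "\<dots> = (\<Sum>l<m. \<Sum>e\<le>q. if e < t then c e * (\<Sum>j<t - e. H l j * (u (t - e - j) $ l)) else 0)"
        by (rule sum.swap)
      also have "\<dots> = (\<Sum>l<m. \<Sum>j<t. conv q c (H l) j * (u (t - j) $ l))"
        by (intro sum.cong refl sum_shift_eq_conv)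
      also have "\<dots> = (\<Sum>l<m. \<Sum>j<T. conv q c (H l) j * v l j)"
      proof (rule sum.cong[OF refl])
        fix l assume "l \<in> {..<m}"
        then show "(\<Sum>j<t. conv q c (H l) j * (u (t - j) $ l)) = (\<Sum>j<T. conv q c (H l) j * v l j)"
          using t1 v0[of l] by (intro sum.mono_neutral_cong_left) (auto simp: v_def lagged_def)
      qed
      finally show ?thesis .
    qed
    have f1: "output_feature p k y t i \<bullet> w1 = y t $ i - (\<Sum>l<m. \<Sum>j<T. conv q c (H l) j * v l j)"
    proof -
      have "output_feature p k y t i \<bullet> w1 = (\<Sum>j<k. lagged y p t (Suc j) $ i * (if j < q then - c (Suc j) else 0))"
        by (simp add: output_feature_def w1_def scalar_prod_def atLeast0LessThan)
      also have "\<dots> = (\<Sum>j<q. - (if Suc j < t then c (Suc j) * y (t - Suc j) $ i else 0))"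
        by (rule sum.mono_neutral_cong_right) (use q i in \<open>auto simp: lagged_def\<close>)
      also have "\<dots> = y t $ i - (\<Sum>e\<le>q. if e < t then c e * y (t - e) $ i else 0)"
        unfolding sum_negf sum.atMost_shift using t1 c0 by simp
      finally show ?thesis unfolding ar .
    qed
    have f2: "input_feature m k L u t \<bullet> w2 = (\<Sum>l<m. \<Sum>a<N. if a < T then me l a * v l a else 0)"
    proof -
      have "input_feature m k L u t \<bullet> w2
          = (\<Sum>g<N * m. (\<lambda>a l. if a < T then me l a * v l a else 0) (g div m) (g mod m))"
        unfolding input_feature_def w2_def scalar_prod_def v_def atLeast0LessThan
        by (rule sum.cong) (auto simp: N_def mult.commute)
      also have "\<dots> = (\<Sum>a<N. \<Sum>l<m. if a < T then me l a * v l a else 0)" by (rule sum_mult_div_mod)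
      also have "\<dots> = (\<Sum>l<m. \<Sum>a<N. if a < T then me l a * v l a else 0)" by (rule sum.swap)
      finally show ?thesis .
    qed
    have f3: "filter_feature m h T \<phi> u t \<bullet> w3
        = (\<Sum>l<m. \<Sum>b<h. if b < T then th l b * (\<Sum>i<T. \<phi> b $ i * v l i) else 0)"
    proof -
      have ih: "(input_history m T u t *\<^sub>v \<phi> b) $ l = (\<Sum>i<T. \<phi> b $ i * v l i)" if "b < T" "l < m" for b l
      proof -
        have "\<phi> b \<in> carrier_vec T" using sf that by (simp add: spectral_filters_def)
        then show ?thesis using that
          by (simp add: input_history_def scalar_prod_def v_def atLeast0LessThan mult.commute)
      qed
      have "filter_feature m h T \<phi> u t \<bullet> w3
          = (\<Sum>g<h * m. (\<lambda>b l. if b < T then th l b * (\<Sum>i<T. \<phi> b $ i * v l i) else 0) (g div m) (g mod m))"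
        unfolding filter_feature_def w3_def scalar_prod_def atLeast0LessThan
      proof (rule sum.cong)
        fix g assume "g \<in> {..<h * m}"
        then have "0 < m" "g < h * m" by (cases m; auto)+
        then show "vec (h * m) (\<lambda>j. if j div m < T then (input_history m T u t *\<^sub>v \<phi> (j div m)) $ (j mod m) else 0) $ g *
            vec (h * m) (\<lambda>j. if j div m < T then th (j mod m) (j div m) else 0) $ g
          = (\<lambda>b l. if b < T then th l b * (\<Sum>i<T. \<phi> b $ i * v l i) else 0) (g div m) (g mod m)"
          using ih[of "g div m" "g mod m"] by simp
      qed simp
      also have "\<dots> = (\<Sum>b<h. \<Sum>l<m. if b < T then th l b * (\<Sum>i<T. \<phi> b $ i * v l i) else 0)"
        by (rule sum_mult_div_mod)
      also have "\<dots> = (\<Sum>l<m. \<Sum>b<h. if b < T then th l b * (\<Sum>i<T. \<phi> b $ i * v l i) else 0)"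
        by (rule sum.swap)
      finally show ?thesis .
    qed
    have "unified_feature m p k L h T \<phi> u y i t \<bullet> w
        = output_feature p k y t i \<bullet> w1 + (input_feature m k L u t \<bullet> w2 + filter_feature m h T \<phi> u t \<bullet> w3)"
    proof -
      have c: "output_feature p k y t i \<in> carrier_vec k" "w1 \<in> carrier_vec k"
        "input_feature m k L u t \<in> carrier_vec (m * N)" "w2 \<in> carrier_vec (m * N)"
        "filter_feature m h T \<phi> u t \<in> carrier_vec (h * m)" "w3 \<in> carrier_vec (h * m)"
        by (simp_all add: output_feature_def input_feature_def filter_feature_def w1_def w2_def w3_def N_def)
      show ?thesis unfolding unified_feature_def w_def
        using c by (simp add: scalar_prod_append[of _ k _ "m * N + h * m"] scalar_prod_append[of _ "m * N" _ "h * m"])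
    qed
    then have "unified_feature m p k L h T \<phi> u y i t \<bullet> w - y t $ i
      = (\<Sum>l<m. (\<Sum>a<N. if a < T then me l a * v l a else 0)
          + (\<Sum>b<h. if b < T then th l b * (\<Sum>i<T. \<phi> b $ i * v l i) else 0)
          - (\<Sum>j<T. conv q c (H l) j * v l j))"
      unfolding f1 f2 f3 by (simp add: sum.distrib sum_subtractf)
    also have "\<bar>\<dots>\<bar> \<le> (\<Sum>l<m. E)"
      by (rule order_trans[OF sum_abs sum_mono]) (auto intro!: err vK)
    finally show ?thesis by simp
  qed
  show ?thesis using wc wb errw unfolding WW_def E_def by blast
qed

section \<open>Filter count and memory length\<close>

text \<open>Since ln T \<ge> 2/3 and \<open>tau k\<close> exceeds 1, sums of these logarithms are
  dominated by constant multiples of their products. The last two bounds convert the sharper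
  estimates in \<open>logA\<close> and \<open>logB\<close> into products of powers of k,
  \<open>tau k\<close> and ln T.\<close>

lemma log_scale_bounds:
  assumes T: "2 \<le> T" and k: "1 \<le> k"
  shows "2 / 3 \<le> ln (real T)" "1 < tau k" "1 \<le> logB T k" "ln (real T) \<le> logB T k" "tau k \<le> logB T k"
    "logB T k \<le> logA T k" "logA T k \<le> real k * logB T k" "real k \<le> logA T k" "real k * tau k \<le> logA T k"
    "ln (real T) \<le> logA T k" "1 \<le> logA T k" "1 \<le> real k * tau k" "tau k \<le> real k * tau k"
    "logB T k \<le> 3 * (ln (real T) * tau k)" "logA T k \<le> 3 * (real k * ln (real T) * tau k)"
proof -
  show l: "2 / 3 \<le> ln (real T)"
    using ln2_ge_two_thirds T by (meson ln_mono numeral_le_real_of_nat_iff order_trans zero_less_numeral)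
  show t: "1 < tau k" by (rule tau_gt_1[OF k])
  have kr: "1 \<le> real k" using k by simp
  have kt: "tau k \<le> real k * tau k" "real k \<le> real k * tau k"
    using mult_right_mono[OF kr, of "tau k"] mult_left_mono[of 1 "tau k" "real k"] t by auto
  show "tau k \<le> real k * tau k" by (rule kt)
  show "1 \<le> real k * tau k" using kt t by linarith
  have B: "logB T k = ln (real T) + tau k" and A: "logA T k = ln (real T) + real k * tau k"
    by (simp_all add: logB_def logA_def tau_def)
  show "1 \<le> logB T k" "ln (real T) \<le> logB T k" "tau k \<le> logB T k"
    "logB T k \<le> logA T k" "real k \<le> logA T k" "real k * tau k \<le> logA T k"
    "ln (real T) \<le> logA T k" "1 \<le> logA T k"
    using l t kt kr unfolding A B by linarith+
  have kl: "ln (real T) \<le> real k * ln (real T)" using mult_right_mono[OF kr, of "ln (real T)"] l by simp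
  show "logA T k \<le> real k * logB T k" unfolding A B distrib_left using kl by linarith
  have lt: "ln (real T) \<le> ln (real T) * tau k" using mult_left_mono[of 1 "tau k" "ln (real T)"] l t by simp
  have tl: "tau k \<le> 3 / 2 * (ln (real T) * tau k)"
    using mult_right_mono[of 1 "3 / 2 * ln (real T)" "tau k"] l t by simp
  have B3: "logB T k \<le> 5 / 2 * (ln (real T) * tau k)" unfolding B using lt tl by linarith
  moreover have "0 \<le> ln (real T) * tau k" using l t by simp
  ultimately show "logB T k \<le> 3 * (ln (real T) * tau k)" by linarith
  have "logA T k \<le> real k * (3 * (ln (real T) * tau k))"
    using \<open>logA T k \<le> real k * logB T k\<close> mult_left_mono[OF \<open>logB T k \<le> 3 * (ln (real T) * tau k)\<close>, of "real k"]
    by linarith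
  then show "logA T k \<le> 3 * (real k * ln (real T) * tau k)" by (simp add: mult_ac)
qed

lemma k_tau_bounds:
  assumes k: "1 \<le> k"
  shows "1 \<le> real k * tau k" "tau k \<le> real k * tau k" "real k \<le> real k * tau k"
proof -
  have "real k * 1 \<le> real k * tau k" using tau_gt_1[OF k] by (intro mult_left_mono) auto
  then show "real k \<le> real k * tau k" by simp
qed (rule log_scale_bounds[OF order_refl k])+

lemma logB_eq: "2 \<le> T \<Longrightarrow> ln (real T * (real k + 2)) = logB T k"
  by (simp add: ln_mult logB_def)

lemma L_ustb_eq: "L_ustb k A Au Bu Cu = root_prod k A * (1 + real k * unstable_gain Au Bu Cu)"
  by (simp add: L_ustb_def root_prod_def unstable_gain_def mult.assoc)

lemma L_ustb_ge:
  assumes "1 \<le> k"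
  shows "root_prod k A \<le> L_ustb k A Au Bu Cu" "1 \<le> L_ustb k A Au Bu Cu"
    "root_prod k A * (1 + unstable_gain Au Bu Cu) \<le> L_ustb k A Au Bu Cu"
proof -
  have "unstable_gain Au Bu Cu \<le> real k * unstable_gain Au Bu Cu"
    using assms unstable_gain_nonneg[of Au Bu Cu] mult_right_mono[of 1 "real k" "unstable_gain Au Bu Cu"] by simp
  then show 1: "root_prod k A * (1 + unstable_gain Au Bu Cu) \<le> L_ustb k A Au Bu Cu"
    unfolding L_ustb_eq using root_prod_ge_1[of k A] by (intro mult_left_mono) linarith+
  have "root_prod k A * 1 \<le> root_prod k A * (1 + unstable_gain Au Bu Cu)"
    using root_prod_ge_1[of k A] unstable_gain_nonneg[of Au Bu Cu] by (intro mult_left_mono) linarith+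
  then show "root_prod k A \<le> L_ustb k A Au Bu Cu" using 1 by simp
  then show "1 \<le> L_ustb k A Au Bu Cu" using root_prod_ge_1[of k A] by linarith
qed

lemma inf_norm_le_entries:
  assumes M: "0 \<le> M" "\<And>x. x \<in> elements_mat X \<Longrightarrow> \<bar>x\<bar> \<le> M"
  shows "inf_norm X \<le> real (dim_col X) * M"
proof (rule inf_norm_le)
  fix i assume i: "i < dim_row X"
  have "(\<Sum>j<dim_col X. \<bar>X $$ (i, j)\<bar>) \<le> (\<Sum>j<dim_col X. M)"
    using i by (intro sum_mono M(2) elements_matI[of X "dim_row X" "dim_col X"]) auto
  then show "(\<Sum>j<dim_col X. \<bar>X $$ (i, j)\<bar>) \<le> real (dim_col X) * M" by simp
qed (use M in simp)

definition lu_const :: "nat \<Rightarrow> real \<Rightarrow> real" where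
  "lu_const m M = 4 + 2 * ln (1 + M) + ln (1 + real m * M\<^sup>2)"

lemma lu_const_nonneg: "0 \<le> M \<Longrightarrow> 0 \<le> lu_const m M"
  by (simp add: lu_const_def)

text \<open>The blocks \<open>Au\<close> and \<open>Cu\<close> have up to k columns, so entries
  bounded by M allow induced norms up to k M. Both \<open>root_prod\<close> and the power of the
  norm of \<open>Au\<close> are then at most (1 + k M)^k, which accounts for the order k log k;
  \<open>Bu\<close> has m columns and contributes m M only.\<close>

lemma ln_L_ustb_le:
  assumes sys: "lds_system d m p A B C k"
    and blk: "lds_blocks k A B C Au Bst Bu Bf Cst Cu Cf V W"
    and M: "0 \<le> M" "\<And>x. x \<in> elements_mat Au \<union> elements_mat Bu \<union> elements_mat Cu \<Longrightarrow> \<bar>x\<bar> \<le> M"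
  shows "ln (L_ustb k A Au Bu Cu) \<le> lu_const m M * (real k * tau k)"
proof -
  note ub = unstable_block_bounds[OF sys blk]
  have k: "1 \<le> k" using sys instability_complexity_bounds[of A d k] by (auto simp: lds_system_def)
  let ?q = "dim_row Au" and ?N = "1 + real k * M"
  have qk: "real ?q \<le> real k" using ub(4) by simp
  have Au: "inf_norm Au \<le> real k * M"
    using inf_norm_le_entries[of M Au] M mult_right_mono[OF qk M(1)] carrier_matD(2)[OF ub(1)] by force
  have Cu: "inf_norm Cu \<le> real k * M"
    using inf_norm_le_entries[of M Cu] M mult_right_mono[OF qk M(1)] carrier_matD(2)[OF ub(3)] by force
  have Bu: "inf_norm Bu \<le> real m * M"
    using inf_norm_le_entries[of M Bu] M carrier_matD(2)[OF ub(2)] by force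
  have N1: "1 \<le> ?N" using M by simp
  have "root_prod k A \<le> (\<Prod>z\<in>unstable_eigs k A. ?N ^ alg_mult A z)"
    unfolding root_prod_def
  proof (rule prod_mono)
    fix z assume "z \<in> unstable_eigs k A"
    then have "cmod z \<le> inf_norm Au" using eigenvalue_le_inf_norm[OF ub(1)] ub(5) by blast
    then have "1 + cmod z \<le> ?N" using Au by linarith
    then show "0 \<le> (1 + cmod z) ^ alg_mult A z \<and> (1 + cmod z) ^ alg_mult A z \<le> ?N ^ alg_mult A z"
      by (auto intro: power_mono)
  qed
  also have "\<dots> = ?N ^ (\<Sum>z\<in>unstable_eigs k A. alg_mult A z)" by (rule power_sum[symmetric])
  also have "\<dots> \<le> ?N ^ k" using N1 ub(6) by (rule power_increasing[rotated])
  finally have rp: "root_prod k A \<le> ?N ^ k" .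
  have "unstable_gain Au Bu Cu \<le> (real k * M) * (real m * M) * ?N ^ k"
    unfolding unstable_gain_def
  proof (intro mult_mono Cu Bu)
    have "max 1 (inf_norm Au) ^ (?q - 1) \<le> ?N ^ (?q - 1)"
      using Au N1 by (intro power_mono) auto
    also have "\<dots> \<le> ?N ^ k" using N1 ub(4) by (intro power_increasing) auto
    finally show "max 1 (inf_norm Au) ^ (?q - 1) \<le> ?N ^ k" .
  qed (use M in \<open>auto intro: inf_norm_nonneg mult_nonneg_nonneg\<close>)
  then have "real k * unstable_gain Au Bu Cu \<le> real k * ((real k * M) * (real m * M) * ?N ^ k)"
    by (intro mult_left_mono) auto
  moreover have "1 \<le> ?N ^ k" using N1 by (rule one_le_power)
  ultimately have "1 + real k * unstable_gain Au Bu Cu \<le> ?N ^ k + real k * ((real k * M) * (real m * M) * ?N ^ k)"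
    by linarith
  also have "\<dots> = (1 + (real k)\<^sup>2 * (real m * M\<^sup>2)) * ?N ^ k"
    by (simp add: power2_eq_square algebra_simps)
  finally have ug: "1 + real k * unstable_gain Au Bu Cu \<le> (1 + (real k)\<^sup>2 * (real m * M\<^sup>2)) * ?N ^ k" .
  have N2: "?N \<le> (1 + M) * (real k + 2)" using M by (simp add: algebra_simps)
  have k2: "1 + (real k)\<^sup>2 * (real m * M\<^sup>2) \<le> (1 + real m * M\<^sup>2) * (real k + 2)\<^sup>2"
    using M by (simp add: power2_eq_square algebra_simps)
  have "L_ustb k A Au Bu Cu \<le> ?N ^ k * ((1 + (real k)\<^sup>2 * (real m * M\<^sup>2)) * ?N ^ k)"
    unfolding L_ustb_eq using rp ug unstable_gain_nonneg[of Au Bu Cu] N1 by (intro mult_mono) auto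
  also have "\<dots> = ?N ^ (2 * k) * (1 + (real k)\<^sup>2 * (real m * M\<^sup>2))" by (simp add: mult_2 power_add)
  also have "\<dots> \<le> ((1 + M) * (real k + 2)) ^ (2 * k) * ((1 + real m * M\<^sup>2) * (real k + 2)\<^sup>2)"
    using N2 k2 N1 M by (intro mult_mono power_mono) auto
  finally have "ln (L_ustb k A Au Bu Cu) \<le> ln (((1 + M) * (real k + 2)) ^ (2 * k) * ((1 + real m * M\<^sup>2) * (real k + 2)\<^sup>2))"
    using L_ustb_ge(2)[OF k, of A Au Bu Cu] by (intro ln_mono) auto
  also have "\<dots> = 2 * real k * (ln (1 + M) + tau k) + (ln (1 + real m * M\<^sup>2) + 2 * tau k)"
  proof -
    have p: "0 < 1 + M" "0 < real k + 2" "0 < 1 + real m * M\<^sup>2" using M by (auto intro: add_pos_nonneg)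
    show ?thesis using p by (simp add: ln_mult ln_realpow tau_def)
  qed
  also have "\<dots> \<le> lu_const m M * (real k * tau k)"
  proof -
    have t: "1 < tau k" and kr: "1 \<le> real k" using tau_gt_1[OF k] k by auto
    have l: "0 \<le> ln (1 + M)" "0 \<le> ln (1 + real m * M\<^sup>2)" using M by auto
    have e: "1 \<le> real k * tau k" "tau k \<le> real k * tau k" "real k \<le> real k * tau k"
      using k_tau_bounds[OF k] .
    have "ln (1 + M) * real k \<le> ln (1 + M) * (real k * tau k)" by (rule mult_left_mono[OF e(3) l(1)])
    moreover have "ln (1 + real m * M\<^sup>2) * 1 \<le> ln (1 + real m * M\<^sup>2) * (real k * tau k)"
      by (rule mult_left_mono[OF e(1) l(2)])
    moreover have "lu_const m M * (real k * tau k) = 4 * (real k * tau k)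
        + 2 * (ln (1 + M) * (real k * tau k)) + ln (1 + real m * M\<^sup>2) * (real k * tau k)"
      unfolding lu_const_def by (simp only: distrib_right mult.assoc)
    moreover have "2 * real k * (ln (1 + M) + tau k) = 2 * (ln (1 + M) * real k) + 2 * (real k * tau k)"
      by (simp add: algebra_simps)
    ultimately show ?thesis using e(2) by linarith
  qed
  finally show ?thesis .
qed

lemma ln_1_plus_k_Lu:
  assumes k: "1 \<le> k" and Lu: "1 \<le> Lu"
  shows "ln (1 + real k * Lu) \<le> 1 + ln (real k) + ln Lu"
proof -
  have kL: "1 * 1 \<le> real k * Lu" using k Lu by (intro mult_mono) auto
  have kL: "1 \<le> real k * Lu" using kL by simp
  then have "ln (1 + real k * Lu) \<le> ln (2 * (real k * Lu))" by (intro ln_mono) linarith+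
  also have "\<dots> = ln 2 + (ln (real k) + ln Lu)" using k Lu by (simp add: ln_mult)
  finally show ?thesis using ln_2_less_1 by linarith
qed

lemma ln_k_le_tau: "1 \<le> k \<Longrightarrow> ln (real k) \<le> tau k"
  unfolding tau_def by (intro ln_mono) auto

lemma nat_ceiling_le:
  fixes x y :: real
  assumes "x \<le> y" "0 \<le> y"
  shows "real (nat \<lceil>x\<rceil>) \<le> y + 1"
proof -
  have "real (nat \<lceil>x\<rceil>) \<le> real (nat \<lceil>y\<rceil>)" using assms by (intro of_nat_mono nat_mono ceiling_mono)
  also have "\<dots> \<le> y + 1" using assms(2) by linarith
  finally show ?thesis .
qed

lemma neg_ln_min_rate: "0 \<le> - ln min_rate"
  using min_rate by simp

lemma L_tilde_bounds:
  assumes k: "1 \<le> k" and Lu: "1 \<le> Lu" and le: "ln Lu \<le> c\<^sub>0 * (real k * tau k)"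
  shows "1 \<le> L_tilde k Lu" "Lu / (1 - 1 / tau k) ^ k \<le> L_tilde k Lu"
    "ln (1 + real k * Lu) \<le> (2 + c\<^sub>0) * (real k * tau k)"
    "ln (L_tilde k Lu) \<le> (2 + c\<^sub>0 - ln min_rate) * (real k * tau k)"
proof -
  let ?r = "1 - 1 / tau k"
  have r: "0 < ?r" "?r < 1" "min_rate \<le> ?r" using rate_bounds[OF k] min_rate by linarith+
  have kr: "1 \<le> real k" using k by simp
  have e: "1 \<le> real k * tau k" "tau k \<le> real k * tau k" "real k \<le> real k * tau k"
    using k_tau_bounds[OF k] .
  have kL: "Lu \<le> real k * Lu" using mult_right_mono[OF kr, of Lu] Lu by simp
  have rk: "0 < ?r ^ k" "?r ^ k \<le> 1" using r by (auto simp: power_le_one)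
  show "Lu / ?r ^ k \<le> L_tilde k Lu"
    unfolding L_tilde_def using kL rk by (intro divide_right_mono) linarith+
  have "1 \<le> Lu / ?r ^ k" using rk Lu by (subst pos_le_divide_eq) linarith+
  then show "1 \<le> L_tilde k Lu" using \<open>Lu / ?r ^ k \<le> L_tilde k Lu\<close> by linarith
  have "ln (1 + real k * Lu) \<le> 1 + ln (real k) + ln Lu" by (rule ln_1_plus_k_Lu[OF k Lu])
  also have "\<dots> \<le> (2 + c\<^sub>0) * (real k * tau k)"
    unfolding distrib_right using le ln_k_le_tau[OF k] e by linarith
  finally show l1: "ln (1 + real k * Lu) \<le> (2 + c\<^sub>0) * (real k * tau k)" .
  have p: "0 < 1 + real k * Lu" using kL Lu by linarith
  have "ln (L_tilde k Lu) = ln (1 + real k * Lu) - real k * ln ?r"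
    unfolding L_tilde_def using p rk r by (simp add: ln_div ln_realpow)
  moreover have "- (real k * ln ?r) \<le> - ln min_rate * (real k * tau k)"
  proof -
    have "ln min_rate \<le> ln ?r" using r min_rate by (intro ln_mono) auto
    then have "- (real k * ln ?r) \<le> - ln min_rate * real k"
      using mult_left_mono[of "ln min_rate" "ln ?r" "real k"] by (simp add: mult.commute)
    also have "\<dots> \<le> - ln min_rate * (real k * tau k)" by (rule mult_left_mono[OF e(3) neg_ln_min_rate])
    finally show ?thesis .
  qed
  ultimately show "ln (L_tilde k Lu) \<le> (2 + c\<^sub>0 - ln min_rate) * (real k * tau k)"
    using l1 by (simp add: algebra_simps)
qed

definition h_const :: "real \<Rightarrow> real \<Rightarrow> real \<Rightarrow> real" where
  "h_const K M c\<^sub>0 = ln (1 + 4 * pi * K\<^sup>2 * M ^ 4) + 2 * (2 + c\<^sub>0 - ln min_rate) + 2 * (2 + c\<^sub>0)"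

lemma h_const_nonneg: "0 \<le> c\<^sub>0 \<Longrightarrow> 0 \<le> h_const K M c\<^sub>0"
  unfolding h_const_def using neg_ln_min_rate pi_gt_zero
  by (intro add_nonneg_nonneg ln_ge_zero mult_nonneg_nonneg) (auto intro!: mult_nonneg_nonneg)

text \<open>The bound \<open>y\<close> on \<open>- ln \<epsilon>\<close> is left open: with ln (1 +
  1/\<epsilon>) it leads to the bound in terms of T, k and 1/\<epsilon>, with a constant to the one
  in terms of T and k alone.\<close>

lemma filter_count_le:
  assumes T: "2 \<le> T" and k: "1 \<le> k" and Lu: "1 \<le> Lu" and lnLu: "ln Lu \<le> c\<^sub>0 * (real k * tau k)"
    and c0: "0 \<le> c\<^sub>0" and M: "frob_norm Bst \<le> M" "frob_norm Cst \<le> M"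
    and eps: "0 < \<epsilon>" and y: "- ln \<epsilon> \<le> y" "0 \<le> y"
  shows "real (filter_count T k K Lu Bst Cst \<epsilon>)
    \<le> 1 + 2 * ln (real T) * (h_const K M c\<^sub>0 * (real k * tau k) + 6 * ln (real T) + y)"
proof -
  let ?l = "ln (real T)" and ?kt = "real k * tau k"
  define G where "G = 4 * pi * K\<^sup>2 * (frob_norm Cst)\<^sup>2 * (frob_norm Bst)\<^sup>2"
  define D where "D = 1 + real k * Lu"
  define X where "X = 4 * pi * K\<^sup>2 * (L_tilde k Lu)\<^sup>2 * (frob_norm Cst)\<^sup>2 * (frob_norm Bst)\<^sup>2 * real T ^ 6 * D\<^sup>2 / \<epsilon>"
  define Y where "Y = h_const K M c\<^sub>0 * ?kt + 6 * ?l + y"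
  have l: "2 / 3 \<le> ?l" and kt: "1 \<le> ?kt" by (rule log_scale_bounds[OF T k])+
  note lt = L_tilde_bounds[OF k Lu lnLu]
  have D: "0 < D" using Lu by (simp add: D_def add_pos_nonneg)
  have Y0: "0 \<le> Y" 
  proof -
    have "0 \<le> h_const K M c\<^sub>0 * ?kt" by (rule mult_nonneg_nonneg[OF h_const_nonneg[OF c0]]) (use kt in linarith)
    then show ?thesis unfolding Y_def using l y by linarith
  qed
  have "ln X \<le> Y"
  proof (cases "G = 0")
    \<comment> \<open>A vanishing gain or input bound makes the argument of the logarithm 0, and
      \<open>ln 0 = 0\<close>.\<close>
    case True
    then have "X = 0" by (auto simp: X_def G_def)
    then show ?thesis using Y0 by simp
  next
    case False
    have Gp: "0 < G" using False unfolding G_def by (simp add: zero_less_mult_iff)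
    have T0: "0 < real T" using T by simp
    have Xe: "X = G * (L_tilde k Lu)\<^sup>2 * real T ^ 6 * D\<^sup>2 / \<epsilon>" by (simp add: X_def G_def mult_ac)
    have "ln X = ln G + 2 * ln (L_tilde k Lu) + 6 * ?l + 2 * ln D - ln \<epsilon>"
      unfolding Xe using Gp lt(1) T0 D eps by (simp add: ln_div ln_mult ln_realpow)
    moreover have "ln G \<le> ln (1 + 4 * pi * K\<^sup>2 * M ^ 4) * ?kt"
    proof -
      have "G \<le> 4 * pi * K\<^sup>2 * M\<^sup>2 * M\<^sup>2"
        unfolding G_def using M frob_norm_nonneg
        by (intro mult_mono mult_left_mono power_mono) auto
      also have "\<dots> = 4 * pi * K\<^sup>2 * M ^ 4" by (simp add: power4_eq_xxxx power2_eq_square mult_ac)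
      finally have "ln G \<le> ln (1 + 4 * pi * K\<^sup>2 * M ^ 4)" using Gp by (intro ln_mono) linarith+
      also have "\<dots> \<le> ln (1 + 4 * pi * K\<^sup>2 * M ^ 4) * ?kt"
      proof -
        have "0 \<le> ln (1 + 4 * pi * K\<^sup>2 * M ^ 4)" using pi_gt_zero by (intro ln_ge_zero) (auto intro!: mult_nonneg_nonneg)
        from mult_left_mono[OF kt this] show ?thesis by simp
      qed
      finally show ?thesis .
    qed
    moreover have "h_const K M c\<^sub>0 * ?kt = ln (1 + 4 * pi * K\<^sup>2 * M ^ 4) * ?kt
        + 2 * ((2 + c\<^sub>0 - ln min_rate) * ?kt) + 2 * ((2 + c\<^sub>0) * ?kt)"
      unfolding h_const_def by (simp only: distrib_right mult.assoc)
    ultimately show ?thesis unfolding Y_def using lt(3,4) y unfolding D_def by linarith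
  qed
  then have "2 * ?l * ln X \<le> 2 * ?l * Y" using l by (intro mult_left_mono) auto
  moreover have "0 \<le> 2 * ?l * Y" using l Y0 by simp
  ultimately have "real (nat \<lceil>2 * ?l * ln X\<rceil>) \<le> 2 * ?l * Y + 1" by (rule nat_ceiling_le)
  then show ?thesis unfolding filter_count_def X_def D_def Y_def by simp
qed

text \<open>\<open>ln Lu\<close> is kept because one of the bounds on L retains
  \<open>L_ustb\<close>. The 3 collects ln T and three copies of \<open>tau k\<close>: one from the
  factor \<open>1 + tau k\<close>, two from the square of \<open>1 + real k * Lu\<close>.\<close>

lemma memory_length_le:
  assumes T: "2 \<le> T" and k: "1 \<le> k" and Lu: "1 \<le> Lu" and Cf: "0 \<le> Cf" "Cf \<le> M" and K: "0 \<le> K"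
    and eps: "0 < \<epsilon>" and y: "- ln \<epsilon> \<le> y" "0 \<le> y"
  shows "real (memory_length T k K Lu Cf \<epsilon>)
    \<le> 1 + tau k * (ln ((1 + M) * (1 + K)) + 2 + 3 * logB T k + 2 * ln Lu + y)"
proof -
  define D where "D = 1 + real k * Lu"
  define Z where "Z = (1 + Cf) * K * (1 + tau k) * real T * D\<^sup>2 / \<epsilon>"
  define Y where "Y = ln ((1 + M) * (1 + K)) + 2 + 3 * logB T k + 2 * ln Lu + y"
  note lf = log_scale_bounds[OF T k]
  have D: "0 < D" using Lu by (simp add: D_def add_pos_nonneg)
  have M1: "1 \<le> (1 + M) * (1 + K)" using Cf K mult_mono[of 1 "1 + M" 1 "1 + K"] by simp
  have Y0: "0 \<le> Y" unfolding Y_def using M1 lf(3) Lu y ln_ge_zero[of Lu] ln_ge_zero[OF M1] by linarith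
  have "ln Z \<le> Y"
  proof (cases "K = 0")
    case True
    then show ?thesis using Y0 by (simp add: Z_def)
  next
    case False
    have p: "0 < 1 + Cf" "0 < K" "0 < 1 + tau k" "0 < real T" using Cf False K lf(2) T by auto
    have "ln Z = ln ((1 + Cf) * K) + ln (1 + tau k) + ln (real T) + 2 * ln D - ln \<epsilon>"
      unfolding Z_def using p D eps by (simp add: ln_div ln_mult ln_realpow)
    moreover have "ln ((1 + Cf) * K) \<le> ln ((1 + M) * (1 + K))"
      using p Cf by (intro ln_mono mult_mono mult_pos_pos) auto
    moreover have "ln (1 + tau k) \<le> tau k" using lf(2) by (intro ln_add_one_self_le_self) simp
    moreover have "ln D \<le> 1 + ln (real k) + ln Lu" unfolding D_def by (rule ln_1_plus_k_Lu[OF k Lu])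
    moreover have "ln (real k) \<le> tau k" by (rule ln_k_le_tau[OF k])
    moreover have "logB T k = ln (real T) + tau k" by (simp add: logB_def tau_def)
    ultimately show ?thesis unfolding Y_def using y lf(1) by linarith
  qed
  then have "tau k * ln Z \<le> tau k * Y" using lf(2) by (intro mult_left_mono) auto
  moreover have "0 \<le> tau k * Y" using lf(2) Y0 by simp
  ultimately have "real (nat \<lceil>tau k * ln Z\<rceil>) \<le> tau k * Y + 1" by (rule nat_ceiling_le)
  then show ?thesis unfolding memory_length_def Z_def D_def Y_def by simp
qed

text \<open>The upper bound on \<open>ln \<epsilon>\<close> serves the memory length: there
  \<epsilon> divides the polynomial under the logarithm, and the quotient must stay large.\<close>

lemma approx_level_bounds:
  assumes T: "2 \<le> T" and k: "1 \<le> k" and c: "0 < c\<^sub>1" "c\<^sub>1 \<le> c\<^sub>2" and eps: "\<epsilon> \<in> approx_levels c\<^sub>1 c\<^sub>2 T k"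
  shows "0 < \<epsilon>" "- ln \<epsilon> \<le> ln (1 + 1 / c\<^sub>1)" "- ln \<epsilon> \<le> ln (1 + 1 / \<epsilon>)"
    "\<epsilon> \<le> 2 * c\<^sub>2 * (logB T k * logA T k)" "ln \<epsilon> \<le> (\<bar>ln c\<^sub>2\<bar> + 4) * logB T k"
proof -
  note lf = log_scale_bounds[OF T k]
  let ?B = "logB T k" and ?A = "logA T k"
  have BA: "?A \<le> ?B * ?A" using mult_right_mono[OF lf(3), of ?A] lf(11) by simp
  have e: "c\<^sub>1 * (real k + ?B * ?A) \<le> \<epsilon>" "\<epsilon> \<le> c\<^sub>2 * (real k + ?B * ?A)"
    using eps by (auto simp: approx_levels_def)
  have "c\<^sub>1 * 1 \<le> c\<^sub>1 * (real k + ?B * ?A)" using c(1) BA lf(11) k by (intro mult_left_mono) linarith+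
  then have ce: "c\<^sub>1 \<le> \<epsilon>" using e(1) by linarith
  show pos: "0 < \<epsilon>" using ce c by linarith
  have "- ln \<epsilon> = ln (1 / \<epsilon>)" using pos by (simp add: ln_div)
  also have "\<dots> \<le> ln (1 + 1 / \<epsilon>)" using pos by (intro ln_mono) auto
  finally show 1: "- ln \<epsilon> \<le> ln (1 + 1 / \<epsilon>)" .
  have "1 / \<epsilon> \<le> 1 / c\<^sub>1" using ce c by (intro divide_left_mono) auto
  then have "ln (1 + 1 / \<epsilon>) \<le> ln (1 + 1 / c\<^sub>1)" using pos by (intro ln_mono) (auto intro: add_pos_pos)
  then show "- ln \<epsilon> \<le> ln (1 + 1 / c\<^sub>1)" using 1 by linarith
  have "c\<^sub>2 * (real k + ?B * ?A) \<le> c\<^sub>2 * (2 * (?B * ?A))" using c BA lf(8) by (intro mult_left_mono) linarith+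
  then show 2: "\<epsilon> \<le> 2 * c\<^sub>2 * (?B * ?A)" using e(2) by simp
  have "?B * ?A \<le> ?B * (real k * ?B)" using lf(3,7) by (intro mult_left_mono) linarith+
  then have "2 * c\<^sub>2 * (?B * ?A) \<le> 2 * c\<^sub>2 * (?B * (real k * ?B))" by (rule mult_left_mono) (use c in simp)
  then have "ln \<epsilon> \<le> ln (2 * c\<^sub>2 * (?B * (real k * ?B)))" using 2 pos by (intro ln_mono) linarith+
  also have "\<dots> = ln 2 + ln c\<^sub>2 + (ln ?B + (ln (real k) + ln ?B))"
  proof -
    have "0 < c\<^sub>2" "0 < ?B" "0 < real k" using c lf(3) k by auto
    then show ?thesis by (simp add: ln_mult)
  qed
  also have "\<dots> \<le> (\<bar>ln c\<^sub>2\<bar> + 4) * ?B"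
  proof -
    have "ln ?B \<le> ?B - 1" using lf(3) by (intro ln_le_minus_one) linarith
    moreover have "\<bar>ln c\<^sub>2\<bar> * 1 \<le> \<bar>ln c\<^sub>2\<bar> * ?B" using lf(3) by (intro mult_left_mono) auto
    ultimately show ?thesis unfolding distrib_right
      using ln_2_less_1 ln_k_le_tau[OF k] lf(3,5) abs_ge_self[of "ln c\<^sub>2"] by linarith
  qed
  finally show "ln \<epsilon> \<le> (\<bar>ln c\<^sub>2\<bar> + 4) * ?B" .
qed

lemma logB_logA_le:
  assumes T: "2 \<le> T" and k: "1 \<le> k" and e: "2 \<le> e"
  shows "logB T k * logA T k \<le> real k * logB T k ^ e"
    "logB T k * logA T k \<le> 2 * (real k * ln (real T) * logB T k ^ e)"
proof -
  note lf = log_scale_bounds[OF T k]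
  let ?B = "logB T k" and ?A = "logA T k"
  have "?B * ?A \<le> ?B * (real k * ?B)" using lf(3,7) by (intro mult_left_mono) linarith+
  also have "\<dots> = real k * ?B ^ 2" by (simp add: power2_eq_square)
  also have "\<dots> \<le> real k * ?B ^ e" using lf(3) e by (intro mult_left_mono power_increasing) auto
  finally show 1: "?B * ?A \<le> real k * ?B ^ e" .
  have "0 \<le> real k * ?B ^ e" using lf(3) by simp
  then have "1 * (real k * ?B ^ e) \<le> (2 * ln (real T)) * (real k * ?B ^ e)" using lf(1) by (intro mult_right_mono) auto
  then show "?B * ?A \<le> 2 * (real k * ln (real T) * ?B ^ e)" using 1 by (simp add: mult_ac)
qed

text \<open>One constant and one exponent serve all the bounds; the exponent is the degree of a
  polynomial under a logarithm in some of them and the power of a logarithm in the others. Both are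
  fixed before T, k and the system.\<close>

lemma parameter_count_bounds:
  fixes m p :: nat
  assumes M: "0 \<le> M" and K: "0 \<le> K" and c: "0 < c\<^sub>1" "c\<^sub>1 \<le> c\<^sub>2" and c0: "0 \<le> c\<^sub>0"
  obtains cc e where "0 < cc" and
    "\<And>T k Lu Bst Cst Cf \<epsilon> h L. 2 \<le> T \<Longrightarrow> 1 \<le> k \<Longrightarrow> 1 \<le> Lu \<Longrightarrow> ln Lu \<le> c\<^sub>0 * (real k * tau k) \<Longrightarrow>
      frob_norm Bst \<le> M \<Longrightarrow> frob_norm Cst \<le> M \<Longrightarrow> 0 \<le> Cf \<Longrightarrow> Cf \<le> M \<Longrightarrow> \<epsilon> \<in> approx_levels c\<^sub>1 c\<^sub>2 T k \<Longrightarrow>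
      h = filter_count T k K Lu Bst Cst \<epsilon> \<Longrightarrow> L = memory_length T k K Lu Cf \<epsilon> \<Longrightarrow>
      real h \<le> cc * (real k * ln (real T) * ln ((real T * (real k + 2) * (1 + 1 / \<epsilon>)) ^ e)) \<and>
      real h \<le> cc * (real k * ln (real T * (real k + 2)) ^ e) \<and>
      real L \<le> cc * (tau k * ln ((real T * (real k + 2)) ^ e * Lu\<^sup>2 / \<epsilon>)) \<and>
      real L \<le> cc * (real k * ln (real T * (real k + 2) * (1 + 1 / \<epsilon>)) ^ e) \<and>
      real L \<le> cc * (real k * ln (real T * (real k + 2)) ^ e) \<and>
      real (p * feat_dim m k L h) \<le> cc * (real k * ln (real T) * ln (real T * (real k + 2)) ^ e) \<and>
      real (p * feat_dim m k L h) \<le> cc * (real k * ln (real T * (real k + 2)) ^ e) \<and>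
      real (feat_dim m k L h) \<le> cc * (logB T k * logA T k)"
proof -
  define \<iota> where "\<iota> = ln (1 + 1 / c\<^sub>1)"
  define \<zeta> where "\<zeta> = ln ((1 + M) * (1 + K))"
  define c3 where "c3 = h_const K M c\<^sub>0"
  \<comment> \<open>\<open>ch\<close> is for h, \<open>cL\<close> for L in terms of
    \<open>ln Lu\<close>, \<open>cM\<close> for L after replacing \<open>ln Lu\<close> by its bound,
    and \<open>cn\<close> for the feature dimension.\<close>
  define ch where "ch = 2 * c3 + 16 + 2 * \<iota>"
  define cL where "cL = \<zeta> + 6 + \<iota>"
  define cM where "cM = cL * (1 + 2 * c\<^sub>0)"
  define cn where "cn = 1 + real m * (cM + 2) + real m * ch"
  define cc where "cc = ch + cL + cM + cn + 2 * (real p * cn)"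
  define e where "e = nat \<lceil>\<bar>ln c\<^sub>2\<bar>\<rceil> + 6"
  have nn: "0 \<le> \<iota>" "0 \<le> \<zeta>" "0 \<le> c3"
    unfolding \<iota>_def \<zeta>_def c3_def using c M K h_const_nonneg[OF c0] mult_mono[of 1 "1 + M" 1 "1 + K"] by auto
  have nn2: "0 \<le> ch" "0 \<le> cL" unfolding ch_def cL_def using nn by auto
  have nn3: "0 \<le> cM" unfolding cM_def using nn2 c0 by simp
  have nn4: "1 \<le> cn" unfolding cn_def using nn2 nn3 by simp
  have ge: "ch \<le> cc" "cL \<le> cc" "cM \<le> cc" "cn \<le> cc" "2 * (real p * cn) \<le> cc" "0 < cc"
  proof -
    have "0 \<le> real p * cn" using nn4 by simp
    then show "ch \<le> cc" "cL \<le> cc" "cM \<le> cc" "cn \<le> cc" "2 * (real p * cn) \<le> cc" "0 < cc"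
      unfolding cc_def using nn2 nn3 nn4 by linarith+
  qed
  have e: "2 \<le> e" "1 \<le> e" "\<bar>ln c\<^sub>2\<bar> + 6 \<le> real e" unfolding e_def by (simp_all add: le_nat_iff)
  show thesis
  proof (rule that[OF ge(6), of e], goal_cases)
    case (1 T k Lu Bst Cst Cf \<epsilon> h L)
    note T = 1(1) and k = 1(2) and Lu = 1(3) and lnLu = 1(4) and eps = 1(9)
    note lf = log_scale_bounds[OF T k] and ab = approx_level_bounds[OF T k c eps]
    let ?B = "logB T k" and ?A = "logA T k" and ?l = "ln (real T)" and ?kt = "real k * tau k"
    define Q where "Q = ln (real T * (real k + 2) * (1 + 1 / \<epsilon>))"
    have y0: "0 \<le> ln (1 + 1 / \<epsilon>)" using ab(1) by simp
    have Q: "Q = ?B + ln (1 + 1 / \<epsilon>)"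
    proof -
      have "0 < real T * (real k + 2)" "0 < 1 + 1 / \<epsilon>" using T ab(1) by (auto intro: add_pos_pos)
      then show ?thesis unfolding Q_def using logB_eq[OF T, of k] by (simp only: ln_mult_pos)
    qed
    have BQ: "?B \<le> Q" using Q y0 by simp
    have kr: "1 \<le> real k" using k by simp
    have Q1: "1 \<le> Q" using BQ lf(3) by linarith
    have kQ: "Q \<le> real k * Q" using mult_right_mono[OF kr, of Q] Q1 by simp
    have BA1: "1 \<le> ?B * ?A" "?A \<le> ?B * ?A" "?l * ?A \<le> ?B * ?A" "tau k * ?A \<le> ?B * ?A"
      using mult_mono[of 1 ?B 1 ?A] mult_right_mono[OF lf(3), of ?A] mult_right_mono[OF lf(4), of ?A]
        mult_right_mono[OF lf(5), of ?A] lf(3,11) by simp_all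
    have h1: "real h \<le> 1 + 2 * ?l * (c3 * ?kt + 6 * ?l + ln (1 + 1 / \<epsilon>))"
      unfolding 1(10) c3_def by (rule filter_count_le[OF T k Lu lnLu c0 1(5,6) ab(1) ab(3) y0])
    have h2: "real h \<le> 1 + 2 * ?l * (c3 * ?kt + 6 * ?l + \<iota>)"
      unfolding 1(10) c3_def
      by (rule filter_count_le[OF T k Lu lnLu c0 1(5,6) ab(1) ab(2)[folded \<iota>_def] nn(1)])
    have L1: "real L \<le> 1 + tau k * (\<zeta> + 2 + 3 * ?B + 2 * ln Lu + \<iota>)"
      unfolding 1(11) \<zeta>_def
      by (rule memory_length_le[OF T k Lu 1(7,8) K ab(1) ab(2)[folded \<iota>_def] nn(1)])
    have lnLu0: "0 \<le> ln Lu" using Lu by simp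
    have hq: "real h \<le> ch * (real k * ?l * Q)"
    proof -
      have "?kt \<le> real k * Q" using BQ lf(5) by (intro mult_left_mono) linarith+
      then have "c3 * ?kt \<le> c3 * (real k * Q)" by (rule mult_left_mono[OF _ nn(3)])
      then have "c3 * ?kt + 6 * ?l + ln (1 + 1 / \<epsilon>) \<le> c3 * (real k * Q) + 7 * (real k * Q)"
        using lf(3,4) Q kQ BQ y0 by linarith
      then have "2 * ?l * (c3 * ?kt + 6 * ?l + ln (1 + 1 / \<epsilon>)) \<le> 2 * ?l * ((c3 + 7) * (real k * Q))"
        using lf(1) by (intro mult_left_mono) (auto simp: distrib_right)
      moreover have "1 \<le> 2 * (?l * (real k * Q))"
        using mult_mono[of "1 / 2" ?l 1 "real k * Q"] lf(1) kQ Q1 by simp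
      moreover have "2 * ?l * ((c3 + 7) * (real k * Q)) + 2 * (?l * (real k * Q)) = (2 * (c3 + 7) + 2) * (?l * (real k * Q))"
        by (simp add: algebra_simps)
      ultimately have "real h \<le> (2 * (c3 + 7) + 2) * (?l * (real k * Q))"
        using h1 by linarith
      also have "\<dots> \<le> ch * (?l * (real k * Q))"
      proof (rule mult_right_mono)
        show "2 * (c3 + 7) + 2 \<le> ch" unfolding ch_def using nn by simp
        show "0 \<le> ?l * (real k * Q)" using lf(1) Q1 by simp
      qed
      finally show ?thesis by (simp add: mult_ac)
    qed
    have hBA: "real h \<le> ch * (?B * ?A)"
    proof -
      have "c3 * ?kt \<le> c3 * ?A" using nn lf(9) by (intro mult_left_mono)
      moreover have "\<iota> * 1 \<le> \<iota> * ?A" using nn lf(11) by (intro mult_left_mono)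
      ultimately have "c3 * ?kt + 6 * ?l + \<iota> \<le> (c3 + 6 + \<iota>) * ?A" using lf(10) by (simp add: distrib_right)
      then have "2 * ?l * (c3 * ?kt + 6 * ?l + \<iota>) \<le> 2 * ?l * ((c3 + 6 + \<iota>) * ?A)"
        using lf(1) by (intro mult_left_mono) auto
      also have "\<dots> = 2 * (c3 + 6 + \<iota>) * (?l * ?A)" by (simp add: mult_ac)
      also have "\<dots> \<le> 2 * (c3 + 6 + \<iota>) * (?B * ?A)" using nn BA1 by (intro mult_left_mono) auto
      finally have "real h \<le> (2 * (c3 + 6 + \<iota>)) * (?B * ?A) + 1 * (?B * ?A)" using h2 BA1(1) by linarith
      also have "\<dots> = (2 * (c3 + 6 + \<iota>) + 1) * (?B * ?A)" by (simp only: distrib_right)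
      also have "\<dots> \<le> ch * (?B * ?A)" unfolding ch_def using BA1 by (intro mult_right_mono) auto
      finally show ?thesis .
    qed
    have LB: "real L \<le> cL * (tau k * (?B + 2 * ln Lu))"
    proof -
      have "(\<zeta> + 2 + \<iota>) * 1 \<le> (\<zeta> + 2 + \<iota>) * ?B" using nn lf(3) by (intro mult_left_mono) auto
      then have "\<zeta> + 2 + 3 * ?B + 2 * ln Lu + \<iota> \<le> (\<zeta> + 5 + \<iota>) * ?B + 2 * ln Lu"
        by (simp add: distrib_right)
      moreover have "1 \<le> tau k * ?B" using mult_mono[of 1 "tau k" 1 ?B] lf(2,3) by simp
      moreover have "tau k * (\<zeta> + 2 + 3 * ?B + 2 * ln Lu + \<iota>) \<le> tau k * ((\<zeta> + 5 + \<iota>) * ?B + 2 * ln Lu)"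
        using calculation(1) lf(2) by (intro mult_left_mono) auto
      ultimately have "real L \<le> tau k * ((\<zeta> + 5 + \<iota>) * ?B + 2 * ln Lu) + tau k * ?B" using L1 by linarith
      also have "\<dots> = tau k * (cL * ?B + 2 * ln Lu)" unfolding cL_def by (simp add: algebra_simps)
      also have "\<dots> \<le> tau k * (cL * ?B + cL * (2 * ln Lu))"
      proof -
        have "1 * (2 * ln Lu) \<le> cL * (2 * ln Lu)"
          unfolding cL_def using nn lnLu0 by (intro mult_right_mono) auto
        then show ?thesis using lf(2) by (intro mult_left_mono) auto
      qed
      finally show ?thesis by (simp add: algebra_simps)
    qed
    have LBA: "real L \<le> cM * (?B * ?A)"
    proof -
      have "c\<^sub>0 * ?kt \<le> c\<^sub>0 * ?A" using c0 lf(9) by (intro mult_left_mono)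
      then have "?B + 2 * ln Lu \<le> (1 + 2 * c\<^sub>0) * ?A" using lf(6) lnLu by (simp add: distrib_right)
      then have "tau k * (?B + 2 * ln Lu) \<le> tau k * ((1 + 2 * c\<^sub>0) * ?A)" using lf(2) by (intro mult_left_mono) auto
      also have "\<dots> = (1 + 2 * c\<^sub>0) * (tau k * ?A)" by (simp add: mult_ac)
      also have "\<dots> \<le> (1 + 2 * c\<^sub>0) * (?B * ?A)" using c0 BA1 by (intro mult_left_mono) auto
      finally have "cL * (tau k * (?B + 2 * ln Lu)) \<le> cL * ((1 + 2 * c\<^sub>0) * (?B * ?A))"
        using nn2 by (intro mult_left_mono)
      then show ?thesis using LB by (simp add: cM_def mult.assoc)
    qed
    have nBA: "real (feat_dim m k L h) \<le> cn * (?B * ?A)"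
    proof -
      have "real k + 1 \<le> 2 * (?B * ?A)" using lf(8) BA1 by linarith
      then have "real m * (real L + (real k + 1)) \<le> real m * (cM * (?B * ?A) + 2 * (?B * ?A))"
        using LBA by (intro mult_left_mono add_mono) auto
      moreover have "real m * real h \<le> real m * (ch * (?B * ?A))" using hBA by (intro mult_left_mono) auto
      moreover have "real (feat_dim m k L h) = real k + real m * (real L + (real k + 1)) + real m * real h"
        by (simp add: feat_dim_def algebra_simps)
      moreover have "cn * (?B * ?A) = ?B * ?A + real m * (cM * (?B * ?A) + 2 * (?B * ?A)) + real m * (ch * (?B * ?A))"
        unfolding cn_def by (simp add: algebra_simps)
      ultimately show ?thesis using lf(8) BA1 by linarith
    qed
    have up: "x \<le> cc * w" if "x \<le> b * w" "b \<le> cc" "0 \<le> w" for x b w :: real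
      using that(1) mult_right_mono[OF that(2,3)] by linarith
    have BA0: "0 \<le> ?B * ?A" using BA1 by linarith
    have P: "ln (real T * (real k + 2)) = ?B" by (rule logB_eq[OF T])
    note le = logB_logA_le[OF T k e(1)]
    have kB0: "0 \<le> real k * ?B ^ e" "0 \<le> real k * ?l * ?B ^ e" using lf(1,3) by simp_all
    have tr: "x \<le> cc * w" if "x \<le> b * (?B * ?A)" "0 \<le> b" "b \<le> cc" "?B * ?A \<le> w" for x b w :: real
    proof -
      have "b * (?B * ?A) \<le> cc * w" using that BA0 by (intro mult_mono) linarith+
      then show ?thesis using that(1) by linarith
    qed
    show ?case
      unfolding P Q_def[symmetric]
    proof (intro conjI)
      show "real h \<le> cc * (real k * ?l * ln ((real T * (real k + 2) * (1 + 1 / \<epsilon>)) ^ e))"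
      proof -
        have pos: "0 < real T * (real k + 2) * (1 + 1 / \<epsilon>)"         proof (rule mult_pos_pos)
          show "0 < real T * (real k + 2)" using T by simp
          show "0 < 1 + 1 / \<epsilon>" using ab(1) by (simp add: add_pos_pos)
        qed
        have "ln ((real T * (real k + 2) * (1 + 1 / \<epsilon>)) ^ e) = real e * Q"
          unfolding Q_def by (rule ln_realpow)
        moreover have "1 * Q \<le> real e * Q" using e(2) Q1 by (intro mult_right_mono) auto
        ultimately have "real k * ?l * Q \<le> real k * ?l * ln ((real T * (real k + 2) * (1 + 1 / \<epsilon>)) ^ e)"
          using lf(1) by (intro mult_left_mono) auto
        then have "ch * (real k * ?l * Q) \<le> cc * (real k * ?l * ln ((real T * (real k + 2) * (1 + 1 / \<epsilon>)) ^ e))"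
          using lf(1) Q1 ge(6) by (intro mult_mono[OF ge(1)]) simp_all
        then show ?thesis using hq by linarith
      qed
      show "real h \<le> cc * (real k * ?B ^ e)" by (rule tr[OF hBA nn2(1) ge(1) le(1)])
      show "real L \<le> cc * (tau k * ln ((real T * (real k + 2)) ^ e * Lu\<^sup>2 / \<epsilon>))"
      proof -
        have pos: "0 < real T * (real k + 2)" using T by simp
        have "ln ((real T * (real k + 2)) ^ e * Lu\<^sup>2 / \<epsilon>) = real e * ?B + 2 * ln Lu - ln \<epsilon>"
        proof -
          have "ln (S ^ e * Lu\<^sup>2 / \<epsilon>) = real e * ln S + 2 * ln Lu - ln \<epsilon>" if "0 < S" for S
            using that Lu ab(1) by (simp add: ln_div ln_mult ln_realpow)
          from this[OF pos] show ?thesis unfolding P .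
        qed
        moreover have "(\<bar>ln c\<^sub>2\<bar> + 6) * ?B \<le> real e * ?B" using e(3) lf(3) by (intro mult_right_mono) auto
        ultimately have "?B + 2 * ln Lu \<le> ln ((real T * (real k + 2)) ^ e * Lu\<^sup>2 / \<epsilon>)"
          using ab(5) lf(3) unfolding distrib_right by linarith
        then have "tau k * (?B + 2 * ln Lu) \<le> tau k * ln ((real T * (real k + 2)) ^ e * Lu\<^sup>2 / \<epsilon>)"
          using lf(2) by (intro mult_left_mono) auto
        moreover have "0 \<le> tau k * (?B + 2 * ln Lu)" using lf(2,3) lnLu0 by simp
        ultimately have "cL * (tau k * (?B + 2 * ln Lu)) \<le> cc * (tau k * ln ((real T * (real k + 2)) ^ e * Lu\<^sup>2 / \<epsilon>))"
          using ge(6) by (intro mult_mono[OF ge(2)]) linarith+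
        then show ?thesis using LB by linarith
      qed
      show LL: "real L \<le> cc * (real k * ?B ^ e)" by (rule tr[OF LBA nn3 ge(3) le(1)])
      show "real L \<le> cc * (real k * Q ^ e)"
      proof -
        have "?B ^ e \<le> Q ^ e" using BQ lf(3) by (intro power_mono) linarith+
        then have "cc * (real k * ?B ^ e) \<le> cc * (real k * Q ^ e)" using ge(6) by (intro mult_left_mono) auto
        then show ?thesis using LL by linarith
      qed
      have pn: "real (p * feat_dim m k L h) \<le> (real p * cn) * (?B * ?A)"
        using mult_left_mono[OF nBA, of "real p"] by (simp add: mult.assoc)
      have pn0: "0 \<le> real p * cn" using nn4 by simp
      show "real (p * feat_dim m k L h) \<le> cc * (real k * ?l * ?B ^ e)"
      proof -
        have "(real p * cn) * (?B * ?A) \<le> (real p * cn) * (2 * (real k * ?l * ?B ^ e))"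
          by (rule mult_left_mono[OF le(2) pn0])
        also have "\<dots> = (2 * (real p * cn)) * (real k * ?l * ?B ^ e)" by simp
        also have "\<dots> \<le> cc * (real k * ?l * ?B ^ e)" by (rule mult_right_mono[OF ge(5) kB0(2)])
        finally show ?thesis using pn by linarith
      qed
      have "real p * cn \<le> cc" using ge(5) pn0 by linarith
      then show "real (p * feat_dim m k L h) \<le> cc * (real k * ?B ^ e)" by (rule tr[OF pn pn0 _ le(1)])
      show "real (feat_dim m k L h) \<le> cc * (?B * ?A)" by (rule up[OF nBA ge(4) BA0])
    qed
  qed
qed

section \<open>Prediction error\<close>

definition weight_bound ::
  "nat \<Rightarrow> real mat \<Rightarrow> real mat \<Rightarrow> real mat \<Rightarrow> real mat \<Rightarrow> real mat \<Rightarrow> real mat \<Rightarrow> real \<Rightarrow> real \<Rightarrow> real" where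
  "weight_bound k A Au Bu Cu Bst Cst Gf \<Theta> =
     root_prod k A * (1 + unstable_gain Au Bu Cu + frob_norm Cst * frob_norm Bst + Gf)
     + frob_norm Cst * frob_norm Bst * (root_prod k A / (1 - 1 / tau k) ^ k) * (1 + \<Theta>)"

text \<open>The mechanism behind both tuning formulas, with b = 2 ln T for the filters and b =
  \<open>tau k\<close> for the memory. Truncating a negative ceiling to 0 only decreases the
  left-hand side.\<close>

lemma exp_neg_nat_ceiling_le:
  assumes "0 < X" "0 < b"
  shows "exp (- (real (nat \<lceil>b * ln X\<rceil>) / b)) \<le> 1 / X"
proof -
  have "b * ln X \<le> real (nat \<lceil>b * ln X\<rceil>)" by linarith
  then have "ln X \<le> real (nat \<lceil>b * ln X\<rceil>) / b" using assms(2) by (simp add: pos_le_divide_eq mult.commute)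
  then have "exp (- (real (nat \<lceil>b * ln X\<rceil>) / b)) \<le> exp (- ln X)" by simp
  also have "\<dots> = 1 / X" using assms(1) by (simp add: exp_minus field_simps)
  finally show ?thesis .
qed

text \<open>The power of the rate is at most exp (- L / \<open>tau k\<close>), hence at most 1 / Z
  for the argument Z of the logarithm in the memory length. The factors of Z dominate those of the
  error one by one, the squared factor dominating \<open>l1\<close>. For K = 0 the error vanishes
  although Z is 0.\<close>

lemma fast_error_le:
  assumes T: "2 \<le> T" and k: "1 \<le> k" and K: "0 \<le> K" and Gf: "0 \<le> Gf" and eps: "0 < \<epsilon>"
    and l1: "0 \<le> l1" "l1 \<le> Lu" and Lu: "1 \<le> Lu"
    and L: "L = memory_length T k K Lu Gf \<epsilon>"
  shows "K * l1 * Gf * (1 - 1 / tau k) ^ Suc L * tau k \<le> \<epsilon> / real T"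
proof (cases "K = 0")
  case True
  then show ?thesis using eps by simp
next
  case False
  define D where "D = 1 + real k * Lu"
  define Z where "Z = (1 + Gf) * K * (1 + tau k) * real T * D\<^sup>2 / \<epsilon>"
  let ?r = "1 - 1 / tau k"
  have t: "1 < tau k" by (rule tau_gt_1[OF k])
  have r: "0 < ?r" "?r < 1" using t by (auto simp: field_simps)
  have kr: "1 \<le> real k" using k by simp
  have DL: "Lu \<le> D" using mult_right_mono[OF kr, of Lu] Lu unfolding D_def by linarith
  then have D: "1 \<le> D" using Lu by linarith
  have "D * 1 \<le> D * D" using D by (intro mult_left_mono) auto
  then have DD: "l1 \<le> D\<^sup>2" using DL l1 by (simp add: power2_eq_square)
  have Z: "0 < Z" unfolding Z_def using Gf K False t T D eps by (intro divide_pos_pos mult_pos_pos) auto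
  have "?r ^ Suc L \<le> ?r ^ L" using r by (intro power_decreasing) auto
  also have "\<dots> \<le> exp (- (1 / tau k)) ^ L"
    using r exp_ge_add_one_self[of "- (1 / tau k)"] by (intro power_mono) auto
  also have "\<dots> = exp (- (real L / tau k))" by (simp add: exp_of_nat_mult[symmetric])
  also have "\<dots> \<le> 1 / Z"
    unfolding L memory_length_def D_def[symmetric] Z_def[symmetric] using Z t
    by (intro exp_neg_nat_ceiling_le) auto
  finally have rL: "?r ^ Suc L \<le> 1 / Z" .
  have "K * l1 * Gf * tau k \<le> K * D\<^sup>2 * (1 + Gf) * (1 + tau k)"
    using K l1 Gf t DD by (intro mult_mono mult_nonneg_nonneg) auto
  also have "\<dots> = Z * (\<epsilon> / real T)" unfolding Z_def using T eps by (simp add: field_simps)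
  finally have 1: "K * l1 * Gf * tau k \<le> Z * (\<epsilon> / real T)" .
  have "K * l1 * Gf * ?r ^ Suc L * tau k = (K * l1 * Gf * tau k) * ?r ^ Suc L" by simp
  also have "\<dots> \<le> (Z * (\<epsilon> / real T)) * (1 / Z)"
    using r Z eps by (intro mult_mono[OF 1 rL]) (auto intro!: mult_nonneg_nonneg)
  also have "\<dots> = \<epsilon> / real T" using Z by simp
  finally show ?thesis .
qed

text \<open>The formula for h turns the exponential in the tail bound into 1 / X, and X contains the
  squares of all gains. Of its power T^6 only T^4 is used up; the 10 is 120 / 12, as 12 \<le> 4 pi.
  Here it is the square of the error that is of order \<epsilon> / T, while the fast error is of
  that order itself.\<close>

lemma slow_error_le:
  assumes T: "2 \<le> T" and eps: "0 < \<epsilon>"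
    and l: "0 \<le> l" "l \<le> L_tilde k Lu" "1 \<le> L_tilde k Lu" and Lu: "1 \<le> Lu"
    and h: "h = filter_count T k K Lu Bst Cst \<epsilon>"
    and R: "R\<^sup>2 = 120 * real T ^ 2 * exp (- real h / (2 * ln (real T)))"
  shows "(frob_norm Cst * frob_norm Bst * l * (R * (sqrt (real T) * K)))\<^sup>2 \<le> 10 * (\<epsilon> / real T)"
proof (cases "frob_norm Cst = 0 \<or> frob_norm Bst = 0 \<or> K = 0")
  case True
  then show ?thesis using eps by auto
next
  case False
  define D where "D = 1 + real k * Lu"
  define G where "G = K\<^sup>2 * (L_tilde k Lu)\<^sup>2 * (frob_norm Cst)\<^sup>2 * (frob_norm Bst)\<^sup>2"
  define X where "X = 4 * pi * K\<^sup>2 * (L_tilde k Lu)\<^sup>2 * (frob_norm Cst)\<^sup>2 * (frob_norm Bst)\<^sup>2 * real T ^ 6 * D\<^sup>2 / \<epsilon>"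
  have D: "1 \<le> D" using Lu by (simp add: D_def)
  have G: "0 < G" using False l(3) unfolding G_def by (auto intro!: mult_pos_pos)
  have Tr: "1 \<le> real T" using T by simp
  have Xe: "X = 4 * pi * (G * (real T ^ 6 * D\<^sup>2)) / \<epsilon>" by (simp add: X_def G_def mult_ac)
  have X: "0 < X" unfolding Xe using G Tr D eps pi_gt_zero by (intro divide_pos_pos mult_pos_pos) auto
  have lnT: "0 < ln (real T)" using T by simp
  have ex: "exp (- real h / (2 * ln (real T))) \<le> 1 / X"
    using exp_neg_nat_ceiling_le[OF X, of "2 * ln (real T)"] lnT
    unfolding h filter_count_def X_def D_def by simp
  have "(frob_norm Cst * frob_norm Bst * l * (R * (sqrt (real T) * K)))\<^sup>2
      = ((frob_norm Cst)\<^sup>2 * (frob_norm Bst)\<^sup>2 * K\<^sup>2 * l\<^sup>2) * (real T * R\<^sup>2)"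
    using Tr by (simp add: power_mult_distrib mult_ac)
  also have "\<dots> \<le> G * (real T * R\<^sup>2)"
  proof (rule mult_right_mono)
    have "l\<^sup>2 \<le> (L_tilde k Lu)\<^sup>2" using l by (intro power_mono) auto
    then have "((frob_norm Cst)\<^sup>2 * (frob_norm Bst)\<^sup>2 * K\<^sup>2) * l\<^sup>2
        \<le> ((frob_norm Cst)\<^sup>2 * (frob_norm Bst)\<^sup>2 * K\<^sup>2) * (L_tilde k Lu)\<^sup>2"
      by (rule mult_left_mono) simp
    then show "(frob_norm Cst)\<^sup>2 * (frob_norm Bst)\<^sup>2 * K\<^sup>2 * l\<^sup>2 \<le> G" by (simp add: G_def mult_ac)
  qed (use Tr in simp)
  also have "\<dots> \<le> G * (real T * (120 * real T ^ 2 * (1 / X)))"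
    unfolding R using ex G Tr by (intro mult_left_mono) auto
  also have "\<dots> = 120 * (G * real T ^ 3) / X" by (simp add: power2_eq_square power3_eq_cube mult_ac)
  also have "\<dots> \<le> 10 * (\<epsilon> / real T)"
  proof -
    have "12 * (G * real T ^ 4) \<le> 4 * pi * (G * (real T ^ 6 * D\<^sup>2))"
    proof (rule mult_mono)
      show "12 \<le> 4 * pi" using pi_gt3 by simp
      have "real T ^ 4 \<le> real T ^ 6" using Tr by (intro power_increasing) auto
      then have "real T ^ 4 * 1 \<le> real T ^ 6 * D\<^sup>2" using D by (intro mult_mono one_le_power) auto
      then show "G * real T ^ 4 \<le> G * (real T ^ 6 * D\<^sup>2)" using G by (intro mult_left_mono) auto
    qed (use G in auto)
    also have "\<dots> = X * \<epsilon>" unfolding Xe using eps by simp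
    finally have a: "12 * (G * real T ^ 4) \<le> X * \<epsilon>" .
    have "120 * (G * real T ^ 3) * real T = 10 * (12 * (G * real T ^ 4))"
      by (simp add: eval_nat_numeral mult_ac)
    also have "\<dots> \<le> 10 * (X * \<epsilon>)" using a by simp
    finally have "120 * (G * real T ^ 3) * real T \<le> (10 * \<epsilon>) * X" by (simp add: mult_ac)
    then show ?thesis using X Tr by (simp add: field_simps)
  qed
  finally show ?thesis .
qed

lemma abs_output_le:
  assumes u: "controlled_run d m A B C K By u" and C: "C \<in> carrier_mat p d" and t: "1 \<le> t" and i: "i < p"
  shows "\<bar>lds_output d A B C u t $ i\<bar> \<le> By"
proof -
  have "norm (lds_output d A B C u t $ i) \<le> l2norm (lds_output d A B C u t)"
    using C i by (intro index_le_l2norm) (simp add: lds_output_def)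
  also have "\<dots> \<le> By" using u t by (auto simp: controlled_run_def)
  finally show ?thesis by simp
qed

text \<open>The constant is fixed before the system: the system-dependent gains are already
  compensated by the tuning of h and L, so they survive only in the bound on the weights.\<close>

lemma comparator_cumulative_error:
  fixes m :: nat and K By c\<^sub>1 c\<^sub>2 :: real
  assumes K: "0 \<le> K" and c: "0 < c\<^sub>1" "c\<^sub>1 \<le> c\<^sub>2"
  obtains c8 where "0 \<le> c8" and
    "\<And>d p A B C k Au Bst Bu Bf Cst Cu Cf V W T \<epsilon> \<phi> \<sigma> u \<Theta> i h L y.
      lds_system d m p A B C k \<Longrightarrow> lds_blocks k A B C Au Bst Bu Bf Cst Cu Cf V W \<Longrightarrow> 2 \<le> T \<Longrightarrow>
      \<epsilon> \<in> approx_levels c\<^sub>1 c\<^sub>2 T k \<Longrightarrow> spectral_filters T \<phi> \<sigma> \<Longrightarrow> controlled_run d m A B C K By u \<Longrightarrow>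
      (\<And>x. complex_of_real x \<in> slow_eigs k A \<Longrightarrow> (\<Sum>i<T. (x ^ i)\<^sup>2) \<le> \<Theta>\<^sup>2) \<Longrightarrow> 0 \<le> \<Theta> \<Longrightarrow> i < p \<Longrightarrow>
      h = filter_count T k K (L_ustb k A Au Bu Cu) Bst Cst \<epsilon> \<Longrightarrow>
      L = memory_length T k K (L_ustb k A Au Bu Cu) (fast_gain Bf Cf V W) \<epsilon> \<Longrightarrow>
      y = lds_output d A B C u \<Longrightarrow>
      \<exists>w \<in> carrier_vec (feat_dim m k L h).
        (\<forall>j<feat_dim m k L h. \<bar>w $ j\<bar> \<le> weight_bound k A Au Bu Cu Bst Cst (fast_gain Bf Cf V W) \<Theta>) \<and>
        (\<Sum>t = 1..T. (unified_feature m p k L h T \<phi> u y i t \<bullet> w - y t $ i)\<^sup>2) \<le> c8 * (logA T k)\<^sup>2"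
proof -
  obtain T\<^sub>0 :: nat where tail: "\<And>T \<phi> \<sigma> h \<alpha>. T\<^sub>0 \<le> T \<Longrightarrow> spectral_filters T \<phi> \<sigma> \<Longrightarrow> \<bar>\<alpha>\<bar> \<le> 1 \<Longrightarrow>
    (\<Sum>j\<in>{h..<T}. (\<Sum>i<T. \<phi> j $ i * \<alpha> ^ i)\<^sup>2) \<le> 120 * real T ^ 2 * exp (- real h / (2 * ln (real T)))"
    by (rule filter_tail_le) blast
  define c8 where "c8 = 2 * (real m)\<^sup>2 * (4 * c\<^sub>2\<^sup>2 + 20 * c\<^sub>2) + (1 + real T\<^sub>0) * By\<^sup>2"
  have c2: "0 < c\<^sub>2" using c by linarith
  have nn: "0 \<le> 2 * (real m)\<^sup>2 * (4 * c\<^sub>2\<^sup>2 + 20 * c\<^sub>2)" "0 \<le> (1 + real T\<^sub>0) * By\<^sup>2" using c2 by simp_all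
  show thesis
  proof (rule that[of c8], goal_cases)
    case 1
    show ?case unfolding c8_def using nn by linarith
  next
    case (2 d p A B C k Au Bst Bu Bf Cst Cu Cf V W T \<epsilon> \<phi> \<sigma> u \<Theta> i h L y)
    note sys = 2(1) and blk = 2(2) and T = 2(3) and eps = 2(4) and sf = 2(5) and u = 2(6)
      and \<Theta> = 2(7,8) and i = 2(9) and h = 2(10) and L = 2(11) and y = 2(12)
    have A: "A \<in> carrier_mat d d" and C: "C \<in> carrier_mat p d" and kA: "k = instability_complexity A"
      using sys by (auto simp: lds_system_def)
    have k: "1 \<le> k" using instability_complexity_bounds[OF A kA] by auto
    note lf = log_scale_bounds[OF T k] and ab = approx_level_bounds[OF T k c eps]
    let ?B = "logB T k" and ?A = "logA T k" and ?Lu = "L_ustb k A Au Bu Cu"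
      and ?Gf = "fast_gain Bf Cf V W" and ?n = "feat_dim m k L h"
    let ?W = "weight_bound k A Au Bu Cu Bst Cst ?Gf \<Theta>"
    note Lu = L_ustb_ge[OF k, of A Au Bu Cu]
    have Gf: "0 \<le> ?Gf" by (simp add: fast_gain_def spectral_norm_nonneg)
    have r: "0 < 1 - 1 / tau k" using rate_bounds[OF k] min_rate by linarith
    have rp: "0 \<le> root_prod k A" using root_prod_ge_1[of k A] by linarith
    show ?case
    proof (cases "T\<^sub>0 \<le> T \<and> ?B\<^sup>2 \<le> real T")
      case True
      define R where "R = sqrt (120 * real T ^ 2 * exp (- real h / (2 * ln (real T))))"
      have R: "0 \<le> R" "R\<^sup>2 = 120 * real T ^ 2 * exp (- real h / (2 * ln (real T)))"
        by (simp_all add: R_def)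
      have tl: "(\<Sum>j\<in>{h..<T}. (\<Sum>i<T. \<phi> j $ i * \<alpha> ^ i)\<^sup>2) \<le> R\<^sup>2" if "\<bar>\<alpha>\<bar> \<le> 1" for \<alpha>
        unfolding R(2) using True sf that by (intro tail) auto
      define ef where "ef = K * root_prod k A * ?Gf * (1 - 1 / tau k) ^ Suc L * tau k"
      define es where "es = frob_norm Cst * frob_norm Bst * (root_prod k A / (1 - 1 / tau k) ^ k) * (R * (sqrt (real T) * K))"
      obtain w where w: "w \<in> carrier_vec ?n" "\<And>j. j < ?n \<Longrightarrow> \<bar>w $ j\<bar> \<le> ?W"
        and err: "\<And>t. t \<in> {1..T} \<Longrightarrow> \<bar>unified_feature m p k L h T \<phi> u y i t \<bullet> w - y t $ i\<bar> \<le> real m * (ef + es)"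
        using comparator_exists[OF sys blk sf u K tl R(1) \<Theta> i]
        unfolding weight_bound_def ef_def es_def y by blast
      have ef: "0 \<le> ef" "ef \<le> \<epsilon> / real T"
        unfolding ef_def using K rp Gf r lf(2) fast_error_le[OF T k K Gf ab(1) rp Lu(1,2) L]
        by (auto intro!: mult_nonneg_nonneg)
      have lt: "1 \<le> L_tilde k ?Lu" "?Lu / (1 - 1 / tau k) ^ k \<le> L_tilde k ?Lu"
      proof -
        \<comment> \<open>The two conclusions of \<open>L_tilde_bounds\<close> that are used here do
          not mention its constant, so \<open>ln ?Lu\<close> itself is an admissible choice.\<close>
        have "ln ?Lu \<le> ln ?Lu * (real k * tau k)"
          using mult_left_mono[OF lf(12), of "ln ?Lu"] Lu(2) by simp
        from L_tilde_bounds(1,2)[OF k Lu(2) this]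
        show "1 \<le> L_tilde k ?Lu" "?Lu / (1 - 1 / tau k) ^ k \<le> L_tilde k ?Lu" by auto
      qed
      have "root_prod k A / (1 - 1 / tau k) ^ k \<le> ?Lu / (1 - 1 / tau k) ^ k"
        using Lu(1) r by (intro divide_right_mono) auto
      then have "root_prod k A / (1 - 1 / tau k) ^ k \<le> L_tilde k ?Lu" using lt(2) by linarith
      moreover have "0 \<le> root_prod k A / (1 - 1 / tau k) ^ k" using rp r by simp
      ultimately have es: "es\<^sup>2 \<le> 10 * (\<epsilon> / real T)"
        unfolding es_def by (intro slow_error_le[OF T ab(1) _ _ lt(1) Lu(2) h R(2)])
      have step: "(unified_feature m p k L h T \<phi> u y i t \<bullet> w - y t $ i)\<^sup>2
          \<le> 2 * (real m)\<^sup>2 * ((\<epsilon> / real T)\<^sup>2 + 10 * (\<epsilon> / real T))" if "t \<in> {1..T}" for t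
      proof -
        have "(unified_feature m p k L h T \<phi> u y i t \<bullet> w - y t $ i)\<^sup>2 \<le> (real m * (ef + es))\<^sup>2"
          using power_mono[OF err[OF that] abs_ge_zero, of 2] by simp
        also have "\<dots> = (real m)\<^sup>2 * (ef + es)\<^sup>2" by (simp add: power_mult_distrib)
        also have "\<dots> \<le> (real m)\<^sup>2 * (2 * (ef\<^sup>2 + es\<^sup>2))"
        proof (rule mult_left_mono)
          have "0 \<le> (ef - es)\<^sup>2" by simp
          then show "(ef + es)\<^sup>2 \<le> 2 * (ef\<^sup>2 + es\<^sup>2)" by (simp add: power2_sum power2_diff)
        qed simp
        also have "\<dots> \<le> (real m)\<^sup>2 * (2 * ((\<epsilon> / real T)\<^sup>2 + 10 * (\<epsilon> / real T)))"
          using es power_mono[OF ef(2,1), of 2] by (intro mult_left_mono) auto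
        also have "\<dots> = 2 * (real m)\<^sup>2 * ((\<epsilon> / real T)\<^sup>2 + 10 * (\<epsilon> / real T))"
          by (simp only: mult_ac)
        finally show ?thesis .
      qed
      have "(\<Sum>t = 1..T. (unified_feature m p k L h T \<phi> u y i t \<bullet> w - y t $ i)\<^sup>2)
          \<le> (\<Sum>t = 1..T. 2 * (real m)\<^sup>2 * ((\<epsilon> / real T)\<^sup>2 + 10 * (\<epsilon> / real T)))"
        by (rule sum_mono) (rule step)
      also have "\<dots> = 2 * (real m)\<^sup>2 * (\<epsilon>\<^sup>2 / real T + 10 * \<epsilon>)"
        using T by (simp add: field_simps power2_eq_square)
      \<comment> \<open>The fast errors sum to \<epsilon>^2 / T. As \<epsilon> is of order B A, this
        is O(A^2) once B^2 \<le> T; the slow errors sum to O(\<epsilon>), which is O(A^2) because B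
        \<le> A.\<close>
      also have "\<dots> \<le> 2 * (real m)\<^sup>2 * ((4 * c\<^sub>2\<^sup>2 + 20 * c\<^sub>2) * ?A\<^sup>2)"
      proof (rule mult_left_mono)
        have "\<epsilon>\<^sup>2 \<le> (2 * c\<^sub>2 * (?B * ?A))\<^sup>2" using ab(1,4) by (intro power_mono) auto
        also have "\<dots> = 4 * c\<^sub>2\<^sup>2 * ?A\<^sup>2 * ?B\<^sup>2" by (simp add: power_mult_distrib mult_ac)
        also have "\<dots> \<le> 4 * c\<^sub>2\<^sup>2 * ?A\<^sup>2 * real T" using True by (intro mult_left_mono) auto
        finally have "\<epsilon>\<^sup>2 / real T \<le> 4 * c\<^sub>2\<^sup>2 * ?A\<^sup>2" using T by (simp add: pos_divide_le_eq)
        moreover have "?B * ?A \<le> ?A * ?A" using lf(6,11) by (intro mult_right_mono) auto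
        then have "2 * c\<^sub>2 * (?B * ?A) \<le> 2 * c\<^sub>2 * (?A * ?A)" using c2 by (intro mult_left_mono) auto
        then have "10 * \<epsilon> \<le> 20 * c\<^sub>2 * ?A\<^sup>2" using ab(4) by (simp add: power2_eq_square)
        ultimately show "\<epsilon>\<^sup>2 / real T + 10 * \<epsilon> \<le> (4 * c\<^sub>2\<^sup>2 + 20 * c\<^sub>2) * ?A\<^sup>2"
          unfolding distrib_right by linarith
      qed simp
      also have "\<dots> \<le> c8 * ?A\<^sup>2"
      proof -
        have "(2 * (real m)\<^sup>2 * (4 * c\<^sub>2\<^sup>2 + 20 * c\<^sub>2)) * ?A\<^sup>2 \<le> c8 * ?A\<^sup>2"
          unfolding c8_def using nn by (intro mult_right_mono) auto
        then show ?thesis by (simp add: mult.assoc)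
      qed
      finally show ?thesis using w by blast
    next
      case False
      have Tb: "real T \<le> (1 + real T\<^sub>0) * ?A\<^sup>2"
      proof -
        have A1: "1 \<le> ?A\<^sup>2" using lf(11) by (intro one_le_power)
        have "?B\<^sup>2 \<le> ?A\<^sup>2" using lf(3,6) by (intro power_mono) auto
        moreover have "real T\<^sub>0 * 1 \<le> real T\<^sub>0 * ?A\<^sup>2" using A1 by (intro mult_left_mono) auto
        moreover have "real T \<le> real T\<^sub>0 \<or> real T \<le> ?B\<^sup>2" using False by auto
        moreover have "0 \<le> real T\<^sub>0 * ?A\<^sup>2" by simp
        ultimately show ?thesis using A1 unfolding distrib_right by linarith
      qed
      have W0: "0 \<le> ?W"
      proof -
        have "0 \<le> frob_norm Cst * frob_norm Bst" by (simp add: frob_norm_nonneg)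
        then show ?thesis unfolding weight_bound_def using rp r \<Theta>(2) Gf unstable_gain_nonneg[of Au Bu Cu]
          by (intro add_nonneg_nonneg mult_nonneg_nonneg divide_nonneg_nonneg zero_le_power) (auto simp: frob_norm_nonneg)
      qed
      have "(\<Sum>t = 1..T. (unified_feature m p k L h T \<phi> u y i t \<bullet> 0\<^sub>v ?n - y t $ i)\<^sup>2) \<le> (\<Sum>t = 1..T. By\<^sup>2)"
      proof (rule sum_mono)
        fix t assume "t \<in> {1..T}"
        then have "\<bar>y t $ i\<bar> \<le> By" unfolding y by (intro abs_output_le[OF u C _ i]) simp
        then have "(y t $ i)\<^sup>2 \<le> By\<^sup>2" using power_mono[of "\<bar>y t $ i\<bar>" By 2] by simp
        moreover have "unified_feature m p k L h T \<phi> u y i t \<in> carrier_vec ?n" by (rule carrier_vecI) simp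
        ultimately show "(unified_feature m p k L h T \<phi> u y i t \<bullet> 0\<^sub>v ?n - y t $ i)\<^sup>2 \<le> By\<^sup>2" by simp
      qed
      also have "\<dots> = By\<^sup>2 * real T" by simp
      also have "\<dots> \<le> By\<^sup>2 * ((1 + real T\<^sub>0) * ?A\<^sup>2)" using Tb by (intro mult_left_mono) auto
      also have "\<dots> = ((1 + real T\<^sub>0) * By\<^sup>2) * ?A\<^sup>2" by (simp add: mult_ac)
      also have "\<dots> \<le> c8 * ?A\<^sup>2" unfolding c8_def using nn by (intro mult_right_mono) auto
      finally show ?thesis using W0 by (intro bexI[of _ "0\<^sub>v ?n"]) auto
    qed
  qed
qed

text \<open>Outputs and lagged inputs are bounded by constants; a filter component pairs a unit
  vector with T inputs and may grow like the square root of T.\<close>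

lemma abs_unified_feature_le:
  assumes sf: "spectral_filters T \<phi> \<sigma>" and K: "0 \<le> K" and By: "0 \<le> By"
    and u: "\<And>t. 1 \<le> t \<Longrightarrow> u t \<in> carrier_vec m \<and> l2norm (u t) \<le> K"
    and y: "\<And>t. 1 \<le> t \<Longrightarrow> \<bar>y t $ i\<bar> \<le> By" and i: "i < p" and T: "1 \<le> T" and j: "j < feat_dim m k L h"
  shows "\<bar>unified_feature m p k L h T \<phi> u y i t $ j\<bar> \<le> (By + K) * sqrt (real T)"
proof -
  interpret filters T \<phi> \<sigma> by unfold_locales (rule sf)
  let ?E = "(By + K) * sqrt (real T)"
  have s1: "1 \<le> sqrt (real T)" using T by simp
  have le: "x \<le> ?E" if "x \<le> By \<or> x \<le> K" for x
  proof -
    have "(By + K) * 1 \<le> ?E" using s1 By K by (intro mult_left_mono) auto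
    then show ?thesis using that By K by auto
  qed
  have uK: "\<bar>lagged u m t g $ l\<bar> \<le> K" if "l < m" for g l
  proof (cases "g < t")
    case True
    then have g: "u (t - g) \<in> carrier_vec m" "l2norm (u (t - g)) \<le> K" using u[of "t - g"] by simp_all
    have "norm (u (t - g) $ l) \<le> l2norm (u (t - g))"
      using carrier_vecD[OF g(1)] that by (intro index_le_l2norm) simp
    also have "\<dots> \<le> K" by (rule g(2))
    finally show ?thesis using True by (simp add: lagged_def)
  qed (use K that in \<open>simp add: lagged_def\<close>)
  have 1: "\<bar>output_feature p k y t i $ g\<bar> \<le> ?E" if "g < k" for g
    using that y[of "t - Suc g"] By i by (intro le) (auto simp: output_feature_def lagged_def)
  have 2: "\<bar>input_feature m k L u t $ g\<bar> \<le> ?E" if "g < m * (L + k + 1)" for g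
  proof -
    have "0 < m" using that by (cases m) auto
    then show ?thesis using that uK[of "g mod m"] by (intro le) (simp add: input_feature_def)
  qed
  have 3: "\<bar>filter_feature m h T \<phi> u t $ g\<bar> \<le> ?E" if "g < h * m" for g
  proof (cases "g div m < T")
    case True
    have m0: "0 < m" using that by (cases m) auto
    define l b where "l = g mod m" and "b = g div m"
    have l: "l < m" using m0 by (simp add: l_def)
    have b: "b < T" using True by (simp add: b_def)
    define v where "v a = lagged u m t a $ l" for a
    have "(\<Sum>a<T. v a * \<phi> b $ a)\<^sup>2 \<le> (\<Sum>a<T. (v a)\<^sup>2) * (\<Sum>a<T. (\<phi> b $ a)\<^sup>2)"
      by (rule Cauchy_Schwarz_ineq_sum)
    also have "(\<Sum>a<T. (\<phi> b $ a)\<^sup>2) = 1" using phi_orthonormal[OF b b] by (simp add: power2_eq_square)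
    also have "(\<Sum>a<T. (v a)\<^sup>2) * 1 \<le> (\<Sum>a<T. K\<^sup>2)"
      unfolding mult_1_right
    proof (rule sum_mono)
      fix a
      show "(v a)\<^sup>2 \<le> K\<^sup>2" using power_mono[OF uK[OF l, of a] abs_ge_zero, of 2] by (simp add: v_def)
    qed
    also have "\<dots> = (K * sqrt (real T))\<^sup>2" by (simp add: power_mult_distrib)
    finally have "\<bar>\<Sum>a<T. v a * \<phi> b $ a\<bar>\<^sup>2 \<le> (K * sqrt (real T))\<^sup>2" by simp
    then have "\<bar>\<Sum>a<T. v a * \<phi> b $ a\<bar> \<le> K * sqrt (real T)" by (rule power2_le_imp_le) (use K in simp)
    also have "\<dots> \<le> ?E" using By by (intro mult_right_mono) auto
    finally have *: "\<bar>\<Sum>a<T. v a * \<phi> b $ a\<bar> \<le> ?E" .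
    have "(input_history m T u t *\<^sub>v \<phi> b) $ l = (\<Sum>a<T. v a * \<phi> b $ a)"
      using l carrier_vecD[OF phi_carrier[OF b]]
      by (simp add: input_history_def scalar_prod_def v_def atLeast0LessThan)
    then show ?thesis using that True * by (simp add: filter_feature_def l_def b_def)
  next
    case False
    then show ?thesis using that le[of 0] K by (simp add: filter_feature_def)
  qed
  have d: "dim_vec (output_feature p k y t i) = k" "dim_vec (input_feature m k L u t) = m * (L + k + 1)"
    "dim_vec (filter_feature m h T \<phi> u t) = h * m"
    by (simp_all add: output_feature_def input_feature_def filter_feature_def)
  have j': "j < k + (m * (L + k + 1) + h * m)" using j by (simp add: feat_dim_def)
  consider "j < k" | "k \<le> j" "j - k < m * (L + k + 1)"
    | "k \<le> j" "m * (L + k + 1) \<le> j - k" "j - k - m * (L + k + 1) < h * m"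
    using j' by linarith
  then show ?thesis
  proof cases
    case a: 1
    have "unified_feature m p k L h T \<phi> u y i t $ j = output_feature p k y t i $ j"
      unfolding unified_feature_def using a d j' by (subst index_append_vec) auto
    then show ?thesis using 1[OF a] by simp
  next
    case a: 2
    have "unified_feature m p k L h T \<phi> u y i t $ j = input_feature m k L u t $ (j - k)"
      unfolding unified_feature_def using a d j' by (subst index_append_vec, simp, subst index_append_vec) auto
    then show ?thesis using 2[OF a(2)] by simp
  next
    case a: 3
    have "unified_feature m p k L h T \<phi> u y i t $ j = filter_feature m h T \<phi> u t $ (j - k - m * (L + k + 1))"
      unfolding unified_feature_def using a d j' by (subst index_append_vec, simp, subst index_append_vec) auto
    then show ?thesis using 3[OF a(3)] by simp
  qed
qed

lemma scalar_prod_self_le: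
  assumes "\<And>j. j < n \<Longrightarrow> \<bar>w $ j\<bar> \<le> (b :: real)" "w \<in> carrier_vec n"
  shows "w \<bullet> w \<le> real n * b\<^sup>2"
proof -
  have "w \<bullet> w = (\<Sum>j<n. (w $ j)\<^sup>2)"
    using assms(2) by (simp add: scalar_prod_def atLeast0LessThan power2_eq_square)
  also have "\<dots> \<le> (\<Sum>j<n. b\<^sup>2)"
  proof (rule sum_mono)
    fix j assume "j \<in> {..<n}"
    then show "(w $ j)\<^sup>2 \<le> b\<^sup>2" using power_mono[OF assms(1)[of j] abs_ge_zero, of 2] by simp
  qed
  finally show ?thesis by simp
qed

text \<open>Feature dimension and feature size are under the logarithm and cost O(A). The term in
  \<open>lam\<close> is kept apart, since its size compared with A differs between the
  applications.\<close>

lemma ln_regret_le: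
  fixes n T :: nat and E lam cc B A :: real
  assumes n: "0 < n" "real n \<le> cc * (B * A)" and T: "2 \<le> T" and A: "1 \<le> A" "B \<le> A" "ln (real T) \<le> A"
    and B: "1 \<le> B" and cc: "0 < cc" and lam: "0 < lam"
  shows "ln (real n * (1 + real T * (E * sqrt (real T))\<^sup>2 / lam))
    \<le> (\<bar>ln cc\<bar> + ln (1 + E\<^sup>2) + 4) * A + ln (1 + 1 / lam)"
proof -
  have Tr: "1 \<le> real T" using T by simp
  have e: "real T * (E * sqrt (real T))\<^sup>2 = E\<^sup>2 * (real T)\<^sup>2"
    using Tr by (simp add: power_mult_distrib power2_eq_square)
  have E1: "1 \<le> 1 + E\<^sup>2" by simp
  have T2: "1 \<le> (real T)\<^sup>2" using Tr by (rule one_le_power)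
  have "1 + E\<^sup>2 * (real T)\<^sup>2 \<le> (1 + E\<^sup>2) * (real T)\<^sup>2" unfolding distrib_right using T2 by linarith
  moreover have "1 + E\<^sup>2 * (real T)\<^sup>2 / lam \<le> (1 + E\<^sup>2 * (real T)\<^sup>2) * (1 + 1 / lam)"
    using lam by (simp add: algebra_simps)
  ultimately have le: "1 + E\<^sup>2 * (real T)\<^sup>2 / lam \<le> ((1 + E\<^sup>2) * (real T)\<^sup>2) * (1 + 1 / lam)"
    using lam by (meson add_nonneg_nonneg divide_nonneg_pos mult_right_mono order_trans zero_le_one)
  have pos: "0 < 1 + E\<^sup>2 * (real T)\<^sup>2 / lam" "0 < 1 + 1 / lam" using lam by (auto intro: add_pos_nonneg)
  have "ln (1 + E\<^sup>2 * (real T)\<^sup>2 / lam) \<le> ln (((1 + E\<^sup>2) * (real T)\<^sup>2) * (1 + 1 / lam))"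
    using le pos by (intro ln_mono) linarith+
  also have "\<dots> = ln (1 + E\<^sup>2) + 2 * ln (real T) + ln (1 + 1 / lam)"
  proof -
    have "0 < 1 + E\<^sup>2" "0 < real T" using Tr by (auto intro: add_pos_nonneg)
    then show ?thesis using pos(2) by (simp add: ln_mult ln_realpow)
  qed
  finally have 1: "ln (1 + E\<^sup>2 * (real T)\<^sup>2 / lam) \<le> ln (1 + E\<^sup>2) + 2 * ln (real T) + ln (1 + 1 / lam)" .
  have "ln (real n) \<le> ln (cc * (B * A))" using n by (intro ln_mono) auto
  also have "\<dots> = ln cc + (ln B + ln A)" using cc B A by (simp add: ln_mult)
  finally have 2: "ln (real n) \<le> ln cc + (ln B + ln A)" .
  have "ln B \<le> A" "ln A \<le> A" using ln_le_minus_one[of B] ln_le_minus_one[of A] A B by linarith+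
  moreover have "\<bar>ln cc\<bar> * 1 \<le> \<bar>ln cc\<bar> * A" "ln (1 + E\<^sup>2) * 1 \<le> ln (1 + E\<^sup>2) * A"
    by (rule mult_left_mono[OF A(1)], use E1 in simp)+
  moreover have "ln (real n * (1 + real T * (E * sqrt (real T))\<^sup>2 / lam))
      = ln (real n) + ln (1 + E\<^sup>2 * (real T)\<^sup>2 / lam)"
    unfolding e using n(1) pos(1) by (simp add: ln_mult)
  ultimately show ?thesis using 1 2 A(3) abs_ge_self[of "ln cc"] unfolding distrib_right by linarith
qed

text \<open>\<open>lam\<close> and \<Theta> are left open for two uses: an exponentially small
  \<open>lam\<close> with \<Theta> the square root of T, uniformly over systems, and a fixed
  \<open>lam\<close> with a constant \<Theta> for one system. In both, the last factor is
  O(A).\<close>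

lemma avg_error_le:
  fixes m p :: nat and M K By c\<^sub>1 c\<^sub>2 :: real
  assumes K: "0 \<le> K" and c: "0 < c\<^sub>1" "c\<^sub>1 \<le> c\<^sub>2" and M: "0 \<le> M"
  obtains cc where "0 < cc" and
    "\<And>d A B C k Au Bst Bu Bf Cst Cu Cf V W T \<epsilon> \<phi> \<sigma> u \<Theta> lam.
      lds_system d m p A B C k \<Longrightarrow> lds_blocks k A B C Au Bst Bu Bf Cst Cu Cf V W \<Longrightarrow>
      mode_bound M Au Bst Bu Bf Cst Cu Cf V W \<Longrightarrow> 2 \<le> T \<Longrightarrow>
      \<epsilon> \<in> approx_levels c\<^sub>1 c\<^sub>2 T k \<Longrightarrow> spectral_filters T \<phi> \<sigma> \<Longrightarrow> controlled_run d m A B C K By u \<Longrightarrow>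
      (\<And>x. complex_of_real x \<in> slow_eigs k A \<Longrightarrow> (\<Sum>i<T. (x ^ i)\<^sup>2) \<le> \<Theta>\<^sup>2) \<Longrightarrow> 0 \<le> \<Theta> \<Longrightarrow> 0 < lam \<Longrightarrow>
      avg_error m p k (memory_length T k K (L_ustb k A Au Bu Cu) (fast_gain Bf Cf V W) \<epsilon>)
        (filter_count T k K (L_ustb k A Au Bu Cu) Bst Cst \<epsilon>) T \<phi> lam u (lds_output d A B C u)
      \<le> cc * (logB T k * logA T k * (lam * (weight_bound k A Au Bu Cu Bst Cst (fast_gain Bf Cf V W) \<Theta>)\<^sup>2
          + logA T k + ln (1 + 1 / lam))) / real T"
proof -
  show thesis
  proof (rule comparator_cumulative_error[OF K c, where m = m and By = By],
      rule parameter_count_bounds[OF M K c lu_const_nonneg[OF M, of m], where m = m and p = p], goal_cases)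
    case (1 c8 cs e)
    note c8 = 1(1) and comp = 1(2) and cs = 1(3) and size = 1(4)
    define c11 where "c11 = \<bar>ln cs\<bar> + ln (1 + (By + K)\<^sup>2) + 4"
    define c12 where "c12 = cs + c8 + By\<^sup>2 * cs * c11"
    have c11: "1 \<le> c11" unfolding c11_def by (simp add: add_nonneg_nonneg)
    have c12: "0 < c12" unfolding c12_def using cs c8 c11 by (auto intro!: add_pos_nonneg)
    show ?case
    proof (rule that[of "(1 + real p) * c12"], goal_cases)
      case 1
      show ?case using c12 by (simp add: add_pos_nonneg)
    next
      case (2 d A B C k Au Bst Bu Bf Cst Cu Cf V W T \<epsilon> \<phi> \<sigma> u \<Theta> lam)
      note sys = 2(1) and blk = 2(2) and mb = 2(3) and T = 2(4) and eps = 2(5) and sf = 2(6) and u = 2(7)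
        and \<Theta> = 2(8,9) and lam = 2(10)
      have A: "A \<in> carrier_mat d d" and C: "C \<in> carrier_mat p d" and kA: "k = instability_complexity A"
        using sys by (auto simp: lds_system_def)
      have k: "1 \<le> k" using instability_complexity_bounds[OF A kA] by auto
      note lf = log_scale_bounds[OF T k]
      define h where "h = filter_count T k K (L_ustb k A Au Bu Cu) Bst Cst \<epsilon>"
      define L where "L = memory_length T k K (L_ustb k A Au Bu Cu) (fast_gain Bf Cf V W) \<epsilon>"
      define y where "y = lds_output d A B C u"
      define n where "n = feat_dim m k L h"
      define a where "a i t = unified_feature m p k L h T \<phi> u y i t" for i t
      define Wm where "Wm = weight_bound k A Au Bu Cu Bst Cst (fast_gain Bf Cf V W) \<Theta>"
      define Q where "Q = lam * Wm\<^sup>2 + logA T k + ln (1 + 1 / lam)"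
      let ?B = "logB T k" and ?A = "logA T k"
      have By: "0 \<le> By"
      proof -
        have "l2norm (y 1) \<le> By" using u by (auto simp: controlled_run_def y_def)
        then show ?thesis by (rule order_trans[rotated]) (simp add: l2norm_def)
      qed
      have nle: "real n \<le> cs * (?B * ?A)"
        unfolding n_def
      proof (rule size[THEN conjunct2, THEN conjunct2, THEN conjunct2, THEN conjunct2, THEN conjunct2,
            THEN conjunct2, THEN conjunct2, OF T k _ _ _ _ _ _ eps h_def L_def])
        show "1 \<le> L_ustb k A Au Bu Cu" by (rule L_ustb_ge[OF k])
        show "ln (L_ustb k A Au Bu Cu) \<le> lu_const m M * (real k * tau k)"
          using mb by (intro ln_L_ustb_le[OF sys blk M]) (auto simp: mode_bound_def)
      qed (use mb in \<open>auto simp: mode_bound_def fast_gain_def spectral_norm_nonneg\<close>)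
      have n0: "0 < n" using k by (simp add: n_def feat_dim_def)
      have ln0: "0 \<le> ln (1 + 1 / lam)" using lam by simp
      have Q: "lam * Wm\<^sup>2 \<le> Q" "?A \<le> Q" "?A + ln (1 + 1 / lam) \<le> Q"
        unfolding Q_def using lam ln0 lf(11) by simp_all
      have BA: "0 \<le> ?B * ?A" using lf(3,11) by simp
      have reg: "(\<Sum>t = 1..T. (vaw_predict lam n (a i) (\<lambda>s. y s $ i) t - y t $ i)\<^sup>2) \<le> c12 * (?B * ?A * Q)"
        if i: "i < p" for i
      proof -
        interpret vaw_data lam n "a i" "\<lambda>s. y s $ i"
          by unfold_locales (use lam in \<open>auto simp: a_def n_def intro: carrier_vecI\<close>)
        obtain w where w: "w \<in> carrier_vec n" "\<And>j. j < n \<Longrightarrow> \<bar>w $ j\<bar> \<le> Wm"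
          and err: "(\<Sum>t = 1..T. (a i t \<bullet> w - y t $ i)\<^sup>2) \<le> c8 * ?A\<^sup>2"
          using comp[OF sys blk T eps sf u \<Theta> i h_def L_def y_def] unfolding a_def n_def Wm_def by blast
        have ya: "\<And>t. 1 \<le> t \<Longrightarrow> \<bar>y t $ i\<bar> \<le> By" unfolding y_def by (rule abs_output_le[OF u C _ i])
        have "(\<Sum>t = 1..T. (vaw_predict lam n (a i) (\<lambda>s. y s $ i) t - y t $ i)\<^sup>2)
            \<le> lam * (w \<bullet> w) + (\<Sum>t = 1..T. (a i t \<bullet> w - y t $ i)\<^sup>2)
              + By\<^sup>2 * (real n * ln (real n * (1 + real T * ((By + K) * sqrt (real T))\<^sup>2 / lam)))"
        proof (rule vaw_regret[OF w(1) n0])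
          show "\<bar>y t $ i\<bar> \<le> By" if "t \<in> {1..T}" for t using ya that by simp
          show "\<bar>a i t $ j\<bar> \<le> (By + K) * sqrt (real T)" if "t \<in> {1..T}" "j < n" for t j
            unfolding a_def using u that T
            by (intro abs_unified_feature_le[OF sf K By _ ya i]) (auto simp: controlled_run_def n_def)
        qed
        also have "\<dots> \<le> cs * (?B * ?A * Q) + c8 * (?B * ?A * Q) + By\<^sup>2 * cs * c11 * (?B * ?A * Q)"
        proof (intro add_mono)
          have "lam * (w \<bullet> w) \<le> lam * (real n * Wm\<^sup>2)"
            using lam scalar_prod_self_le[OF w(2,1)] by (intro mult_left_mono) auto
          also have "\<dots> = real n * (lam * Wm\<^sup>2)" by simp
          also have "\<dots> \<le> (cs * (?B * ?A)) * Q"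
            using nle Q(1) lam cs BA by (intro mult_mono) auto
          finally show "lam * (w \<bullet> w) \<le> cs * (?B * ?A * Q)" by (simp add: mult.assoc)
          have "?A * ?A \<le> (?B * ?A) * Q"
            using Q(2) lf(3,11) mult_right_mono[OF lf(3), of ?A] BA by (intro mult_mono) auto
          then have "c8 * ?A\<^sup>2 \<le> c8 * (?B * ?A * Q)"
            unfolding power2_eq_square using c8 by (rule mult_left_mono)
          then show "(\<Sum>t = 1..T. (a i t \<bullet> w - y t $ i)\<^sup>2) \<le> c8 * (?B * ?A * Q)" using err by linarith
          let ?ln = "ln (real n * (1 + real T * ((By + K) * sqrt (real T))\<^sup>2 / lam))"
          have "?ln \<le> c11 * ?A + ln (1 + 1 / lam)"
            unfolding c11_def by (rule ln_regret_le[OF n0 nle T lf(11,6,10,3) cs lam])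
          also have "\<dots> \<le> c11 * ?A + c11 * ln (1 + 1 / lam)"
            using mult_right_mono[OF c11 ln0] by simp
          also have "\<dots> \<le> c11 * Q"
            unfolding distrib_left[symmetric] using c11 Q(3) by (intro mult_left_mono) auto
          finally have l: "?ln \<le> c11 * Q" .
          have Q0: "0 \<le> c11 * Q" using c11 Q(2) lf(11) by simp
          have "real n * ?ln \<le> real n * (c11 * Q)" using l by (intro mult_left_mono) auto
          also have "\<dots> \<le> (cs * (?B * ?A)) * (c11 * Q)" by (rule mult_right_mono[OF nle Q0])
          finally have "By\<^sup>2 * (real n * ?ln) \<le> By\<^sup>2 * ((cs * (?B * ?A)) * (c11 * Q))" by (intro mult_left_mono) auto
          then show "By\<^sup>2 * (real n * ?ln) \<le> By\<^sup>2 * cs * c11 * (?B * ?A * Q)" by (simp add: mult_ac)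
        qed
        also have "\<dots> = c12 * (?B * ?A * Q)" unfolding c12_def by (simp only: distrib_right)
        finally show ?thesis .
      qed
      have yd: "dim_vec (y t) = p" for t using C by (simp add: y_def lds_output_def)
      have sq: "(l2norm (unified_predict m p k L h T \<phi> lam u y t - y t))\<^sup>2
          = (\<Sum>i<p. (vaw_predict lam n (a i) (\<lambda>s. y s $ i) t - y t $ i)\<^sup>2)" for t
      proof -
        have "(l2norm (unified_predict m p k L h T \<phi> lam u y t - y t))\<^sup>2
            = (\<Sum>i<p. ((unified_predict m p k L h T \<phi> lam u y t - y t) $ i)\<^sup>2)"
          by (simp add: l2norm_def L2_set_def yd sum_nonneg)
        also have "\<dots> = (\<Sum>i<p. (vaw_predict lam n (a i) (\<lambda>s. y s $ i) t - y t $ i)\<^sup>2)"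
          by (intro sum.cong refl) (simp add: yd unified_predict_def n_def a_def[abs_def])
        finally show ?thesis .
      qed
      have "avg_error m p k L h T \<phi> lam u y
          = (\<Sum>i<p. \<Sum>t = 1..T. (vaw_predict lam n (a i) (\<lambda>s. y s $ i) t - y t $ i)\<^sup>2) / real T"
        unfolding avg_error_def sq by (subst sum.swap) simp
      also have "\<dots> \<le> (\<Sum>i<p. c12 * (?B * ?A * Q)) / real T"
        by (intro divide_right_mono sum_mono reg) auto
      also have "\<dots> \<le> (1 + real p) * c12 * (?B * ?A * Q) / real T"
      proof (rule divide_right_mono)
        have "0 \<le> c12 * (?B * ?A * Q)" 
          by (rule mult_nonneg_nonneg[OF less_imp_le[OF c12] mult_nonneg_nonneg[OF BA]]) (use Q(2) lf(11) in linarith)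
        then show "(\<Sum>i<p. c12 * (?B * ?A * Q)) \<le> (1 + real p) * c12 * (?B * ?A * Q)"
          by (simp add: distrib_right)
      qed simp
      finally show ?case unfolding L_def h_def y_def Q_def Wm_def .
    qed
  qed
qed

lemma logB_logA_sq_le:
  assumes "2 \<le> T" "1 \<le> k"
  shows "logB T k * (logA T k)\<^sup>2 \<le> 27 * ((real k)\<^sup>2 * tau k ^ 3 * ln (real T) ^ 3)"
proof -
  note lf = log_scale_bounds[OF assms]
  have "logB T k * (logA T k)\<^sup>2 \<le> (3 * (ln (real T) * tau k)) * (3 * (real k * ln (real T) * tau k))\<^sup>2"
    using lf(3,11) lf(14,15) by (intro mult_mono power_mono) auto
  also have "\<dots> = 27 * ((real k)\<^sup>2 * tau k ^ 3 * ln (real T) ^ 3)"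
    by (simp add: power_mult_distrib power2_eq_square power3_eq_cube mult_ac)
  finally show ?thesis .
qed

lemma dim_vaw_weights:
  assumes "0 < lam" "\<And>t. a t \<in> carrier_vec n"
  shows "dim_vec (vaw_weights lam n a b t) = n"
proof -
  interpret vaw_data lam n a b by unfold_locales (use assms in auto)
  show ?thesis unfolding vaw_weights_def Ginv_def[symmetric] by (simp add: carrier_matD(1)[OF Ginv(1)])
qed

lemma learnable_params_eq:
  assumes "0 < lam"
  shows "learnable_params m p k L h T \<phi> lam u y = p * feat_dim m k L h"
  unfolding learnable_params_def unified_weights_def
  by (simp add: dim_vaw_weights[OF assms] carrier_vecI)

text \<open>The logarithms of \<open>L_ustb\<close> and \<open>L_tilde\<close> are O(k log k), and
  the square root of T adds at most ln T, so the weights are exp (O(A)). In the exponent, 3 is the 2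
  from \<open>L_tilde_bounds\<close> plus 1 for ln T \<le> A.\<close>

lemma weight_bound_le:
  assumes sys: "lds_system d m p A B C k" and blk: "lds_blocks k A B C Au Bst Bu Bf Cst Cu Cf V W"
    and M: "0 \<le> M" and mb: "mode_bound M Au Bst Bu Bf Cst Cu Cf V W" and T: "2 \<le> T"
  shows "weight_bound k A Au Bu Cu Bst Cst (fast_gain Bf Cf V W) (sqrt (real T))
    \<le> (1 + M + 3 * M\<^sup>2) * exp ((3 + lu_const m M - ln min_rate) * logA T k)"
proof -
  have k: "1 \<le> k" using sys instability_complexity_bounds[of A d k] by (auto simp: lds_system_def)
  note lf = log_scale_bounds[OF T k]
  let ?A = "logA T k" and ?Lu = "L_ustb k A Au Bu Cu" and ?c = "lu_const m M" and ?Gf = "fast_gain Bf Cf V W"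
  let ?X = "exp ((3 + ?c - ln min_rate) * ?A)"
  have c: "0 \<le> ?c" by (rule lu_const_nonneg[OF M])
  have lnLu: "ln ?Lu \<le> ?c * (real k * tau k)"
    using mb by (intro ln_L_ustb_le[OF sys blk M]) (auto simp: mode_bound_def)
  note Lu = L_ustb_ge[OF k, of A Au Bu Cu] and lt = L_tilde_bounds[OF k L_ustb_ge(2)[OF k] lnLu]
  have M': "frob_norm Bst \<le> M" "frob_norm Cst \<le> M" "?Gf \<le> M" "0 \<le> ?Gf"
    using mb by (auto simp: mode_bound_def fast_gain_def spectral_norm_nonneg)
  have r: "0 < 1 - 1 / tau k" using rate_bounds[OF k] min_rate by linarith
  have rp: "1 \<le> root_prod k A" by (rule root_prod_ge_1)
  define F where "F = frob_norm Cst * frob_norm Bst"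
  have F: "0 \<le> F" "F \<le> M\<^sup>2"
    unfolding F_def power2_eq_square using M' M frob_norm_nonneg by (auto intro!: mult_mono mult_nonneg_nonneg)
  have "ln ?Lu \<le> (3 + ?c - ln min_rate) * ?A"
  proof -
    have "?c * (real k * tau k) \<le> (3 + ?c - ln min_rate) * ?A"
      using c lf(9,11) neg_ln_min_rate lf(12) by (intro mult_mono) auto
    then show ?thesis using lnLu by linarith
  qed
  then have "exp (ln ?Lu) \<le> ?X" by simp
  then have LuX: "?Lu \<le> ?X" using Lu(2) by simp
  have "root_prod k A * (1 + unstable_gain Au Bu Cu + F + ?Gf)
      = root_prod k A * (1 + unstable_gain Au Bu Cu) + root_prod k A * (F + ?Gf)"
    by (simp add: algebra_simps)
  also have "\<dots> \<le> ?Lu + ?Lu * (M\<^sup>2 + M)"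
    using Lu rp F M' by (intro add_mono mult_mono) auto
  also have "\<dots> = ?Lu * (1 + M\<^sup>2 + M)" by (simp add: algebra_simps)
  also have "\<dots> \<le> ?X * (1 + M\<^sup>2 + M)" using LuX M by (intro mult_right_mono) auto
  finally have 1: "root_prod k A * (1 + unstable_gain Au Bu Cu + F + ?Gf) \<le> ?X * (1 + M\<^sup>2 + M)" .
  have "root_prod k A / (1 - 1 / tau k) ^ k \<le> ?Lu / (1 - 1 / tau k) ^ k"
    using Lu(1) r by (intro divide_right_mono) auto
  then have rl: "root_prod k A / (1 - 1 / tau k) ^ k \<le> L_tilde k ?Lu" using lt(2) by linarith
  have Tr: "1 \<le> real T" using T by simp
  have "sqrt (real T) \<le> real T"
    using Tr by (intro real_le_lsqrt) (auto simp: power2_eq_square)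
  then have sT: "1 + sqrt (real T) \<le> 2 * real T" using Tr by linarith
  have lX: "L_tilde k ?Lu * real T \<le> ?X"
  proof -
    have "ln (L_tilde k ?Lu * real T) = ln (L_tilde k ?Lu) + ln (real T)"
      using lt(1) Tr by (simp add: ln_mult)
    also have "\<dots> \<le> (2 + ?c - ln min_rate) * (real k * tau k) + ?A" using lt(4) lf(10) by linarith
    also have "\<dots> \<le> (2 + ?c - ln min_rate) * ?A + ?A"
      using c neg_ln_min_rate lf(9) by (intro add_mono mult_left_mono) auto
    also have "\<dots> = (3 + ?c - ln min_rate) * ?A" by (simp add: algebra_simps)
    finally have "exp (ln (L_tilde k ?Lu * real T)) \<le> ?X" by simp
    moreover have "0 < L_tilde k ?Lu * real T" using lt(1) Tr by (intro mult_pos_pos) linarith+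
    ultimately show ?thesis by simp
  qed
  have "F * (root_prod k A / (1 - 1 / tau k) ^ k) * (1 + sqrt (real T)) \<le> M\<^sup>2 * L_tilde k ?Lu * (2 * real T)"
    using F rl rp r sT lt(1) by (intro mult_mono mult_nonneg_nonneg) auto
  also have "\<dots> = 2 * M\<^sup>2 * (L_tilde k ?Lu * real T)" by simp
  also have "\<dots> \<le> 2 * M\<^sup>2 * ?X" by (rule mult_left_mono[OF lX]) simp
  finally have "F * (root_prod k A / (1 - 1 / tau k) ^ k) * (1 + sqrt (real T)) \<le> 2 * M\<^sup>2 * ?X" .
  then have "weight_bound k A Au Bu Cu Bst Cst ?Gf (sqrt (real T)) \<le> ?X * (1 + M\<^sup>2 + M) + 2 * M\<^sup>2 * ?X"
    unfolding weight_bound_def using 1 by (simp only: F_def[symmetric])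
  also have "\<dots> = (1 + M + 3 * M\<^sup>2) * ?X" by (simp add: algebra_simps)
  finally show ?thesis .
qed

lemma weight_bound_nonneg:
  assumes "1 \<le> k" "0 \<le> Gf" "0 \<le> \<Theta>"
  shows "0 \<le> weight_bound k A Au Bu Cu Bst Cst Gf \<Theta>"
proof -
  have "0 \<le> root_prod k A" "0 < 1 - 1 / tau k"
    using root_prod_ge_1[of k A] rate_bounds[OF assms(1)] min_rate by linarith+
  then show ?thesis unfolding weight_bound_def using assms unstable_gain_nonneg[of Au Bu Cu]
    by (intro add_nonneg_nonneg mult_nonneg_nonneg divide_nonneg_nonneg zero_le_power)
      (auto simp: frob_norm_nonneg)
qed

text \<open>Reduces the statement on one fixed system to the uniform estimate.\<close>

lemma mode_bound_exists:
  obtains M where "0 \<le> M" "mode_bound M Au Bst Bu Bf Cst Cu Cf V W"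
proof -
  define S where "S = elements_mat Au \<union> elements_mat Bu \<union> elements_mat Cu"
  define M where "M = (\<Sum>x\<in>S. \<bar>x\<bar>) + frob_norm Bst + frob_norm Cst + fast_gain Bf Cf V W"
  have fin: "finite S" by (simp add: S_def elements_mat_def)
  have Gf: "0 \<le> fast_gain Bf Cf V W" by (simp add: fast_gain_def spectral_norm_nonneg)
  have s0: "0 \<le> (\<Sum>x\<in>S. \<bar>x\<bar>)" by (simp add: sum_nonneg)
  have "\<bar>x\<bar> \<le> (\<Sum>x\<in>S. \<bar>x\<bar>)" if "x \<in> S" for x using fin that by (intro member_le_sum) auto
  then have el: "\<forall>x\<in>S. \<bar>x\<bar> \<le> M"
    using Gf frob_norm_nonneg[of Bst] frob_norm_nonneg[of Cst] unfolding M_def by fastforce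
  show thesis
  proof (rule that)
    show "0 \<le> M" using Gf s0 frob_norm_nonneg[of Bst] frob_norm_nonneg[of Cst] by (simp add: M_def)
    show "mode_bound M Au Bst Bu Bf Cst Cu Cf V W"
      unfolding mode_bound_def S_def[symmetric]
      using el Gf s0 frob_norm_nonneg[of Bst] frob_norm_nonneg[of Cst] by (simp add: M_def)
  qed
qed

text \<open>There are finitely many slow eigenvalues, all of modulus below 1, so the geometric
  series with limits 1 / (1 - x^2) give a bound that does not depend on T.\<close>

lemma slow_moment_bound:
  assumes A: "A \<in> carrier_mat d d"
  obtains \<Theta> where "0 \<le> \<Theta>" "\<And>x T. complex_of_real x \<in> slow_eigs k A \<Longrightarrow> (\<Sum>i<T. (x ^ i)\<^sup>2) \<le> \<Theta>\<^sup>2"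
proof -
  define S where "S = {x. complex_of_real x \<in> slow_eigs k A}"
  have lt: "\<bar>x\<bar> < 1" if "x \<in> S" for x using that by (auto simp: S_def slow_eigs_def)
  have "finite (complex_of_real ` S)"
    by (rule finite_subset[OF _ finite_eigenvalues[OF A]]) (auto simp: S_def slow_eigs_def)
  then have fin: "finite S" by (rule finite_imageD) (simp add: inj_on_def)
  have pos: "0 < 1 - x\<^sup>2" if "x \<in> S" for x using lt[OF that] by (simp add: abs_square_less_1)
  define \<Theta> where "\<Theta> = sqrt (\<Sum>x\<in>S. 1 / (1 - x\<^sup>2))"
  have s0: "0 \<le> (\<Sum>x\<in>S. 1 / (1 - x\<^sup>2))" using pos by (intro sum_nonneg) (simp add: less_imp_le)
  show thesis
  proof (rule that[of \<Theta>])
    show "0 \<le> \<Theta>" using s0 by (simp add: \<Theta>_def)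
    fix x T assume "complex_of_real x \<in> slow_eigs k A"
    then have x: "x \<in> S" by (simp add: S_def)
    have "(\<Sum>i<T. (x ^ i)\<^sup>2) = (\<Sum>i<T. (x\<^sup>2) ^ i)" by (simp add: power_mult[symmetric] mult.commute)
    also have "\<dots> = (1 - (x\<^sup>2) ^ T) / (1 - x\<^sup>2)" using pos[OF x] by (subst sum_gp_strict) auto
    also have "\<dots> \<le> 1 / (1 - x\<^sup>2)" using pos[OF x] by (intro divide_right_mono) auto
    also have "\<dots> \<le> (\<Sum>x\<in>S. 1 / (1 - x\<^sup>2))"
      using fin x pos by (intro member_le_sum) (auto simp: less_imp_le)
    also have "\<dots> = \<Theta>\<^sup>2" using s0 by (simp add: \<Theta>_def)
    finally show "(\<Sum>i<T. (x ^ i)\<^sup>2) \<le> \<Theta>\<^sup>2" .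
  qed
qed

theorem theorem21:
  fixes m p :: nat and M K By c\<^sub>1 c\<^sub>2 :: real
  assumes "0 \<le> K" and "0 < c\<^sub>1" and "c\<^sub>1 \<le> c\<^sub>2"
  shows
    "(\<exists>c > 0. \<exists>e :: nat. \<exists>lam :: nat \<Rightarrow> nat \<Rightarrow> real. (\<forall>T k. lam T k > 0) \<and>
       (\<forall>d A B C k Au Bst Bu Bf Cst Cu Cf V W T \<epsilon> \<phi> \<sigma>.
          lds_system d m p A B C k \<longrightarrow>
          lds_blocks k A B C Au Bst Bu Bf Cst Cu Cf V W \<longrightarrow>
          mode_bound M Au Bst Bu Bf Cst Cu Cf V W \<longrightarrow>
          T \<ge> 2 \<longrightarrow> \<epsilon> \<in> approx_levels c\<^sub>1 c\<^sub>2 T k \<longrightarrow> spectral_filters T \<phi> \<sigma> \<longrightarrow>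
          (let Lu = L_ustb k A Au Bu Cu;
               h = filter_count T k K Lu Bst Cst \<epsilon>;
               L = memory_length T k K Lu (fast_gain Bf Cf V W) \<epsilon>
           in
             real h \<le> c * (real k * ln (real T) * ln ((real T * (real k + 2) * (1 + 1 / \<epsilon>)) ^ e)) \<and>
             real h \<le> c * (real k * ln (real T * (real k + 2)) ^ e) \<and>
             ln Lu \<le> c * (real k * ln (real k + 2)) \<and>
             real L \<le> c * (ln (real k + 2) * ln ((real T * (real k + 2)) ^ e * Lu\<^sup>2 / \<epsilon>)) \<and>
             real L \<le> c * (real k * ln (real T * (real k + 2) * (1 + 1 / \<epsilon>)) ^ e) \<and>
             real L \<le> c * (real k * ln (real T * (real k + 2)) ^ e) \<and>
             (\<forall>u. controlled_run d m A B C K By u \<longrightarrow>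
                (let y = lds_output d A B C u;
                     n = real (learnable_params m p k L h T \<phi> (lam T k) u y)
                 in
                   avg_error m p k L h T \<phi> (lam T k) u y
                     \<le> c * ((real k)\<^sup>2 * ln (real k + 2) ^ 3 * ln (real T) ^ 3 / real T) \<and>
                   n \<le> c * (real p * (real k + real m * (real L + real k + 1) + real h * real m)) \<and>
                   n \<le> c * (real k * ln (real T) * ln (real T * (real k + 2)) ^ e) \<and>
                   n \<le> c * (real k * ln (real T * (real k + 2)) ^ e))))))
     \<and>
     (\<forall>d A B C k Au Bst Bu Bf Cst Cu Cf V W lam.
        lds_system d m p A B C k \<longrightarrow>
        lds_blocks k A B C Au Bst Bu Bf Cst Cu Cf V W \<longrightarrow>
        lam > 0 \<longrightarrow>
        (\<exists>c > 0. \<forall>T \<epsilon> \<phi> \<sigma> u.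
           T \<ge> 2 \<longrightarrow> \<epsilon> \<in> approx_levels c\<^sub>1 c\<^sub>2 T k \<longrightarrow> spectral_filters T \<phi> \<sigma> \<longrightarrow>
           controlled_run d m A B C K By u \<longrightarrow>
           (let Lu = L_ustb k A Au Bu Cu;
                h = filter_count T k K Lu Bst Cst \<epsilon>;
                L = memory_length T k K Lu (fast_gain Bf Cf V W) \<epsilon>
            in avg_error m p k L h T \<phi> lam u (lds_output d A B C u)
                 \<le> c * ((real k)\<^sup>2 * ln (real k + 2) ^ 3 * ln (real T) ^ 3 / real T))))"
proof (rule conjI, goal_cases)
  case 1
  \<comment> \<open>\<open>M\<close> carries no sign condition, while the estimates want a
    nonnegative bound; \<open>mode_bound\<close> is monotone in it.\<close>
  define M\<^sub>0 where "M\<^sub>0 = \<bar>M\<bar>"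
  have M0: "0 \<le> M\<^sub>0" by (simp add: M\<^sub>0_def)
  define c\<^sub>0 where "c\<^sub>0 = lu_const m M\<^sub>0"
  have c0: "0 \<le> c\<^sub>0" unfolding c\<^sub>0_def by (rule lu_const_nonneg[OF M0])
  show ?case
  proof (rule parameter_count_bounds[OF M0 assms c0, where m = m and p = p],
      rule avg_error_le[OF assms M0, where m = m and p = p and By = By], goal_cases)
    case (1 cs e ca)
    note cs = 1(1) and size = 1(2) and ca = 1(3) and core = 1(4)
    \<comment> \<open>Twice the exponent of \<open>weight_bound_le\<close>, because
      \<open>lam\<close> multiplies the squared weights. The product is then bounded by
      \<open>C1\<close>, and the logarithm of 1 / \<open>lam\<close> is linear in A.\<close>
    define c9 where "c9 = 2 * (3 + c\<^sub>0 - ln min_rate)"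
    define C1 where "C1 = (1 + M\<^sub>0 + 3 * M\<^sub>0\<^sup>2)\<^sup>2"
    define lam where "lam T k = exp (- (c9 * logA T k))" for T k
    define c10 where "c10 = 27 * (ca * (C1 + 2 + c9))"
    define cc where "cc = cs + c10 + c\<^sub>0 + 1"
    have c9: "0 \<le> c9" unfolding c9_def using c0 neg_ln_min_rate by simp
    have C1: "0 \<le> C1" by (simp add: C1_def)
    have c10: "0 \<le> c10" unfolding c10_def using ca C1 c9 by simp
    have cc: "0 < cc" "cs \<le> cc" "c10 \<le> cc" "c\<^sub>0 \<le> cc" "1 \<le> cc"
      unfolding cc_def using cs c10 c0 by linarith+
    show ?case
    proof (intro exI[of _ cc] exI[of _ e] exI[of _ lam] conjI cc(1) allI impI, goal_cases)
      case (1 T k)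
      show ?case by (simp add: lam_def)
    next
      case (2 d A B C k Au Bst Bu Bf Cst Cu Cf V W T \<epsilon> \<phi> \<sigma>)
      note sys = 2(1) and blk = 2(2) and T = 2(4) and eps = 2(5) and sf = 2(6)
      have mb: "mode_bound M\<^sub>0 Au Bst Bu Bf Cst Cu Cf V W"
        using 2(3) unfolding mode_bound_def M\<^sub>0_def by (meson abs_ge_self order_trans)
      have k: "1 \<le> k" using sys instability_complexity_bounds[of A d k] by (auto simp: lds_system_def)
      note lf = log_scale_bounds[OF T k]
      define Lu where "Lu = L_ustb k A Au Bu Cu"
      define Gf where "Gf = fast_gain Bf Cf V W"
      define h where "h = filter_count T k K Lu Bst Cst \<epsilon>"
      define L where "L = memory_length T k K Lu Gf \<epsilon>"
      have Lu: "1 \<le> Lu" unfolding Lu_def by (rule L_ustb_ge[OF k])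
      have lnLu: "ln Lu \<le> c\<^sub>0 * (real k * tau k)"
        unfolding Lu_def c\<^sub>0_def using mb by (intro ln_L_ustb_le[OF sys blk M0]) (auto simp: mode_bound_def)
      have M': "frob_norm Bst \<le> M\<^sub>0" "frob_norm Cst \<le> M\<^sub>0" "0 \<le> Gf" "Gf \<le> M\<^sub>0"
        using mb by (auto simp: mode_bound_def Gf_def fast_gain_def spectral_norm_nonneg)
      note sz = size[OF T k Lu lnLu M' eps h_def L_def]
      have up: "x \<le> cc * w" if "x \<le> b * w" "b \<le> cc" "0 \<le> w" for x b w :: real
        using that(1) mult_right_mono[OF that(2,3)] by linarith
      have up': "x \<le> cc * w" if "x \<le> cs * w" "0 \<le> x" for x w :: real
      proof -
        have "0 \<le> cs * w" using that by linarith
        then have "0 \<le> w" using cs by (simp add: zero_le_mult_iff)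
        then show ?thesis by (rule up[OF that(1) cc(2)])
      qed
      have kt: "0 \<le> real k * tau k" using lf(12) by linarith
      have err: "avg_error m p k L h T \<phi> (lam T k) u (lds_output d A B C u)
          \<le> cc * ((real k)\<^sup>2 * tau k ^ 3 * ln (real T) ^ 3 / real T)"
        if u: "controlled_run d m A B C K By u" for u
      proof -
        let ?A = "logA T k" and ?B = "logB T k"
        define Wm where "Wm = weight_bound k A Au Bu Cu Bst Cst Gf (sqrt (real T))"
        \<comment> \<open>Over all systems the slow eigenvalues can approach modulus 1, so only the
          square root of T is available for \<Theta>.\<close>
        have sl: "(\<Sum>i<T. (x ^ i)\<^sup>2) \<le> (sqrt (real T))\<^sup>2" if "complex_of_real x \<in> slow_eigs k A" for x
        proof -
          have x: "\<bar>x\<bar> \<le> 1" using that by (auto simp: slow_eigs_def)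
          have "(\<Sum>i<T. (x ^ i)\<^sup>2) \<le> (\<Sum>i<T. 1)"
          proof (rule sum_mono)
            fix i
            have "\<bar>x ^ i\<bar> \<le> 1" using x by (simp add: power_abs power_le_one)
            then show "(x ^ i)\<^sup>2 \<le> 1" by (simp only: abs_square_le_1)
          qed
          then show ?thesis by simp
        qed
        have W: "0 \<le> Wm" unfolding Wm_def by (rule weight_bound_nonneg[OF k M'(3)]) simp
        have "Wm \<le> (1 + M\<^sub>0 + 3 * M\<^sub>0\<^sup>2) * exp (c9 / 2 * ?A)"
        proof -
          have "c9 / 2 = 3 + lu_const m M\<^sub>0 - ln min_rate" by (simp add: c9_def c\<^sub>0_def)
          then show ?thesis
            unfolding Wm_def Gf_def by (simp only: weight_bound_le[OF sys blk M0 mb T])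
        qed
        then have "Wm\<^sup>2 \<le> ((1 + M\<^sub>0 + 3 * M\<^sub>0\<^sup>2) * exp (c9 / 2 * ?A))\<^sup>2" using W by (intro power_mono)
        also have "\<dots> = C1 * exp (c9 * ?A)"
          by (simp add: C1_def power_mult_distrib exp_double[symmetric])
        finally have "lam T k * Wm\<^sup>2 \<le> lam T k * (C1 * exp (c9 * ?A))"
          by (intro mult_left_mono) (auto simp: lam_def)
        also have "\<dots> = C1" by (simp add: lam_def exp_minus)
        finally have 1: "lam T k * Wm\<^sup>2 \<le> C1" .
        have 2: "ln (1 + 1 / lam T k) \<le> 1 + c9 * ?A"
        proof -
          have "1 \<le> exp (c9 * ?A)" using c9 lf(11) by simp
          moreover have "1 / lam T k = exp (c9 * ?A)" by (simp add: lam_def exp_minus inverse_eq_divide)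
          ultimately have "1 + 1 / lam T k \<le> 2 * exp (c9 * ?A)" by linarith
          moreover have "0 < 1 + 1 / lam T k" by (simp add: lam_def add_pos_pos)
          ultimately have "ln (1 + 1 / lam T k) \<le> ln (2 * exp (c9 * ?A))" by (intro ln_mono) auto
          also have "\<dots> = ln 2 + c9 * ?A" by (simp add: ln_mult)
          finally show ?thesis using ln_2_less_1 by linarith
        qed
        have "C1 * 1 \<le> C1 * ?A" using C1 lf(11) by (intro mult_left_mono)
        then have Q: "lam T k * Wm\<^sup>2 + ?A + ln (1 + 1 / lam T k) \<le> (C1 + 2 + c9) * ?A"
          unfolding distrib_right using 1 2 lf(11) by linarith
        have "avg_error m p k L h T \<phi> (lam T k) u (lds_output d A B C u)
            \<le> ca * (?B * ?A * (lam T k * Wm\<^sup>2 + ?A + ln (1 + 1 / lam T k))) / real T"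
          unfolding L_def h_def Lu_def Gf_def Wm_def
          by (rule core[OF sys blk mb T eps sf u sl]) (simp_all add: lam_def)
        also have "\<dots> \<le> ca * (?B * ?A * ((C1 + 2 + c9) * ?A)) / real T"
          using Q ca lf(3,11) by (intro divide_right_mono mult_left_mono) auto
        also have "\<dots> = (ca * (C1 + 2 + c9)) * (?B * ?A\<^sup>2) / real T" by (simp add: power2_eq_square)
        also have "\<dots> \<le> (ca * (C1 + 2 + c9)) * (27 * ((real k)\<^sup>2 * tau k ^ 3 * ln (real T) ^ 3)) / real T"
          using ca C1 c9 by (intro divide_right_mono mult_left_mono logB_logA_sq_le[OF T k]) auto
        also have "\<dots> = c10 * ((real k)\<^sup>2 * tau k ^ 3 * ln (real T) ^ 3 / real T)"
          by (simp add: c10_def)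
        finally show ?thesis
          by (rule up[OF _ cc(3)]) (use lf(1,2) in simp)
      qed
      have n: "real (learnable_params m p k L h T \<phi> (lam T k) u y) = real (p * feat_dim m k L h)" for u y
        by (subst learnable_params_eq) (simp_all add: lam_def)
      have n': "real (p * feat_dim m k L h)
          \<le> cc * (real p * (real k + real m * (real L + real k + 1) + real h * real m))"
      proof -
        have "real (p * feat_dim m k L h) = 1 * (real p * (real k + real m * (real L + real k + 1) + real h * real m))"
          by (simp add: feat_dim_def algebra_simps)
        also have "\<dots> \<le> cc * (real p * (real k + real m * (real L + real k + 1) + real h * real m))"
          by (rule mult_right_mono[OF cc(5)]) simp
        finally show ?thesis .
      qed
      show ?case
        unfolding Let_def tau_def[symmetric] Lu_def[symmetric] Gf_def[symmetric] h_def[symmetric]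
          L_def[symmetric] n
        using sz n' err up[OF lnLu cc(4) kt] by (blast intro: up' of_nat_0_le_iff)
    qed
  qed
next
  case 2
  show ?case
  proof (intro allI impI, goal_cases)
    case (1 d A B C k Au Bst Bu Bf Cst Cu Cf V W lam)
    note sys = 1(1) and blk = 1(2) and lam = 1(3)
    obtain M\<^sub>0 where M0: "0 \<le> M\<^sub>0" and mb: "mode_bound M\<^sub>0 Au Bst Bu Bf Cst Cu Cf V W"
      by (rule mode_bound_exists)
    have A: "A \<in> carrier_mat d d" using sys by (simp add: lds_system_def)
    have k: "1 \<le> k" using sys instability_complexity_bounds[OF A] by (auto simp: lds_system_def)
    obtain \<Theta> where \<Theta>: "0 \<le> \<Theta>" "\<And>x T. complex_of_real x \<in> slow_eigs k A \<Longrightarrow> (\<Sum>i<T. (x ^ i)\<^sup>2) \<le> \<Theta>\<^sup>2"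
      by (rule slow_moment_bound[OF A]) blast
    show ?case
    proof (rule avg_error_le[OF assms M0, where m = m and p = p and By = By], goal_cases)
      case (1 ca)
      note ca = 1(1) and core = 1(2)
      \<comment> \<open>With \<Theta> independent of T this is a constant of the system, so
        \<open>lam\<close> times its square is a constant for any fixed \<open>lam\<close>.\<close>
      define Wm where "Wm = weight_bound k A Au Bu Cu Bst Cst (fast_gain Bf Cf V W) \<Theta>"
      define Q where "Q = lam * Wm\<^sup>2 + 1 + ln (1 + 1 / lam)"
      have ln0: "0 \<le> ln (1 + 1 / lam)" using lam by simp
      have Q: "1 \<le> Q" unfolding Q_def using lam ln0 by simp
      show ?case
      proof (intro exI[of _ "27 * (ca * Q)"] conjI allI impI, goal_cases)
        case 1
        show ?case using ca Q by simp
      next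
        case (2 T \<epsilon> \<phi> \<sigma> u)
        note T = 2(1) and eps = 2(2) and sf = 2(3) and u = 2(4)
        note lf = log_scale_bounds[OF T k]
        let ?A = "logA T k" and ?B = "logB T k"
        let ?err = "avg_error m p k (memory_length T k K (L_ustb k A Au Bu Cu) (fast_gain Bf Cf V W) \<epsilon>)
          (filter_count T k K (L_ustb k A Au Bu Cu) Bst Cst \<epsilon>) T \<phi> lam u (lds_output d A B C u)"
        have "?err \<le> ca * (?B * ?A * (lam * Wm\<^sup>2 + ?A + ln (1 + 1 / lam))) / real T"
          unfolding Wm_def by (rule core[OF sys blk mb T eps sf u \<Theta>(2,1) lam])
        also have "\<dots> \<le> ca * (?B * ?A * (Q * ?A)) / real T"
        proof -
          have "lam * Wm\<^sup>2 * 1 \<le> lam * Wm\<^sup>2 * ?A" "ln (1 + 1 / lam) * 1 \<le> ln (1 + 1 / lam) * ?A"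
            by (rule mult_left_mono[OF lf(11)], use lam ln0 in simp)+
          then have "lam * Wm\<^sup>2 + ?A + ln (1 + 1 / lam) \<le> Q * ?A"
            unfolding Q_def distrib_right by linarith
          then show ?thesis using ca lf(3,11) by (intro divide_right_mono mult_left_mono) auto
        qed
        also have "\<dots> = (ca * Q) * (?B * ?A\<^sup>2) / real T" by (simp add: power2_eq_square)
        also have "\<dots> \<le> (ca * Q) * (27 * ((real k)\<^sup>2 * tau k ^ 3 * ln (real T) ^ 3)) / real T"
          using ca Q by (intro divide_right_mono mult_left_mono logB_logA_sq_le[OF T k]) auto
        also have "\<dots> = 27 * (ca * Q) * ((real k)\<^sup>2 * tau k ^ 3 * ln (real T) ^ 3 / real T)" by simp
        finally show ?case
          unfolding Let_def tau_def .
      qed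
    qed
  qed
qed

end
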